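(* Let $A$ be a commutative ring, let $\mathfrak{a}$ be a weakly proregular ideal in $A$, let $\widehat{A}$ be the $\mathfrak{a}$-adic completion of $A$, and let $\widehat{\mathfrak{a}} := \widehat{A}\cdot\mathfrak{a}$, the ideal in $\widehat{A}$ generated by $\mathfrak{a}$. Then the ideal $\widehat{\mathfrak{a}}$ is weakly proregular (as an ideal of $\widehat{A}$).
   Context: All rings are commutative. The $\mathfrak{a}$-adic completion of $A$ is the ring $\widehat{A}:=\lim_{\leftarrow k}A/\mathfrak{a}^{k+1}$. Weak proregularity: for a commutative ring $A$ and $a \in A$ let $\operatorname{K}(A;a)$ be the Koszul complex $0 \to A \xrightarrow{a\cdot(-)} A \to 0$ concentrated in degrees $-1$ and $0$. For a finite sequence $\boldsymbol{a}=(a_1,\ldots,a_p)$ in $A$, $p \ge 1$, let $\operatorname{K}(A;\boldsymbol{a}) := \operatorname{K}(A;a_1)\otimes_A\cdots\otimes_A \operatorname{K}(A;a_p)$, and $\boldsymbol{a}^j := (a_1^j,\ldots,a_p^j)$. For $j_1\ge j_0\ge 1$ there is a homomorphism of complexes $\operatorname{K}(A;\boldsymbol{a}^{j_1})\to \operatorname{K}(A;\boldsymbol{a}^{j_0})$, the tensor product over $i$ of the homomorphisms $\operatorname{K}(A;a_i^{j_1})\to \operatorname{K}(A;a_i^{j_0})$ that are the identity in degree $0$ and multiplication by $a_i^{j_1-j_0}$ in degree $-1$. An inverse system of modules $\{N_j\}$ is pro-zero if for every $j_0$ there is $j_1\ge j_0$ such that $N_{j_1}\to N_{j_0}$ is zero.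 The sequence $\boldsymbol{a}$ is weakly proregular if for every $i\le -1$ the inverse system $\{\operatorname{H}^i(\operatorname{K}(A;\boldsymbol{a}^j))\}_{j\ge 1}$ is pro-zero. An ideal is weakly proregular if it is generated by some (finite) weakly proregular sequence. *)

theory Defs
  imports "HOL-Algebra.Module" "HOL-Algebra.QuotRing" "HOL-Algebra.Ideal_Product"
begin

text \<open>
  Modules are records in the sense of \<^theory>\<open>HOL-Algebra.Module\<close>; their fields \<open>mult\<close> and \<open>one\<close>
  play no role and are left undefined in the constructions below.
\<close>

definition regular_module :: "('a, 'r) ring_scheme \<Rightarrow> ('a, 'a) module" where
  "regular_module R =
     \<lparr>carrier = carrier R, mult = undefined, one = undefined,
      zero = \<zero>\<^bsub>R\<^esub>, add = add R, smult = mult R\<rparr>"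

definition zero_module :: "('a, 'r) ring_scheme \<Rightarrow> ('a, 'a) module" where
  "zero_module R = (regular_module R)\<lparr>carrier := {\<zero>\<^bsub>R\<^esub>}\<rparr>"

definition quotient_module :: "('a, 'b) module \<Rightarrow> 'b set \<Rightarrow> ('a, 'b set) module" where
  "quotient_module M N =
     \<lparr>carrier = a_rcosets\<^bsub>M\<^esub> N, mult = undefined, one = undefined,
      zero = N, add = set_add M,
      smult = (\<lambda>r X. \<Union>x\<in>X. N +>\<^bsub>M\<^esub> (r \<odot>\<^bsub>M\<^esub> x))\<rparr>"

text \<open>The map induced by \<open>f\<close> on quotients, where \<open>N'\<close> is the submodule of the target \<open>M'\<close>.\<close>

definition quotient_map :: "('a, 'c) module \<Rightarrow> 'c set \<Rightarrow> ('b \<Rightarrow> 'c) \<Rightarrow> 'b set \<Rightarrow> 'c set" where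
  "quotient_map M' N' f X = N' <+>\<^bsub>M'\<^esub> (f ` X)"

definition submodule_span :: "('a, 'r) ring_scheme \<Rightarrow> ('a, 'b) module \<Rightarrow> 'b set \<Rightarrow> 'b set" where
  "submodule_span R M S = \<Inter>{N. submodule N R M \<and> S \<subseteq> N}"

definition direct_sum_module ::
    "('a, 'r) ring_scheme \<Rightarrow> 'i set \<Rightarrow> ('i \<Rightarrow> ('a, 'b) module) \<Rightarrow> ('a, 'i \<Rightarrow> 'b) module" where
  "direct_sum_module R I M =
     \<lparr>carrier = {t \<in> (\<Pi>\<^sub>E i\<in>I. carrier (M i)). finite {i \<in> I. t i \<noteq> \<zero>\<^bsub>M i\<^esub>}},
      mult = undefined, one = undefined,
      zero = (\<lambda>i\<in>I. \<zero>\<^bsub>M i\<^esub>),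
      add = (\<lambda>s t. \<lambda>i\<in>I. s i \<oplus>\<^bsub>M i\<^esub> t i),
      smult = (\<lambda>r t. \<lambda>i\<in>I. r \<odot>\<^bsub>M i\<^esub> t i)\<rparr>"

definition free_module :: "('a, 'r) ring_scheme \<Rightarrow> 'x set \<Rightarrow> ('a, 'x \<Rightarrow> 'a) module" where
  "free_module R X = direct_sum_module R X (\<lambda>_. regular_module R)"

definition free_gen :: "('a, 'r) ring_scheme \<Rightarrow> 'x set \<Rightarrow> 'x \<Rightarrow> 'x \<Rightarrow> 'a" where
  "free_gen R X x = (\<lambda>y\<in>X. if y = x then \<one>\<^bsub>R\<^esub> else \<zero>\<^bsub>R\<^esub>)"

text \<open>The linear map between free modules that sends the generator \<open>x \<in> X\<close> to the generator \<open>\<phi> x \<in> Y\<close>.\<close>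

definition free_map ::
    "('a, 'r) ring_scheme \<Rightarrow> 'x set \<Rightarrow> 'y set \<Rightarrow> ('x \<Rightarrow> 'y) \<Rightarrow> ('x \<Rightarrow> 'a) \<Rightarrow> 'y \<Rightarrow> 'a" where
  "free_map R X Y \<phi> t = (\<lambda>y\<in>Y. \<Oplus>\<^bsub>R\<^esub>x\<in>{x \<in> X. t x \<noteq> \<zero>\<^bsub>R\<^esub> \<and> \<phi> x = y}. t x)"

text \<open>
  The tensor product of \<open>M 0, \<dots>, M (p - 1)\<close>, for \<open>p \<ge> 1\<close>, is formed in one step rather than by
  iterating a binary tensor product: the type of an iterated tensor product would depend on \<open>p\<close>.
  It is the free module on the product of the carriers, modulo the relations which make
  the tuple of factors a multilinear expression.
\<close>

definition tensor_tuples :: "nat \<Rightarrow> (nat \<Rightarrow> ('a, 'b) module) \<Rightarrow> (nat \<Rightarrow> 'b) set" where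
  "tensor_tuples p M = (\<Pi>\<^sub>E i\<in>{..<p}. carrier (M i))"

definition tensor_free ::
    "('a, 'r) ring_scheme \<Rightarrow> nat \<Rightarrow> (nat \<Rightarrow> ('a, 'b) module) \<Rightarrow> ('a, (nat \<Rightarrow> 'b) \<Rightarrow> 'a) module" where
  "tensor_free R p M = free_module R (tensor_tuples p M)"

definition tensor_relations ::
    "('a, 'r) ring_scheme \<Rightarrow> nat \<Rightarrow> (nat \<Rightarrow> ('a, 'b) module) \<Rightarrow> ((nat \<Rightarrow> 'b) \<Rightarrow> 'a) set" where
  "tensor_relations R p M =
     (let F = tensor_free R p M; e = free_gen R (tensor_tuples p M) in
      submodule_span R F
        ({e (x(i := u \<oplus>\<^bsub>M i\<^esub> v)) \<ominus>\<^bsub>F\<^esub> (e (x(i := u)) \<oplus>\<^bsub>F\<^esub> e (x(i := v))) | x i u v.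
            x \<in> tensor_tuples p M \<and> i < p \<and> u \<in> carrier (M i) \<and> v \<in> carrier (M i)} \<union>
         {e (x(i := r \<odot>\<^bsub>M i\<^esub> u)) \<ominus>\<^bsub>F\<^esub> (r \<odot>\<^bsub>F\<^esub> e (x(i := u))) | x i r u.
            x \<in> tensor_tuples p M \<and> i < p \<and> r \<in> carrier R \<and> u \<in> carrier (M i)}))"

definition tensor_product ::
    "('a, 'r) ring_scheme \<Rightarrow> nat \<Rightarrow> (nat \<Rightarrow> ('a, 'b) module) \<Rightarrow> ('a, ((nat \<Rightarrow> 'b) \<Rightarrow> 'a) set) module" where
  "tensor_product R p M = quotient_module (tensor_free R p M) (tensor_relations R p M)"

text \<open>The homomorphism \<open>f 0 \<otimes> \<dots> \<otimes> f (p - 1)\<close> for linear maps \<open>f i\<close> from \<open>M i\<close> to \<open>N i\<close>.\<close>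

definition tensor_map ::
    "('a, 'r) ring_scheme \<Rightarrow> nat \<Rightarrow> (nat \<Rightarrow> ('a, 'b) module) \<Rightarrow> (nat \<Rightarrow> ('a, 'c) module) \<Rightarrow>
     (nat \<Rightarrow> 'b \<Rightarrow> 'c) \<Rightarrow> ((nat \<Rightarrow> 'b) \<Rightarrow> 'a) set \<Rightarrow> ((nat \<Rightarrow> 'c) \<Rightarrow> 'a) set" where
  "tensor_map R p M N f =
     quotient_map (tensor_free R p N) (tensor_relations R p N)
       (free_map R (tensor_tuples p M) (tensor_tuples p N) (\<lambda>x. \<lambda>i\<in>{..<p}. f i (x i)))"

text \<open>Cochain complexes of modules: \<open>cdiff C n\<close> maps \<open>cobj C n\<close> to \<open>cobj C (n + 1)\<close>.\<close>

record ('a, 'b) cochain_complex =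
  cobj :: "int \<Rightarrow> ('a, 'b) module"
  cdiff :: "int \<Rightarrow> 'b \<Rightarrow> 'b"

definition cocycles :: "('a, 'b) cochain_complex \<Rightarrow> int \<Rightarrow> 'b set" where
  "cocycles C n = a_kernel (cobj C n) (cobj C (n + 1)) (cdiff C n)"

definition coboundaries :: "('a, 'b) cochain_complex \<Rightarrow> int \<Rightarrow> 'b set" where
  "coboundaries C n = cdiff C (n - 1) ` carrier (cobj C (n - 1))"

definition cohomology :: "('a, 'b) cochain_complex \<Rightarrow> int \<Rightarrow> ('a, 'b set) module" where
  "cohomology C n =
     quotient_module ((cobj C n)\<lparr>carrier := cocycles C n\<rparr>) (coboundaries C n)"

text \<open>The map induced on cohomology by a homomorphism of complexes \<open>f\<close> with target \<open>D\<close>.\<close>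

definition cohomology_map ::
    "('a, 'c) cochain_complex \<Rightarrow> (int \<Rightarrow> 'b \<Rightarrow> 'c) \<Rightarrow> int \<Rightarrow> 'b set \<Rightarrow> 'c set" where
  "cohomology_map D f n = quotient_map (cobj D n) (coboundaries D n) (f n)"

text \<open>
  The tensor product of the complexes \<open>C 0, \<dots>, C (p - 1)\<close>. In degree \<open>n\<close> it is the direct sum, over
  the multidegrees \<open>\<nu>\<close> of total degree \<open>n\<close>, of the tensor products of the modules
  \<open>cobj (C i) (\<nu> i)\<close>. For homogeneous \<open>x\<^sub>j\<close> the differential takes \<open>x\<^sub>0 \<otimes> \<dots> \<otimes> x\<^bsub>p-1\<^esub>\<close> to the sum
  over \<open>i\<close> of \<open>x\<^sub>0 \<otimes> \<dots> \<otimes> d x\<^sub>i \<otimes> \<dots> \<otimes> x\<^bsub>p-1\<^esub>\<close> with sign given by the parity of the sum of the degrees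
  of \<open>x\<^sub>j\<close>, \<open>j < i\<close>.
\<close>

definition multidegrees :: "nat \<Rightarrow> int \<Rightarrow> (nat \<Rightarrow> int) set" where
  "multidegrees p n = {\<nu> \<in> {..<p} \<rightarrow>\<^sub>E UNIV. (\<Sum>i<p. \<nu> i) = n}"

definition tensor_component ::
    "('a, 'r) ring_scheme \<Rightarrow> nat \<Rightarrow> (nat \<Rightarrow> ('a, 'b) cochain_complex) \<Rightarrow> (nat \<Rightarrow> int) \<Rightarrow>
     ('a, ((nat \<Rightarrow> 'b) \<Rightarrow> 'a) set) module" where
  "tensor_component R p C \<nu> = tensor_product R p (\<lambda>i. cobj (C i) (\<nu> i))"

definition tensor_component_map ::
    "('a, 'r) ring_scheme \<Rightarrow> nat \<Rightarrow> (nat \<Rightarrow> ('a, 'b) cochain_complex) \<Rightarrow>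
     (nat \<Rightarrow> ('a, 'c) cochain_complex) \<Rightarrow> (nat \<Rightarrow> int) \<Rightarrow> (nat \<Rightarrow> int) \<Rightarrow> (nat \<Rightarrow> 'b \<Rightarrow> 'c) \<Rightarrow>
     ((nat \<Rightarrow> 'b) \<Rightarrow> 'a) set \<Rightarrow> ((nat \<Rightarrow> 'c) \<Rightarrow> 'a) set" where
  "tensor_component_map R p C D \<nu> \<mu> =
     tensor_map R p (\<lambda>i. cobj (C i) (\<nu> i)) (\<lambda>i. cobj (D i) (\<mu> i))"

definition tensor_complex ::
    "('a, 'r) ring_scheme \<Rightarrow> nat \<Rightarrow> (nat \<Rightarrow> ('a, 'b) cochain_complex) \<Rightarrow>
     ('a, (nat \<Rightarrow> int) \<Rightarrow> ((nat \<Rightarrow> 'b) \<Rightarrow> 'a) set) cochain_complex" where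
  "tensor_complex R p C =
     \<lparr>cobj = (\<lambda>n. direct_sum_module R (multidegrees p n) (tensor_component R p C)),
      cdiff = (\<lambda>n t. \<lambda>\<mu>\<in>multidegrees p (n + 1).
        \<Oplus>\<^bsub>tensor_component R p C \<mu>\<^esub>i\<in>{..<p}.
          let \<nu> = \<mu>(i := \<mu> i - 1);
              y = tensor_component_map R p C C \<nu> \<mu> (\<lambda>j. if j = i then cdiff (C i) (\<nu> i) else id) (t \<nu>)
          in if even (\<Sum>j<i. \<nu> j) then y else \<ominus>\<^bsub>tensor_component R p C \<mu>\<^esub> y)\<rparr>"

definition tensor_complex_map ::
    "('a, 'r) ring_scheme \<Rightarrow> nat \<Rightarrow> (nat \<Rightarrow> ('a, 'b) cochain_complex) \<Rightarrow>
     (nat \<Rightarrow> ('a, 'c) cochain_complex) \<Rightarrow> (nat \<Rightarrow> int \<Rightarrow> 'b \<Rightarrow> 'c) \<Rightarrow> int \<Rightarrow>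
     ((nat \<Rightarrow> int) \<Rightarrow> ((nat \<Rightarrow> 'b) \<Rightarrow> 'a) set) \<Rightarrow> (nat \<Rightarrow> int) \<Rightarrow> ((nat \<Rightarrow> 'c) \<Rightarrow> 'a) set" where
  "tensor_complex_map R p C D f n t =
     (\<lambda>\<nu>\<in>multidegrees p n. tensor_component_map R p C D \<nu> \<nu> (\<lambda>i. f i (\<nu> i)) (t \<nu>))"

definition koszul1 :: "('a, 'r) ring_scheme \<Rightarrow> 'a \<Rightarrow> ('a, 'a) cochain_complex" where
  "koszul1 R a =
     \<lparr>cobj = (\<lambda>n. if n = -1 \<or> n = 0 then regular_module R else zero_module R),
      cdiff = (\<lambda>n x. if n = -1 then a \<otimes>\<^bsub>R\<^esub> x else \<zero>\<^bsub>R\<^esub>)\<rparr>"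

definition koszul ::
    "('a, 'r) ring_scheme \<Rightarrow> 'a list \<Rightarrow>
     ('a, (nat \<Rightarrow> int) \<Rightarrow> ((nat \<Rightarrow> 'a) \<Rightarrow> 'a) set) cochain_complex" where
  "koszul R as = tensor_complex R (length as) (\<lambda>i. koszul1 R (as ! i))"

definition seq_power :: "('a, 'r) ring_scheme \<Rightarrow> 'a list \<Rightarrow> nat \<Rightarrow> 'a list" where
  "seq_power R as j = map (\<lambda>a. a [^]\<^bsub>R\<^esub> j) as"

text \<open>For \<open>j\<^sub>1 \<ge> j\<^sub>0\<close>: the homomorphism from the Koszul complex of \<open>a\<close> to the power \<open>j\<^sub>1\<close> to that of
  \<open>a\<close> to the power \<open>j\<^sub>0\<close>.\<close>

definition koszul1_transition ::
    "('a, 'r) ring_scheme \<Rightarrow> 'a \<Rightarrow> nat \<Rightarrow> nat \<Rightarrow> int \<Rightarrow> 'a \<Rightarrow> 'a" where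
  "koszul1_transition R a j1 j0 n x =
     (if n = 0 then x
      else if n = -1 then a [^]\<^bsub>R\<^esub> (j1 - j0) \<otimes>\<^bsub>R\<^esub> x
      else \<zero>\<^bsub>R\<^esub>)"

definition koszul_transition ::
    "('a, 'r) ring_scheme \<Rightarrow> 'a list \<Rightarrow> nat \<Rightarrow> nat \<Rightarrow> int \<Rightarrow>
     ((nat \<Rightarrow> int) \<Rightarrow> ((nat \<Rightarrow> 'a) \<Rightarrow> 'a) set) \<Rightarrow> (nat \<Rightarrow> int) \<Rightarrow> ((nat \<Rightarrow> 'a) \<Rightarrow> 'a) set" where
  "koszul_transition R as j1 j0 =
     tensor_complex_map R (length as)
       (\<lambda>i. koszul1 R (seq_power R as j1 ! i)) (\<lambda>i. koszul1 R (seq_power R as j0 ! i))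
       (\<lambda>i. koszul1_transition R (as ! i) j1 j0)"

text \<open>For an inverse system of modules indexed by the positive integers, with transition
  maps \<open>\<phi> j1 j0\<close> from \<open>N j1\<close> to \<open>N j0\<close> for \<open>j1 \<ge> j0\<close>.\<close>

definition pro_zero :: "(nat \<Rightarrow> ('a, 'b) module) \<Rightarrow> (nat \<Rightarrow> nat \<Rightarrow> 'b \<Rightarrow> 'b) \<Rightarrow> bool" where
  "pro_zero N \<phi> \<longleftrightarrow>
     (\<forall>j0\<ge>1. \<exists>j1\<ge>j0. \<forall>x\<in>carrier (N j1). \<phi> j1 j0 x = \<zero>\<^bsub>N j0\<^esub>)"

definition weakly_proregular_seq :: "('a, 'r) ring_scheme \<Rightarrow> 'a list \<Rightarrow> bool" where
  "weakly_proregular_seq R as \<longleftrightarrow>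
     as \<noteq> [] \<and> set as \<subseteq> carrier R \<and>
     (\<forall>i\<le>-1. pro_zero (\<lambda>j. cohomology (koszul R (seq_power R as j)) i)
        (\<lambda>j1 j0. cohomology_map (koszul R (seq_power R as j0)) (koszul_transition R as j1 j0) i))"

definition weakly_proregular_ideal :: "('a, 'r) ring_scheme \<Rightarrow> 'a set \<Rightarrow> bool" where
  "weakly_proregular_ideal R I \<longleftrightarrow> (\<exists>as. weakly_proregular_seq R as \<and> I = Idl\<^bsub>R\<^esub> (set as))"

definition ideal_power :: "('a, 'r) ring_scheme \<Rightarrow> 'a set \<Rightarrow> nat \<Rightarrow> 'a set" where
  "ideal_power R I k = I [^]\<^bsub>ideals_set R\<^esub> k"

text \<open>The inverse limit of the rings \<open>R / I\<^bsup>k+1\<^esup>\<close>, as a subring of their product. The transition map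
  from \<open>R / I\<^bsup>k+2\<^esup>\<close> to \<open>R / I\<^bsup>k+1\<^esup>\<close> sends a coset \<open>X\<close> to \<open>I\<^bsup>k+1\<^esup> + X\<close>.\<close>

definition adic_completion :: "('a, 'r) ring_scheme \<Rightarrow> 'a set \<Rightarrow> (nat \<Rightarrow> 'a set) ring" where
  "adic_completion R I =
     (let Q = (\<lambda>k. R Quot (ideal_power R I (k + 1))) in
      \<lparr>carrier = {f. (\<forall>k. f k \<in> carrier (Q k)) \<and>
                     (\<forall>k. ideal_power R I (k + 1) <+>\<^bsub>R\<^esub> f (k + 1) = f k)},
       mult = (\<lambda>f g k. f k \<otimes>\<^bsub>Q k\<^esub> g k),
       one = (\<lambda>k. \<one>\<^bsub>Q k\<^esub>),
       zero = (\<lambda>k. \<zero>\<^bsub>Q k\<^esub>),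
       add = (\<lambda>f g k. f k \<oplus>\<^bsub>Q k\<^esub> g k)\<rparr>)"

definition completion_map :: "('a, 'r) ring_scheme \<Rightarrow> 'a set \<Rightarrow> 'a \<Rightarrow> nat \<Rightarrow> 'a set" where
  "completion_map R I x = (\<lambda>k. ideal_power R I (k + 1) +>\<^bsub>R\<^esub> x)"

definition completed_ideal :: "('a, 'r) ring_scheme \<Rightarrow> 'a set \<Rightarrow> (nat \<Rightarrow> 'a set) set" where
  "completed_ideal R I = Idl\<^bsub>adic_completion R I\<^esub> (completion_map R I ` I)"

end

theory Submission
  imports Defs
begin

text \<open>
  Let \<open>I\<close> be generated by a weakly proregular sequence \<open>as\<close> of length \<open>p\<close>, let \<open>K\<^sub>j\<close> be the Koszul
  complex of the \<open>j\<close>-th powers of \<open>as\<close>, and let \<open>\<gamma>\<close> be the map from the ring to its completion. The image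
  of \<open>as\<close> generates the completed ideal, and it is weakly proregular because, for every \<open>j\<close>, every
  Koszul cycle over the completion is homologous to the image of a Koszul cycle over the ring: if
  \<open>K\<^bsub>j1\<^esub> \<rightarrow> K\<^bsub>j0\<^esub>\<close> kills cohomology over the ring, it then also kills it over the completion.

  To compare the cycles one needs an Artin-Rees property of each \<open>K\<^sub>j\<close> (\<open>koszul_artin_rees\<close>): for
  every \<open>n'\<close> there is \<open>n\<close> such that each cycle with coefficients in \<open>I\<^sup>n\<close> is the boundary of a chain
  with coefficients in \<open>I\<^bsup>n'\<^esup>\<close>. Given this, a cycle \<open>z\<close> over the completion is approximated modulo
  each power of \<open>I\<close> by a chain over the ring; its boundary is small, hence bounds a small chain, and
  subtracting that chain makes the approximation a cycle \<open>w\<^sub>k\<close>. The differences of successive \<open>w\<^sub>k\<close>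
  are small cycles, hence boundaries of small chains \<open>b\<^sub>k\<close>, and \<open>z = \<gamma> w\<^sub>0 + d (\<Sum>k. b\<^sub>k)\<close>
  (\<open>koszul_pro_zero_completion\<close>).

  The Artin-Rees property is where weak proregularity enters. Let \<open>L\<^sub>m\<close> be the subcomplex of \<open>K\<^sub>m\<close>
  with \<open>I\<^sup>m\<close> in degree 0 and all of \<open>K\<^sub>m\<close> elsewhere. The system \<open>L\<close> is pro-acyclic: in
  negative cohomological degrees this is weak proregularity, in degree 0 it is the pigeonhole inclusion
  of \<open>I\<^bsup>p m\<^esup>\<close> in the ideal of the \<open>m\<close>-th powers. Taking iterated cones, \<open>K\<^sub>j \<otimes> L\<^sub>m\<close> is
  pro-acyclic in \<open>m\<close> (\<open>augmented_koszul_pro_acyclic\<close>). A cycle \<open>x\<close> of \<open>K\<^sub>j\<close> with coefficients in \<open>I\<^sup>n\<close> is a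
  cycle of \<open>K\<^sub>j \<otimes> L\<^sub>n\<close>, so it bounds in \<open>K\<^sub>j \<otimes> L\<^sub>m\<close> for a smaller \<open>m\<close>. Finally each \<open>m\<close>-th power is a
  multiple \<open>c a\<close> of the corresponding \<open>j\<close>-th power \<open>a\<close>, which is null-homotopic on \<open>K\<^sub>j\<close>; this gives
  a retraction of \<open>K\<^sub>j \<otimes> K\<^sub>m\<close> onto \<open>K\<^sub>j\<close> (\<open>retraction\<close>), and its value on the bounding chain has
  coefficients in \<open>I\<^sup>m\<close> plus multiples of the factors \<open>c\<close>, which are \<open>(m - j)\<close>-th powers.

  All of this is carried out for Koszul complexes in coordinates. The complexes built from general
  tensor products are identified with them because a tensor product of copies of the ring is the
  ring itself, by multiplication of the factors (\<open>relations_eq\<close>, \<open>weakly_proregular_seq_iff\<close>).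
\<close>

section \<open>Koszul complexes in coordinates\<close>

text \<open>
  The word \<open>l\<close> stands for the exterior product of the basis vectors at the positions
  of its \<open>True\<close> entries, and \<open>f l\<close> is the coefficient there. The degree
  \<open>s\<close> is homological and an integer, so that the two halves of a chain have degrees
  \<open>s\<close> and \<open>s - 1\<close> without a case distinction.
\<close>

definition koszul_chains :: "('a, 'r) ring_scheme \<Rightarrow> nat \<Rightarrow> int \<Rightarrow> (bool list \<Rightarrow> 'a) set" where
  "koszul_chains R n s =
     {f. (\<forall>l. f l \<in> carrier R) \<and> (\<forall>l. f l \<noteq> \<zero>\<^bsub>R\<^esub> \<longrightarrow> length l = n \<and> int (count_list l True) = s)}"

text \<open>
  The Koszul complex of \<open>b # bs\<close> is the cone of \<open>b\<close> on the Koszul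
  complex of \<open>bs\<close>. A chain is a pair \<open>(u, v)\<close>, given by the words that
  begin with \<open>False\<close> and with \<open>True\<close>, and its boundary is \<open>(d u +
  b v, - d v)\<close>.
\<close>

fun kdiff :: "('a, 'r) ring_scheme \<Rightarrow> 'a list \<Rightarrow> (bool list \<Rightarrow> 'a) \<Rightarrow> bool list \<Rightarrow> 'a" where
  "kdiff R [] f l = \<zero>\<^bsub>R\<^esub>"
| "kdiff R (b # bs) f [] = \<zero>\<^bsub>R\<^esub>"
| "kdiff R (b # bs) f (x # l) =
     (if x then \<ominus>\<^bsub>R\<^esub> kdiff R bs (\<lambda>l. f (True # l)) l
      else kdiff R bs (\<lambda>l. f (False # l)) l \<oplus>\<^bsub>R\<^esub> b \<otimes>\<^bsub>R\<^esub> f (True # l))"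

text \<open>
  With powers of the entries of a sequence for \<open>bs\<close>, this is the transition map
  between the Koszul complexes of two powers of the sequence.
\<close>

fun kscale :: "('a, 'r) ring_scheme \<Rightarrow> 'a list \<Rightarrow> (bool list \<Rightarrow> 'a) \<Rightarrow> bool list \<Rightarrow> 'a" where
  "kscale R [] f l = f l"
| "kscale R (b # bs) f [] = \<zero>\<^bsub>R\<^esub>"
| "kscale R (b # bs) f (x # l) =
     (if x then b \<otimes>\<^bsub>R\<^esub> kscale R bs (\<lambda>l. f (True # l)) l else kscale R bs (\<lambda>l. f (False # l)) l)"

text \<open>
  Exterior multiplication by the \<open>k\<close>-th basis vector. It is a null-homotopy for
  multiplication by the \<open>k\<close>-th entry of the sequence.
\<close>

fun kwedge :: "('a, 'r) ring_scheme \<Rightarrow> nat \<Rightarrow> (bool list \<Rightarrow> 'a) \<Rightarrow> bool list \<Rightarrow> 'a" where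
  "kwedge R k f [] = \<zero>\<^bsub>R\<^esub>"
| "kwedge R 0 f (x # l) = (if x then f (False # l) else \<zero>\<^bsub>R\<^esub>)"
| "kwedge R (Suc k) f (x # l) =
     (if x then \<ominus>\<^bsub>R\<^esub> kwedge R k (\<lambda>l. f (True # l)) l else kwedge R k (\<lambda>l. f (False # l)) l)"

text \<open>
  The following two functions split a chain at slot \<open>k\<close> rather than at the front. The
  sign in the second is the one that moves the slot to the front; thus the pair of them identifies
  the complex of \<open>bs @ b # cs\<close> with the cone of \<open>b\<close> on the complex of
  \<open>bs @ cs\<close>, where \<open>k = length bs\<close>.
\<close>

fun slot_absent :: "('a, 'r) ring_scheme \<Rightarrow> nat \<Rightarrow> (bool list \<Rightarrow> 'a) \<Rightarrow> bool list \<Rightarrow> 'a" where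
  "slot_absent R 0 f l = f (False # l)"
| "slot_absent R (Suc k) f [] = \<zero>\<^bsub>R\<^esub>"
| "slot_absent R (Suc k) f (x # l) = slot_absent R k (\<lambda>l. f (x # l)) l"

fun slot_present :: "('a, 'r) ring_scheme \<Rightarrow> nat \<Rightarrow> (bool list \<Rightarrow> 'a) \<Rightarrow> bool list \<Rightarrow> 'a" where
  "slot_present R 0 f l = f (True # l)"
| "slot_present R (Suc k) f [] = \<zero>\<^bsub>R\<^esub>"
| "slot_present R (Suc k) f (x # l) =
     (if x then \<ominus>\<^bsub>R\<^esub> slot_present R k (\<lambda>l. f (True # l)) l else slot_present R k (\<lambda>l. f (False # l)) l)"

text \<open>
  A chain in \<open>p\<close> slots, regarded as a chain in \<open>p + q\<close> slots that does
  not involve the last \<open>q\<close>.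
\<close>

fun kembed :: "('a, 'r) ring_scheme \<Rightarrow> nat \<Rightarrow> nat \<Rightarrow> (bool list \<Rightarrow> 'a) \<Rightarrow> bool list \<Rightarrow> 'a" where
  "kembed R 0 q f l = (if l = replicate q False then f [] else \<zero>\<^bsub>R\<^esub>)"
| "kembed R (Suc p) q f [] = \<zero>\<^bsub>R\<^esub>"
| "kembed R (Suc p) q f (x # l) = kembed R p q (\<lambda>l. f (x # l)) l"

context cring
begin

lemma set_map2_mult: "set bs \<subseteq> carrier R \<Longrightarrow> set cs \<subseteq> carrier R \<Longrightarrow> set (map2 (\<otimes>) bs cs) \<subseteq> carrier R"
  by (auto dest: set_zip_leftD set_zip_rightD intro!: m_closed)

abbreviation chains where "chains \<equiv> koszul_chains R"

lemma chainsI: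
  "\<lbrakk>\<And>l. f l \<in> carrier R; \<And>l. f l \<noteq> \<zero> \<Longrightarrow> length l = n \<and> int (count_list l True) = s\<rbrakk> \<Longrightarrow> f \<in> chains n s"
  by (auto simp: koszul_chains_def)

lemma chains_carr: "f \<in> chains n s \<Longrightarrow> f l \<in> carrier R"
  by (auto simp: koszul_chains_def)

lemma chains_supp: "f \<in> chains n s \<Longrightarrow> length l \<noteq> n \<or> int (count_list l True) \<noteq> s \<Longrightarrow> f l = \<zero>"
  by (auto simp: koszul_chains_def)

lemma chains_zero: "(\<lambda>_. \<zero>) \<in> chains n s" by (auto simp: koszul_chains_def)

lemma chains_add: "\<lbrakk>f \<in> chains n s; g \<in> chains n s\<rbrakk> \<Longrightarrow> (\<lambda>l. f l \<oplus> g l) \<in> chains n s"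
  by (rule chainsI) (auto simp: chains_carr chains_supp, (metis chains_supp l_zero zero_closed)+)

lemma chains_minus: "\<lbrakk>f \<in> chains n s; g \<in> chains n s\<rbrakk> \<Longrightarrow> (\<lambda>l. f l \<ominus> g l) \<in> chains n s"
  by (rule chainsI) (auto simp: chains_carr chains_supp minus_eq, (metis chains_supp l_zero zero_closed minus_zero)+)

lemma chains_smult: "\<lbrakk>f \<in> chains n s; r \<in> carrier R\<rbrakk> \<Longrightarrow> (\<lambda>l. r \<otimes> f l) \<in> chains n s"
  by (rule chainsI) (auto simp: chains_carr chains_supp, (metis chains_supp r_null)+)

lemma chains_Suc:
  "f \<in> chains (Suc n) s \<longleftrightarrow>
     f [] = \<zero> \<and> (\<lambda>l. f (False # l)) \<in> chains n s \<and> (\<lambda>l. f (True # l)) \<in> chains n (s - 1)"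
proof
  assume f: "f \<in> chains (Suc n) s"
  then show "f [] = \<zero> \<and> (\<lambda>l. f (False # l)) \<in> chains n s \<and> (\<lambda>l. f (True # l)) \<in> chains n (s - 1)"
    by (auto intro!: chainsI simp: chains_carr) (auto simp: koszul_chains_def)
next
  assume a: "f [] = \<zero> \<and> (\<lambda>l. f (False # l)) \<in> chains n s \<and> (\<lambda>l. f (True # l)) \<in> chains n (s - 1)"
  have *: "f l \<in> carrier R \<and> (f l \<noteq> \<zero> \<longrightarrow> length l = Suc n \<and> int (count_list l True) = s)" for l
  proof (cases l)
    case Nil then show ?thesis using a by simp
  next
    case (Cons x k)
    have "f (x # k) \<in> carrier R \<and> (f (x # k) \<noteq> \<zero> \<longrightarrow> length k = n \<and> int (count_list (x # k) True) = s)"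
    proof (cases x)
      case True
      have "int (count_list (x # k) True) = s" if "int (count_list k True) = s - 1"
        using that True by simp
      then show ?thesis using a True unfolding koszul_chains_def by auto
    next
      case False
      have "int (count_list (x # k) True) = int (count_list k True)" using False by simp
      then show ?thesis using a False unfolding koszul_chains_def by auto
    qed
    then show ?thesis by (simp add: Cons)
  qed
  show "f \<in> chains (Suc n) s" by (rule chainsI) (use * in auto)
qed

lemma chains_lo: "f \<in> chains (Suc n) s \<Longrightarrow> (\<lambda>l. f (False # l)) \<in> chains n s"
  by (simp add: chains_Suc)
lemma chains_hi: "f \<in> chains (Suc n) s \<Longrightarrow> (\<lambda>l. f (True # l)) \<in> chains n (s - 1)"
  by (simp add: chains_Suc)

lemma chains_neg_deg: "f \<in> chains n s \<Longrightarrow> s < 0 \<Longrightarrow> f = (\<lambda>_. \<zero>)"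
  by (rule ext, rule chains_supp) auto

lemma kdiff_carr:
  "\<lbrakk>\<And>l. f l \<in> carrier R; set bs \<subseteq> carrier R\<rbrakk> \<Longrightarrow> kdiff R bs f l \<in> carrier R"
proof (induction bs arbitrary: f l)
  case (Cons b bs) then show ?case by (cases l) auto
qed simp

lemma kdiff_zero: "set bs \<subseteq> carrier R \<Longrightarrow> kdiff R bs (\<lambda>_. \<zero>) l = \<zero>"
proof (induction bs arbitrary: l)
  case (Cons b bs) then show ?case by (cases l) auto
qed simp

lemma kdiff_add:
  "\<lbrakk>\<And>l. f l \<in> carrier R; \<And>l. g l \<in> carrier R; set bs \<subseteq> carrier R\<rbrakk> \<Longrightarrow>
   kdiff R bs (\<lambda>l. f l \<oplus> g l) l = kdiff R bs f l \<oplus> kdiff R bs g l"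
proof (induction bs arbitrary: f g l)
  case (Cons b bs)
  then have b: "b \<in> carrier R" and bs: "set bs \<subseteq> carrier R" by auto
  show ?case
  proof (cases l)
    case (Cons x k)
    have c: "kdiff R bs (\<lambda>l. f (y # l)) k \<in> carrier R" "kdiff R bs (\<lambda>l. g (y # l)) k \<in> carrier R" for y
      using Cons.prems bs by (auto intro!: kdiff_carr)
    show ?thesis
      unfolding Cons by (simp add: Cons.IH[OF _ _ bs] Cons.prems c b minus_add r_distr a_ac)
  qed simp
qed simp

lemma kdiff_smult:
  "\<lbrakk>\<And>l. f l \<in> carrier R; r \<in> carrier R; set bs \<subseteq> carrier R\<rbrakk> \<Longrightarrow>
   kdiff R bs (\<lambda>l. r \<otimes> f l) l = r \<otimes> kdiff R bs f l"
proof (induction bs arbitrary: f l)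
  case (Cons b bs)
  then have b: "b \<in> carrier R" and bs: "set bs \<subseteq> carrier R" by auto
  show ?case
  proof (cases l)
    case (Cons x k)
    have c: "kdiff R bs (\<lambda>l. f (y # l)) k \<in> carrier R" for y
      using Cons.prems bs by (auto intro!: kdiff_carr)
    show ?thesis
      unfolding Cons by (simp add: Cons.IH[OF _ _ bs] Cons.prems c b r_minus r_distr m_lcomm)
  qed (use Cons.prems in simp)
qed simp

lemma kdiff_neg:
  assumes "\<And>l. f l \<in> carrier R" "set bs \<subseteq> carrier R"
  shows "kdiff R bs (\<lambda>l. \<ominus> f l) l = \<ominus> kdiff R bs f l"
proof -
  have "kdiff R bs (\<lambda>l. \<ominus> f l) l = kdiff R bs (\<lambda>l. (\<ominus> \<one>) \<otimes> f l) l"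
    using assms by (simp add: l_minus)
  also have "\<dots> = \<ominus> kdiff R bs f l"
    using assms by (subst kdiff_smult) (auto simp: l_minus kdiff_carr)
  finally show ?thesis .
qed

lemma kdiff_minus:
  assumes "\<And>l. f l \<in> carrier R" "\<And>l. g l \<in> carrier R" "set bs \<subseteq> carrier R"
  shows "kdiff R bs (\<lambda>l. f l \<ominus> g l) l = kdiff R bs f l \<ominus> kdiff R bs g l"
  using assms by (simp add: minus_eq kdiff_add kdiff_neg)

lemma kdiff_chains:
  "\<lbrakk>f \<in> chains (length bs) s; set bs \<subseteq> carrier R\<rbrakk> \<Longrightarrow> kdiff R bs f \<in> chains (length bs) (s - 1)"
proof (induction bs arbitrary: f s)
  case Nil then show ?case by (auto simp: koszul_chains_def)
next
  case (Cons b bs)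
  have lo: "(\<lambda>l. f (False # l)) \<in> chains (length bs) s" and hi: "(\<lambda>l. f (True # l)) \<in> chains (length bs) (s - 1)"
    using Cons.prems by (simp_all add: chains_Suc)
  have b: "b \<in> carrier R" "set bs \<subseteq> carrier R" using Cons.prems by auto
  have h: "(\<lambda>l. \<zero> \<ominus> kdiff R bs (\<lambda>l. f (True # l)) l) \<in> chains (length bs) (s - 1 - 1)"
    using Cons.IH[OF hi] b chains_minus[OF chains_zero] by blast
  have "(\<lambda>l. \<ominus> kdiff R bs (\<lambda>l. f (True # l)) l) \<in> chains (length bs) (s - 1 - 1)"
    using h Cons.IH[OF hi] b by (simp add: minus_eq kdiff_carr chains_carr[OF hi])
  moreover have "(\<lambda>l. kdiff R bs (\<lambda>l. f (False # l)) l \<oplus> b \<otimes> f (True # l)) \<in> chains (length bs) (s - 1)"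
    using Cons.IH[OF lo] hi b by (intro chains_add chains_smult) auto
  ultimately show ?case by (simp add: chains_Suc)
qed

lemma kdiff_kdiff:
  "\<lbrakk>\<And>l. f l \<in> carrier R; set bs \<subseteq> carrier R\<rbrakk> \<Longrightarrow> kdiff R bs (kdiff R bs f) l = \<zero>"
proof (induction bs arbitrary: f l)
  case (Cons b bs)
  then have b: "b \<in> carrier R" and bs: "set bs \<subseteq> carrier R" by auto
  show ?case
  proof (cases l)
    case (Cons x k)
    have c: "kdiff R bs (\<lambda>l. f (y # l)) l \<in> carrier R" for y l
      using Cons.prems bs by (auto intro!: kdiff_carr)
    show ?thesis
      unfolding Cons
      by (simp add: Cons.IH Cons.prems c b bs kdiff_neg kdiff_add kdiff_smult kdiff_carr r_neg r_minus)
  qed simp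
qed simp

lemma kscale_carr:
  "\<lbrakk>\<And>l. f l \<in> carrier R; set bs \<subseteq> carrier R\<rbrakk> \<Longrightarrow> kscale R bs f l \<in> carrier R"
proof (induction bs arbitrary: f l)
  case (Cons b bs) then show ?case by (cases l) auto
qed simp

lemma kscale_zero: "set bs \<subseteq> carrier R \<Longrightarrow> kscale R bs (\<lambda>_. \<zero>) l = \<zero>"
proof (induction bs arbitrary: l)
  case (Cons b bs) then show ?case by (cases l) auto
qed simp

lemma kscale_add:
  "\<lbrakk>\<And>l. f l \<in> carrier R; \<And>l. g l \<in> carrier R; set bs \<subseteq> carrier R\<rbrakk> \<Longrightarrow>
   kscale R bs (\<lambda>l. f l \<oplus> g l) l = kscale R bs f l \<oplus> kscale R bs g l"
proof (induction bs arbitrary: f g l)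
  case (Cons b bs)
  then show ?case by (cases l) (auto simp: kscale_carr r_distr)
qed simp

lemma kscale_smult:
  "\<lbrakk>\<And>l. f l \<in> carrier R; r \<in> carrier R; set bs \<subseteq> carrier R\<rbrakk> \<Longrightarrow>
   kscale R bs (\<lambda>l. r \<otimes> f l) l = r \<otimes> kscale R bs f l"
proof (induction bs arbitrary: f l)
  case (Cons b bs)
  then show ?case by (cases l) (auto simp: kscale_carr m_lcomm)
qed simp

lemma kscale_neg:
  assumes "\<And>l. f l \<in> carrier R" "set bs \<subseteq> carrier R"
  shows "kscale R bs (\<lambda>l. \<ominus> f l) l = \<ominus> kscale R bs f l"
proof -
  have "kscale R bs (\<lambda>l. \<ominus> f l) l = kscale R bs (\<lambda>l. (\<ominus> \<one>) \<otimes> f l) l"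
    using assms by (simp add: l_minus)
  also have "\<dots> = \<ominus> kscale R bs f l"
    using assms by (subst kscale_smult) (auto simp: l_minus kscale_carr)
  finally show ?thesis .
qed

lemma kscale_chains:
  "\<lbrakk>f \<in> chains (length bs) s; set bs \<subseteq> carrier R\<rbrakk> \<Longrightarrow> kscale R bs f \<in> chains (length bs) s"
proof (induction bs arbitrary: f s)
  case Nil
  have "kscale R [] f = f" by (rule ext) simp
  then show ?case using Nil by simp
next
  case (Cons b bs)
  then show ?case by (auto simp: chains_Suc intro!: chains_smult)
qed

lemma kscale_kscale:
  "\<lbrakk>\<And>l. f l \<in> carrier R; set bs \<subseteq> carrier R; set cs \<subseteq> carrier R; length bs = length cs\<rbrakk> \<Longrightarrow>
   kscale R bs (kscale R cs f) l = kscale R (map2 (\<otimes>) bs cs) f l"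
proof (induction bs arbitrary: cs f l)
  case Nil then show ?case by simp
next
  case (Cons b bs)
  then obtain c cs' where cs: "cs = c # cs'" "length cs' = length bs" by (cases cs) auto
  show ?case
  proof (cases l)
    case (Cons x k)
    have IH: "kscale R bs (\<lambda>l. kscale R cs' (\<lambda>l. f (y # l)) l) k = kscale R (map2 (\<otimes>) bs cs') (\<lambda>l. f (y # l)) k" for y
      using Cons.IH[of "\<lambda>l. f (y # l)" cs' k] Cons.prems cs by simp
    have s: "set (map2 (\<otimes>) bs cs') \<subseteq> carrier R"
      using Cons.prems cs by (intro set_map2_mult) auto
    have "kscale R bs (\<lambda>l. c \<otimes> kscale R cs' (\<lambda>l. f (True # l)) l) k =
          c \<otimes> kscale R bs (\<lambda>l. kscale R cs' (\<lambda>l. f (True # l)) l) k"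
      using Cons.prems cs by (intro kscale_smult) (auto intro!: kscale_carr)
    moreover have "kscale R (map2 (\<otimes>) bs cs') (\<lambda>l. f (True # l)) k \<in> carrier R"
      using Cons.prems s by (auto intro!: kscale_carr)
    ultimately show ?thesis
      using Cons.prems cs by (simp add: Cons IH m_assoc)
  qed (simp add: cs)
qed

text \<open>
  The scaling is a homomorphism of complexes from the one of the products \<open>e b\<close> to
  the one of the \<open>e\<close>.
\<close>

lemma kdiff_kscale:
  "\<lbrakk>\<And>l. f l \<in> carrier R; set bs \<subseteq> carrier R; set es \<subseteq> carrier R; length bs = length es\<rbrakk> \<Longrightarrow>
   kdiff R es (kscale R bs f) l = kscale R bs (kdiff R (map2 (\<otimes>) es bs) f) l"
proof (induction bs arbitrary: es f l)
  case Nil then show ?case by simp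
next
  case (Cons b bs)
  then obtain e es' where es: "es = e # es'" "length es' = length bs" by (cases es) auto
  note c = Cons.prems
  show ?case
  proof (cases l)
    case (Cons x k)
    have IH: "kdiff R es' (\<lambda>l. kscale R bs (\<lambda>l. f (y # l)) l) k = kscale R bs (kdiff R (map2 (\<otimes>) es' bs) (\<lambda>l. f (y # l))) k" for y
      using Cons.IH[of "\<lambda>l. f (y # l)" es' k] c es by simp
    have s: "set (map2 (\<otimes>) es' bs) \<subseteq> carrier R"
      using c es by (intro set_map2_mult) auto
    have d: "kdiff R (map2 (\<otimes>) es' bs) (\<lambda>l. f (y # l)) l \<in> carrier R" for y l
      using c s by (auto intro!: kdiff_carr)
    have d': "kscale R bs (kdiff R (map2 (\<otimes>) es' bs) (\<lambda>l. f (y # l))) l \<in> carrier R" for y l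
      using c d by (auto intro!: kscale_carr)
    have g: "kscale R bs (\<lambda>l. f (y # l)) l \<in> carrier R" for y l using c by (auto intro!: kscale_carr)
    have 1: "kdiff R es' (\<lambda>l. b \<otimes> kscale R bs (\<lambda>l. f (True # l)) l) k =
          b \<otimes> kdiff R es' (\<lambda>l. kscale R bs (\<lambda>l. f (True # l)) l) k"
      using c es g by (intro kdiff_smult) auto
    have 2: "kscale R bs (\<lambda>l. kdiff R (map2 (\<otimes>) es' bs) (\<lambda>l. f (False # l)) l \<oplus> e \<otimes> b \<otimes> f (True # l)) k
      = kscale R bs (kdiff R (map2 (\<otimes>) es' bs) (\<lambda>l. f (False # l))) k \<oplus> (e \<otimes> b) \<otimes> kscale R bs (\<lambda>l. f (True # l)) k"
      using c es d by (subst kscale_add) (auto simp: kscale_smult)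
    have 3: "e \<otimes> b \<otimes> kscale R bs (\<lambda>l. f (True # l)) k = e \<otimes> (b \<otimes> kscale R bs (\<lambda>l. f (True # l)) k)"
      using c es g by (simp add: m_assoc)
    show ?thesis
      using c es d d' g by (simp add: Cons IH 1 2[unfolded 3] kscale_neg r_minus)
  qed (simp add: es)
qed

lemma kwedge_carr: "\<lbrakk>\<And>l. f l \<in> carrier R\<rbrakk> \<Longrightarrow> kwedge R k f l \<in> carrier R"
proof (induction k arbitrary: f l)
  case 0 then show ?case by (cases l) auto
next
  case (Suc k) then show ?case by (cases l) auto
qed

lemma kwedge_zero: "kwedge R k (\<lambda>_. \<zero>) l = \<zero>"
  by (induction k arbitrary: l; case_tac l) auto

lemma kwedge_add: "\<lbrakk>\<And>l. f l \<in> carrier R; \<And>l. g l \<in> carrier R\<rbrakk> \<Longrightarrow>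
  kwedge R k (\<lambda>l. f l \<oplus> g l) l = kwedge R k f l \<oplus> kwedge R k g l"
proof (induction k arbitrary: f g l)
  case 0 then show ?case by (cases l) auto
next
  case (Suc k) then show ?case by (cases l) (auto simp: kwedge_carr minus_add)
qed

lemma kwedge_smult: "\<lbrakk>\<And>l. f l \<in> carrier R; r \<in> carrier R\<rbrakk> \<Longrightarrow>
  kwedge R k (\<lambda>l. r \<otimes> f l) l = r \<otimes> kwedge R k f l"
proof (induction k arbitrary: f l)
  case 0 then show ?case by (cases l) auto
next
  case (Suc k) then show ?case by (cases l) (auto simp: kwedge_carr r_minus)
qed

lemma kwedge_neg: "\<lbrakk>\<And>l. f l \<in> carrier R\<rbrakk> \<Longrightarrow>
  kwedge R k (\<lambda>l. \<ominus> f l) l = \<ominus> kwedge R k f l"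
proof (induction k arbitrary: f l)
  case 0 then show ?case by (cases l) auto
next
  case (Suc k) then show ?case by (cases l) (auto simp: kwedge_carr)
qed

lemma kwedge_chains: "\<lbrakk>f \<in> chains n s; k < n\<rbrakk> \<Longrightarrow> kwedge R k f \<in> chains n (s + 1)"
proof (induction k arbitrary: f n s)
  case 0
  then obtain m where "n = Suc m" by (cases n) auto
  with 0 show ?case by (simp add: chains_Suc chains_zero)
next
  case (Suc k)
  then obtain m where n: "n = Suc m" "k < m" by (cases n) auto
  have lo: "(\<lambda>l. f (False # l)) \<in> chains m s" and hi: "(\<lambda>l. f (True # l)) \<in> chains m (s - 1)"
    using Suc.prems n by (simp_all add: chains_Suc)
  have "(\<lambda>l. \<zero> \<ominus> kwedge R k (\<lambda>l. f (True # l)) l) \<in> chains m s"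
    using Suc.IH[OF hi] n chains_minus[OF chains_zero] by fastforce
  then show ?case using Suc.IH[OF lo] n chains_carr[OF hi] by (simp add: chains_Suc minus_eq kwedge_carr)
qed

lemma kwedge_homotopy:
  "\<lbrakk>f \<in> chains (length bs) s; set bs \<subseteq> carrier R; k < length bs\<rbrakk> \<Longrightarrow>
   kdiff R bs (kwedge R k f) l \<oplus> kwedge R k (kdiff R bs f) l = bs ! k \<otimes> f l"
proof (induction bs arbitrary: f k l s)
  case Nil then show ?case by simp
next
  case (Cons b bs)
  then have b: "b \<in> carrier R" and bs: "set bs \<subseteq> carrier R" by auto
  have f: "f l \<in> carrier R" for l using Cons.prems chains_carr by blast
  have f0: "f [] = \<zero>" and lo: "(\<lambda>l. f (False # l)) \<in> chains (length bs) s"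
    and hi: "(\<lambda>l. f (True # l)) \<in> chains (length bs) (s - 1)"
    using Cons.prems by (simp_all add: chains_Suc)
  show ?case
  proof (cases l)
    case Nil
    moreover have "(b # bs) ! k \<in> carrier R" using Cons.prems nth_mem by blast
    ultimately show ?thesis using f0 Cons.prems(1) by simp
  next
    case (Cons x m)
    have d: "kdiff R bs (\<lambda>l. f (y # l)) m \<in> carrier R" for y m
      using f bs by (auto intro!: kdiff_carr)
    show ?thesis
    proof (cases k)
      case 0
      then show ?thesis using f b bs d by (cases x) (simp_all add: Cons kdiff_zero r_neg1)
    next
      case (Suc k')
      have k': "k' < length bs" using Suc Cons.prems by simp
      have h: "kwedge R k' (\<lambda>l. f (y # l)) m \<in> carrier R" for y m using f by (auto intro!: kwedge_carr)
      have dh: "kdiff R bs (kwedge R k' (\<lambda>l. f (y # l))) m \<in> carrier R" for y m using h bs by (auto intro!: kdiff_carr)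
      have hd: "kwedge R k' (kdiff R bs (\<lambda>l. f (y # l))) m \<in> carrier R" for y m using d by (auto intro!: kwedge_carr)
      have IHl: "kdiff R bs (kwedge R k' (\<lambda>l. f (False # l))) m \<oplus> kwedge R k' (kdiff R bs (\<lambda>l. f (False # l))) m
         = bs ! k' \<otimes> f (False # m)" by (rule Cons.IH[OF lo bs k'])
      have IHh: "kdiff R bs (kwedge R k' (\<lambda>l. f (True # l))) m \<oplus> kwedge R k' (kdiff R bs (\<lambda>l. f (True # l))) m
         = bs ! k' \<otimes> f (True # m)" by (rule Cons.IH[OF hi bs k'])
      have nk: "bs ! k' \<in> carrier R" using bs k' by auto
      show ?thesis
      proof (cases x)
        case True
        then show ?thesis using f bs d h dh hd
          by (simp add: Cons Suc kdiff_neg kwedge_neg IHh)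
      next
        case False
        have "kwedge R k' (\<lambda>l. kdiff R bs (\<lambda>l. f (False # l)) l \<oplus> b \<otimes> f (True # l)) m
          = kwedge R k' (kdiff R bs (\<lambda>l. f (False # l))) m \<oplus> b \<otimes> kwedge R k' (\<lambda>l. f (True # l)) m"
          using f b d by (subst kwedge_add) (auto simp: kwedge_smult)
        moreover have "b \<otimes> \<ominus> kwedge R k' (\<lambda>l. f (True # l)) m = \<ominus> (b \<otimes> kwedge R k' (\<lambda>l. f (True # l)) m)"
          using b h by (simp add: r_minus)
        moreover have "u \<oplus> \<ominus> w \<oplus> (v \<oplus> w) = u \<oplus> v" if "u \<in> carrier R" "v \<in> carrier R" "w \<in> carrier R" for u v w
          using that by algebra
        ultimately show ?thesis using False f b bs d h dh hd
          by (simp add: Cons Suc IHl)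
      qed
    qed
  qed
qed

section \<open>Retraction onto a Koszul complex\<close>

lemma slot_absent_carr: "\<lbrakk>\<And>l. f l \<in> carrier R\<rbrakk> \<Longrightarrow> slot_absent R k f l \<in> carrier R"
proof (induction k arbitrary: f l)
  case (Suc k) then show ?case by (cases l) auto
qed simp

lemma slot_present_carr: "\<lbrakk>\<And>l. f l \<in> carrier R\<rbrakk> \<Longrightarrow> slot_present R k f l \<in> carrier R"
proof (induction k arbitrary: f l)
  case (Suc k) then show ?case by (cases l) auto
qed simp

lemma slot_absent_add_smult:
  "slot_absent R k (\<lambda>l. f l \<oplus> r \<otimes> g l) l = slot_absent R k f l \<oplus> r \<otimes> slot_absent R k g l" if "r \<in> carrier R"
  using that
proof (induction k arbitrary: f g l)
  case (Suc k) then show ?case by (cases l) auto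
qed simp

lemma slot_absent_neg: "slot_absent R k (\<lambda>l. \<ominus> f l) l = \<ominus> slot_absent R k f l"
proof (induction k arbitrary: f l)
  case (Suc k) then show ?case by (cases l) auto
qed simp

lemma slot_present_neg: "\<lbrakk>\<And>l. f l \<in> carrier R\<rbrakk> \<Longrightarrow> slot_present R k (\<lambda>l. \<ominus> f l) l = \<ominus> slot_present R k f l"
proof (induction k arbitrary: f l)
  case (Suc k) then show ?case by (cases l) auto
qed simp

lemma slot_present_add_smult:
  "\<lbrakk>\<And>l. f l \<in> carrier R; \<And>l. g l \<in> carrier R; r \<in> carrier R\<rbrakk> \<Longrightarrow>
   slot_present R k (\<lambda>l. f l \<oplus> r \<otimes> g l) l = slot_present R k f l \<oplus> r \<otimes> slot_present R k g l"
proof (induction k arbitrary: f g l)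
  case (Suc k) then show ?case by (cases l) (auto simp: slot_present_carr minus_add r_minus)
qed simp

lemma slot_absent_chains: "\<lbrakk>f \<in> chains (Suc n) s; k \<le> n\<rbrakk> \<Longrightarrow> slot_absent R k f \<in> chains n s"
proof (induction k arbitrary: f n s)
  case 0
  have "slot_absent R 0 f = (\<lambda>l. f (False # l))" by (rule ext) simp
  with 0 show ?case by (simp add: chains_lo)
next
  case (Suc k)
  then obtain m where n: "n = Suc m" "k \<le> m" by (cases n) auto
  show ?case using Suc.IH[OF chains_lo n(2)] Suc.IH[OF chains_hi n(2)] Suc.prems n by (simp add: chains_Suc)
qed

lemma chains_neg: "f \<in> chains n s \<Longrightarrow> (\<lambda>l. \<ominus> f l) \<in> chains n s"
  using chains_minus[OF chains_zero, of f n s] by (simp add: minus_eq chains_carr)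

lemma slot_present_chains: "\<lbrakk>f \<in> chains (Suc n) s; k \<le> n\<rbrakk> \<Longrightarrow> slot_present R k f \<in> chains n (s - 1)"
proof (induction k arbitrary: f n s)
  case 0
  have "slot_present R 0 f = (\<lambda>l. f (True # l))" by (rule ext) simp
  with 0 show ?case by (simp add: chains_hi)
next
  case (Suc k)
  then obtain m where n: "n = Suc m" "k \<le> m" by (cases n) auto
  have "slot_present R k (\<lambda>l. f (True # l)) \<in> chains m (s - 1 - 1)"
    "slot_present R k (\<lambda>l. f (False # l)) \<in> chains m (s - 1)"
    using Suc.IH[OF chains_lo n(2)] Suc.IH[OF chains_hi n(2)] Suc.prems n by auto
  then show ?case using n by (simp add: chains_Suc chains_neg)
qed

lemma slot_absent_kdiff:
  "\<lbrakk>\<And>l. f l \<in> carrier R; set bs \<subseteq> carrier R; set cs \<subseteq> carrier R; b \<in> carrier R;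
    \<And>l. length l < Suc (length bs) \<Longrightarrow> f l = \<zero>\<rbrakk> \<Longrightarrow>
   slot_absent R (length bs) (kdiff R (bs @ b # cs) f) l =
     kdiff R (bs @ cs) (slot_absent R (length bs) f) l \<oplus> b \<otimes> slot_present R (length bs) f l"
proof (induction bs arbitrary: f l)
  case Nil
  have "slot_absent R 0 f = (\<lambda>l. f (False # l))" by (rule ext) simp
  then show ?case using Nil by simp
next
  case (Cons c bs)
  have c: "c \<in> carrier R" "set bs \<subseteq> carrier R" using Cons.prems by auto
  have bc: "set (bs @ b # cs) \<subseteq> carrier R" "set (bs @ cs) \<subseteq> carrier R" using Cons.prems by auto
  have f: "f l \<in> carrier R" for l by fact
  show ?case
  proof (cases l)
    case Nil
    then show ?thesis using Cons.prems by simp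
  next
    case (Cons x m)
    have k1: "slot_absent R (length bs) (\<lambda>l. f (y # l)) m \<in> carrier R" for y m using f by (intro slot_absent_carr)
    have k2: "slot_present R (length bs) (\<lambda>l. f (y # l)) m \<in> carrier R" for y m using f by (intro slot_present_carr)
    have k3: "kdiff R (bs @ cs) (slot_absent R (length bs) (\<lambda>l. f (y # l))) m \<in> carrier R" for y m
      using k1 bc by (intro kdiff_carr) auto
    have IH: "slot_absent R (length bs) (kdiff R (bs @ b # cs) (\<lambda>l. f (y # l))) m =
      kdiff R (bs @ cs) (slot_absent R (length bs) (\<lambda>l. f (y # l))) m \<oplus> b \<otimes> slot_present R (length bs) (\<lambda>l. f (y # l)) m" for y
      by (rule Cons.IH) (use Cons.prems c in auto)
    show ?thesis
      using c k1 k2 k3 Cons.prems(4) by (simp add: Cons slot_absent_neg slot_absent_add_smult IH minus_add r_minus a_ac)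
  qed
qed

lemma slot_present_kdiff:
  "\<lbrakk>\<And>l. f l \<in> carrier R; set bs \<subseteq> carrier R; set cs \<subseteq> carrier R; b \<in> carrier R\<rbrakk> \<Longrightarrow>
   slot_present R (length bs) (kdiff R (bs @ b # cs) f) l = \<ominus> kdiff R (bs @ cs) (slot_present R (length bs) f) l"
proof (induction bs arbitrary: f l)
  case Nil
  have "slot_present R 0 f = (\<lambda>l. f (True # l))" by (rule ext) simp
  then show ?case using Nil by simp
next
  case (Cons c bs)
  have c: "c \<in> carrier R" "set bs \<subseteq> carrier R" using Cons.prems by auto
  have bc: "set (bs @ b # cs) \<subseteq> carrier R" "set (bs @ cs) \<subseteq> carrier R" using Cons.prems by auto
  have f: "f l \<in> carrier R" for l by fact
  show ?case
  proof (cases l)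
    case Nil
    then show ?thesis using Cons.prems by simp
  next
    case (Cons x m)
    have k2: "slot_present R (length bs) (\<lambda>l. f (y # l)) m \<in> carrier R" for y m using f by (intro slot_present_carr)
    have k3: "kdiff R (bs @ cs) (slot_present R (length bs) (\<lambda>l. f (y # l))) m \<in> carrier R" for y m
      using k2 bc by (intro kdiff_carr) auto
    have k4: "kdiff R (bs @ b # cs) (\<lambda>l. f (y # l)) m \<in> carrier R" for y m
      using f bc by (intro kdiff_carr) auto
    have IH: "slot_present R (length bs) (kdiff R (bs @ b # cs) (\<lambda>l. f (y # l))) m =
      \<ominus> kdiff R (bs @ cs) (slot_present R (length bs) (\<lambda>l. f (y # l))) m" for y
      by (rule Cons.IH) (use Cons.prems c in auto)
    show ?thesis
      using c f k2 k3 k4 bc by (simp add: Cons slot_present_neg slot_present_add_smult kdiff_neg IH minus_add r_minus)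
  qed
qed

lemma kembed_chains: "f \<in> chains p s \<Longrightarrow> kembed R p q f \<in> chains (p + q) s"
proof (induction p arbitrary: f s)
  case 0
  have "count_list (replicate q False) True = 0" by (induction q) auto
  moreover have "s = 0" if "f [] \<noteq> \<zero>" using chains_supp[OF 0, of "[]"] that by auto
  ultimately show ?case using chains_carr[OF 0, of "[]"] by (auto intro!: chainsI split: if_splits)
next
  case (Suc p) then show ?case by (auto simp: chains_Suc)
qed

lemma kembed_0: "f \<in> chains p s \<Longrightarrow> kembed R p 0 f = f"
proof (induction p arbitrary: f s)
  case 0
  show ?case
  proof (rule ext)
    fix l show "kembed R 0 0 f l = f l" using chains_supp[OF 0, of l] by (cases l) auto
  qed
next
  case (Suc p)
  show ?case
  proof (rule ext)
    fix l show "kembed R (Suc p) 0 f l = f l"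
      using Suc.IH[OF chains_lo[OF Suc.prems]] Suc.IH[OF chains_hi[OF Suc.prems]] Suc.prems
      by (cases l; case_tac "hd l") (auto simp: chains_Suc)
  qed
qed

lemma slot_absent_kembed: "slot_absent R p (kembed R p (Suc q) f) l = kembed R p q f l"
proof (induction p arbitrary: f l)
  case (Suc p) then show ?case by (cases l) auto
qed simp

lemma slot_present_kembed: "slot_present R p (kembed R p (Suc q) f) l = \<zero>"
proof (induction p arbitrary: f l)
  case (Suc p) then show ?case by (cases l) auto
qed simp

lemma kembed_add_smult:
  "\<lbrakk>\<And>l. f l \<in> carrier R; \<And>l. g l \<in> carrier R; r \<in> carrier R\<rbrakk> \<Longrightarrow>
   kembed R p q (\<lambda>l. f l \<oplus> r \<otimes> g l) l = kembed R p q f l \<oplus> r \<otimes> kembed R p q g l"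
proof (induction p arbitrary: f g l)
  case (Suc k) then show ?case by (cases l) auto
qed simp

lemma kembed_neg: "kembed R p q (\<lambda>l. \<ominus> f l) l = \<ominus> kembed R p q f l"
proof (induction p arbitrary: f l)
  case (Suc k) then show ?case by (cases l) auto
qed simp

lemma kdiff_unit:
  "set bs \<subseteq> carrier R \<Longrightarrow> r \<in> carrier R \<Longrightarrow>
   kdiff R bs (\<lambda>l. if l = replicate (length bs) False then r else \<zero>) l = \<zero>"
proof (induction bs arbitrary: l)
  case (Cons b bs) then show ?case by (cases l) (auto simp: kdiff_zero)
qed simp

lemma kdiff_kembed:
  "\<lbrakk>f \<in> chains (length cs) s; set bs \<subseteq> carrier R; set cs \<subseteq> carrier R\<rbrakk> \<Longrightarrow>
   kdiff R (cs @ bs) (kembed R (length cs) (length bs) f) l =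
     kembed R (length cs) (length bs) (kdiff R cs f) l"
proof (induction cs arbitrary: f s l)
  case Nil
  have e: "kembed R 0 (length bs) f = (\<lambda>l. if l = replicate (length bs) False then f [] else \<zero>)"
    by (rule ext) simp
  show ?case using Nil chains_carr by (simp add: e kdiff_unit)
next
  case (Cons c cs)
  show ?case
  proof (cases l)
    case (Cons x m)
    have f: "f l \<in> carrier R" for l using Cons.prems chains_carr by blast
    have d: "kdiff R cs (\<lambda>l. f (y # l)) m \<in> carrier R" for y m
      using Cons.prems f by (intro kdiff_carr) auto
    have IH: "kdiff R (cs @ bs) (kembed R (length cs) (length bs) (\<lambda>l. f (y # l))) m =
      kembed R (length cs) (length bs) (kdiff R cs (\<lambda>l. f (y # l))) m" for y
      using Cons.IH[OF chains_lo[of f]] Cons.IH[OF chains_hi[of f]] Cons.prems by (cases y) auto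
    show ?thesis using Cons.prems f d by (simp add: Cons IH kembed_neg kembed_add_smult)
  qed simp
qed

lemma kembed_append: "length l = p \<Longrightarrow> kembed R p q f (l @ replicate q False) = f l"
proof (induction p arbitrary: f l)
  case (Suc p) then show ?case by (cases l) auto
qed simp

lemma slot_absent_append: "length l = k \<Longrightarrow> slot_absent R k f (l @ m) = f (l @ False # m)"
proof (induction k arbitrary: f l)
  case (Suc p) then show ?case by (cases l) auto
qed simp

lemma kscale_kembed:
  "\<lbrakk>\<And>l. f l \<in> carrier R; length cs = p; length bs = q; \<forall>c\<in>set cs. c = \<one>; set bs \<subseteq> carrier R\<rbrakk> \<Longrightarrow>
   kscale R (cs @ bs) (kembed R p q f) l = kembed R p q f l"
proof (induction cs arbitrary: f p l)
  case Nil
  have e: "kembed R 0 (length bs) f = (\<lambda>l. if l = replicate (length bs) False then f [] else \<zero>)"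
    by (rule ext) simp
  have "kscale R bs (\<lambda>l. if l = replicate (length bs) False then r else \<zero>) l =
     (if l = replicate (length bs) False then r else \<zero>)" if "set bs \<subseteq> carrier R" for bs l r
    using that
  proof (induction bs arbitrary: l)
    case (Cons b bs) then show ?case by (cases l) (auto simp: kscale_zero)
  qed simp
  then show ?case using Nil by (auto simp: e)
next
  case (Cons c cs)
  have k: "kembed R p q f l \<in> carrier R" if "\<And>l. f l \<in> carrier R" for p q f l
    using that
  proof (induction p arbitrary: f l)
    case (Suc p) then show ?case by (cases l) auto
  qed simp
  show ?case
  proof (cases l)
    case (Cons x m)
    have "kscale R (cs @ bs) (kembed R (length cs) q (\<lambda>l. f (y # l))) m = kembed R (length cs) q (\<lambda>l. f (y # l)) m" for y
      by (rule Cons.IH) (use Cons.prems in auto)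
    then show ?thesis using Cons.prems k Cons by auto
  qed (use Cons.prems in auto)
qed

lemma kscale_append:
  "\<lbrakk>\<And>l. f l \<in> carrier R; length l = length cs; \<forall>c\<in>set cs. c = \<one>; length bs = q; set bs \<subseteq> carrier R\<rbrakk> \<Longrightarrow>
   kscale R (cs @ bs) f (l @ replicate q False) = f (l @ replicate q False)"
proof (induction cs arbitrary: f l)
  case Nil
  have "kscale R bs f (replicate (length bs) False) = f (replicate (length bs) False)"
    by (induction bs arbitrary: f) auto
  then show ?case using Nil by auto
next
  case (Cons c cs) then show ?case by (cases l) auto
qed

text \<open>
  On the cone \<open>(u, v)\<close> of \<open>b = c a\<close>, where multiplication by
  \<open>a\<close> has a null-homotopy \<open>h\<close>, the map \<open>(u, v) \<mapsto> u + c h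
  v\<close> is a retraction of complexes. When the boundary has no part in the slot of
  \<open>b\<close>, the chain \<open>v\<close> is a cycle, and \<open>d (u + c h v) = d u + c a
  v\<close>.
\<close>

lemma retraction_step:
  assumes X: "X \<in> chains (length cs + Suc (length bs)) t"
    and cs: "set cs \<subseteq> carrier R" and bs: "set bs \<subseteq> carrier R"
    and k: "k < length cs" and c: "c \<in> carrier R" and b: "b = c \<otimes> cs ! k"
    and fib: "\<And>l. slot_present R (length cs) (kdiff R (cs @ b # bs) X) l = \<zero>"
  defines "X' \<equiv> \<lambda>l. slot_absent R (length cs) X l \<oplus> c \<otimes> kwedge R k (slot_present R (length cs) X) l"
  shows "X' \<in> chains (length cs + length bs) t"
    and "kdiff R (cs @ bs) X' l = slot_absent R (length cs) (kdiff R (cs @ b # bs) X) l"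
proof -
  let ?p = "length cs"
  let ?u = "slot_absent R ?p X" and ?v = "slot_present R ?p X"
  have X1: "X \<in> chains (Suc (?p + length bs)) t" using X by simp
  have u: "?u \<in> chains (?p + length bs) t" by (rule slot_absent_chains[OF X1]) simp
  have v: "?v \<in> chains (length (cs @ bs)) (t - 1)" using slot_present_chains[OF X1, of ?p] by simp
  have hv: "kwedge R k ?v \<in> chains (?p + length bs) t" using kwedge_chains[OF v, of k] k by simp
  show "X' \<in> chains (?p + length bs) t" unfolding X'_def by (intro chains_add chains_smult u hv c)
  have "cs ! k \<in> carrier R" using cs k nth_mem by blast
  then have bc: "b \<in> carrier R" "cs ! k \<in> carrier R" using b c by auto
  have csbs: "set (cs @ bs) \<subseteq> carrier R" using cs bs by auto
  have Xc: "X l \<in> carrier R" for l using X chains_carr by blast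
  have vc: "?v l \<in> carrier R" and uc: "?u l \<in> carrier R" and hc: "kwedge R k ?v l \<in> carrier R" for l
    using u v hv chains_carr by blast+
  have dv: "kdiff R (cs @ bs) ?v = (\<lambda>_. \<zero>)"
  proof (rule ext)
    fix l
    have n: "\<ominus> kdiff R (cs @ bs) ?v l = \<zero>" using slot_present_kdiff[of X cs bs b l] fib Xc cs bs bc by simp
    have "kdiff R (cs @ bs) ?v l = \<ominus> (\<ominus> kdiff R (cs @ bs) ?v l)" by (simp only: minus_minus[OF kdiff_carr[OF vc csbs]])
    then show "kdiff R (cs @ bs) ?v l = \<zero>" by (simp only: n minus_zero)
  qed
  have "kdiff R (cs @ bs) (kwedge R k ?v) l \<oplus> kwedge R k (kdiff R (cs @ bs) ?v) l = (cs @ bs) ! k \<otimes> ?v l"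
    by (rule kwedge_homotopy[OF v csbs]) (use k in simp)
  then have dh: "kdiff R (cs @ bs) (kwedge R k ?v) l = cs ! k \<otimes> ?v l"
    using kdiff_carr[of "kwedge R k ?v", OF hc csbs] k by (simp add: dv kwedge_zero nth_append)
  have "kdiff R (cs @ bs) X' l = kdiff R (cs @ bs) ?u l \<oplus> c \<otimes> (cs ! k \<otimes> ?v l)"
    unfolding X'_def using uc hc c csbs by (simp add: kdiff_add kdiff_smult dh)
  also have "\<dots> = kdiff R (cs @ bs) ?u l \<oplus> b \<otimes> ?v l" using b c bc vc by (simp add: m_assoc)
  also have "\<dots> = slot_absent R ?p (kdiff R (cs @ b # bs) X) l"
    by (rule slot_absent_kdiff[symmetric]) (use Xc cs bs bc chains_supp[OF X] in auto)
  finally show "kdiff R (cs @ bs) X' l = slot_absent R ?p (kdiff R (cs @ b # bs) X) l" .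
qed

text \<open>
  Removing the entries of \<open>bs\<close> one at a time turns a chain that bounds
  \<open>x\<close> in the larger complex into one that bounds \<open>x\<close> in the smaller
  complex. Each removal changes the part free of the slots of \<open>bs\<close> only by a multiple
  of the factor \<open>c\<close>, so this part stays in \<open>J\<close>.
\<close>

lemma retraction:
  assumes "X \<in> chains (length cs + length bs) t" "set cs \<subseteq> carrier R" "ideal J R" "x \<in> chains (length cs) s"
    and "\<forall>b\<in>set bs. \<exists>c\<in>J. \<exists>k<length cs. b = c \<otimes> cs ! k"
    and "kdiff R (cs @ bs) X = kembed R (length cs) (length bs) x"
    and "\<And>l. length l = length cs \<Longrightarrow> X (l @ replicate (length bs) False) \<in> J"
  shows "\<exists>y\<in>chains (length cs) t. (\<forall>l. y l \<in> J) \<and> kdiff R cs y = x"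
  using assms
proof (induction bs arbitrary: X)
  case Nil
  interpret J: ideal J R by fact
  have "X l \<in> J" for l
    using Nil.prems(7)[of l] chains_supp[OF Nil.prems(1), of l] J.zero_closed by (cases "length l = length cs") auto
  then show ?case using Nil kembed_0[OF Nil.prems(4)] by (intro bexI[of _ X]) auto
next
  case (Cons b bs)
  interpret J: ideal J R by fact
  obtain c k where ck: "c \<in> J" "k < length cs" "b = c \<otimes> cs ! k" using Cons.prems(5) by auto
  have c: "c \<in> carrier R" using ck J.Icarr by auto
  have bs: "set bs \<subseteq> carrier R"
  proof
    fix d assume "d \<in> set bs"
    then obtain c k where *: "c \<in> J" "k < length cs" "d = c \<otimes> cs ! k" using Cons.prems(5) by auto
    then have "cs ! k \<in> carrier R" using Cons.prems(2) nth_mem by blast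
    then show "d \<in> carrier R" using * J.Icarr by simp
  qed
  let ?X = "\<lambda>l. slot_absent R (length cs) X l \<oplus> c \<otimes> kwedge R k (slot_present R (length cs) X) l"
  have X: "X \<in> chains (length cs + Suc (length bs)) t" using Cons.prems(1) by simp
  have f: "slot_present R (length cs) (kdiff R (cs @ b # bs) X) l = \<zero>" for l
    using Cons.prems(6) by (simp add: slot_present_kembed)
  note st = retraction_step[OF X Cons.prems(2) bs ck(2) c ck(3) f]
  have Xc: "X l \<in> carrier R" for l using X chains_carr by blast
  have h: "kwedge R k (slot_present R (length cs) X) l \<in> carrier R" for l
    by (intro kwedge_carr slot_present_carr Xc)
  show ?case
  proof (rule Cons.IH[OF st(1) Cons.prems(2,3,4)])
    show "\<forall>b\<in>set bs. \<exists>c\<in>J. \<exists>k<length cs. b = c \<otimes> cs ! k" using Cons.prems(5) by simp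
    show "kdiff R (cs @ bs) ?X = kembed R (length cs) (length bs) x"
      by (rule ext) (simp add: st(2) Cons.prems(6) slot_absent_kembed)
    show "slot_absent R (length cs) X (l @ replicate (length bs) False) \<oplus>
         c \<otimes> kwedge R k (slot_present R (length cs) X) (l @ replicate (length bs) False) \<in> J"
      if "length l = length cs" for l
      using Cons.prems(7)[OF that] that ck(1) h by (simp add: slot_absent_append J.I_r_closed)
  qed
qed

end

section \<open>Powers of a finitely generated ideal\<close>

text \<open>
  Weak proregularity in coordinates: the transition maps cycles of homological degree at least 1
  to boundaries.
\<close>

definition koszul_pro_zero :: "('a, 'r) ring_scheme \<Rightarrow> 'a list \<Rightarrow> bool" where
  "koszul_pro_zero R as \<longleftrightarrow>
     (\<forall>s\<ge>1. \<forall>j0\<ge>1. \<exists>j1\<ge>j0. \<forall>f\<in>koszul_chains R (length as) s.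
        kdiff R (seq_power R as j1) f = (\<lambda>_. \<zero>\<^bsub>R\<^esub>) \<longrightarrow>
        (\<exists>h\<in>koszul_chains R (length as) (s + 1).
           kscale R (seq_power R as (j1 - j0)) f = kdiff R (seq_power R as j0) h))"

context cring
begin

lemma ideal_power_ideal: "ideal I R \<Longrightarrow> ideal (ideal_power R I k) R"
proof -
  assume I: "ideal I R"
  interpret M: comm_monoid "ideals_set R" by (rule ideals_set_is_comm_monoid)
  have "I [^]\<^bsub>ideals_set R\<^esub> k \<in> carrier (ideals_set R)"
    by (rule M.nat_pow_closed) (simp add: ideals_set_def I)
  then show ?thesis by (simp add: ideal_power_def ideals_set_def)
qed

lemma ideal_power_0: "ideal_power R I 0 = carrier R"
  by (simp add: ideal_power_def ideals_set_def)

lemma ideal_power_Suc: "ideal_power R I (Suc k) = ideal_power R I k \<cdot> I"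
  by (simp add: ideal_power_def ideals_set_def)

lemma ideal_power_antimono: "ideal I R \<Longrightarrow> k \<le> n \<Longrightarrow> ideal_power R I n \<subseteq> ideal_power R I k"
proof (induction n)
  case (Suc n)
  have "ideal_power R I (Suc n) \<subseteq> ideal_power R I n"
    unfolding ideal_power_Suc using ideal_prod_inter[OF ideal_power_ideal[OF Suc.prems(1)] Suc.prems(1)] by blast
  then show ?case using Suc by (cases "k = Suc n") auto
qed simp

lemma pow_in_ideal_power: "ideal I R \<Longrightarrow> a \<in> I \<Longrightarrow> a [^] (k::nat) \<in> ideal_power R I k"
proof (induction k)
  case 0 then show ?case by (simp add: ideal_power_0)
next
  case (Suc k) then show ?case by (simp add: ideal_power_Suc ideal_prod.prod)
qed

text \<open>
  A power of the ideal is generated by products of generators. The induction on \<open>N\<close>,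
  for all \<open>J\<close> at once, passes from \<open>J\<close> to the colon ideals of
  \<open>J\<close> by an element.
\<close>

lemma ideal_prodlist_least:
  assumes S: "S \<subseteq> carrier R" and J: "ideal J R"
    and "\<And>ws. length ws = N \<Longrightarrow> set ws \<subseteq> S \<Longrightarrow> foldr (\<otimes>) ws \<one> \<in> J"
  shows "ideal_power R (Idl S) N \<subseteq> J"
  using assms(2,3)
proof (induction N arbitrary: J)
  case 0
  then have "\<one> \<in> J" by (force dest: spec[of _ "[]"])
  then show ?case by (simp add: ideal_power_0 ideal.one_imp_carrier[OF 0(1)])
next
  case (Suc N)
  interpret J: ideal J R by fact
  have iI: "ideal (Idl S) R" by (rule genideal_ideal[OF S])
  have colon: "ideal {x \<in> carrier R. w \<otimes> x \<in> J} R" if w: "w \<in> carrier R" for w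
  proof (rule idealI)
    show "ring R" by (rule ring_axioms)
    show "subgroup {x \<in> carrier R. w \<otimes> x \<in> J} (add_monoid R)"
    proof (rule subgroup.intro)
      show "inv\<^bsub>add_monoid R\<^esub> x \<in> {x \<in> carrier R. w \<otimes> x \<in> J}" if "x \<in> {x \<in> carrier R. w \<otimes> x \<in> J}" for x
        using that w J.a_inv_closed by (simp add: a_inv_def[symmetric] r_minus)
    qed (use w in \<open>auto simp: r_distr\<close>)
    show "x \<otimes> a \<in> {x \<in> carrier R. w \<otimes> x \<in> J}" "a \<otimes> x \<in> {x \<in> carrier R. w \<otimes> x \<in> J}"
      if "a \<in> {x \<in> carrier R. w \<otimes> x \<in> J}" "x \<in> carrier R" for a x
    proof -
      have e: "w \<otimes> (a \<otimes> x) = w \<otimes> a \<otimes> x" using that w by (simp add: m_assoc)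
      have e': "x \<otimes> a = a \<otimes> x" using that by (simp add: m_comm)
      have "w \<otimes> a \<otimes> x \<in> J" using that J.I_r_closed by simp
      then show "x \<otimes> a \<in> {x \<in> carrier R. w \<otimes> x \<in> J}" "a \<otimes> x \<in> {x \<in> carrier R. w \<otimes> x \<in> J}"
        using that w e unfolding e' by simp_all
    qed
  qed
  have 1: "x \<otimes> y \<in> J" if x: "x \<in> ideal_power R (Idl S) N" and y: "y \<in> Idl S" for x y
  proof -
    have xc: "x \<in> carrier R" by (rule ideal.Icarr[OF ideal_power_ideal[OF iI] x])
    have "S \<subseteq> {y \<in> carrier R. x \<otimes> y \<in> J}"
    proof
      fix w assume w: "w \<in> S"
      then have wc: "w \<in> carrier R" using S by auto
      have "ideal_power R (Idl S) N \<subseteq> {x \<in> carrier R. w \<otimes> x \<in> J}"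
      proof (rule Suc.IH[OF colon[OF wc]])
        fix ws :: "'a list" assume ws: "length ws = N" "set ws \<subseteq> S"
        have "foldr (\<otimes>) (w # ws) \<one> \<in> J" by (rule Suc.prems(2)) (use ws w in auto)
        moreover have "foldr (\<otimes>) ws \<one> \<in> carrier R" using ws S by (induction ws arbitrary: N) auto
        ultimately show "foldr (\<otimes>) ws \<one> \<in> {x \<in> carrier R. w \<otimes> x \<in> J}" by simp
      qed
      then have "w \<otimes> x \<in> J" using x by blast
      then show "w \<in> {y \<in> carrier R. x \<otimes> y \<in> J}" using wc xc by (simp add: m_comm)
    qed
    then have "Idl S \<subseteq> {y \<in> carrier R. x \<otimes> y \<in> J}" by (rule genideal_minimal[OF colon[OF xc]])
    then show ?thesis using y by blast
  qed
  show ?case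
  proof
    fix z assume "z \<in> ideal_power R (Idl S) (Suc N)"
    then have "z \<in> ideal_power R (Idl S) N \<cdot> (Idl S)" by (simp add: ideal_power_Suc)
    then show "z \<in> J" by (induction z rule: ideal_prod.induct) (auto intro: 1)
  qed
qed

lemma prodlist_count:
  assumes "set ws \<subseteq> carrier R" "a \<in> carrier R"
  shows "\<exists>r\<in>carrier R. foldr (\<otimes>) ws \<one> = a [^] (count_list ws a) \<otimes> r"
  using assms
proof (induction ws)
  case Nil then show ?case by auto
next
  case (Cons w ws)
  then obtain r where r: "r \<in> carrier R" "foldr (\<otimes>) ws \<one> = a [^] (count_list ws a) \<otimes> r" by auto
  show ?case
  proof (cases "w = a")
    case True
    then show ?thesis using r Cons.prems by (intro bexI[of _ r]) (auto simp: m_ac)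
  next
    case False
    then show ?thesis using r Cons.prems by (intro bexI[of _ "w \<otimes> r"]) (auto simp: m_ac)
  qed
qed

lemma seq_power_carrier: "set as \<subseteq> carrier R \<Longrightarrow> set (seq_power R as j) \<subseteq> carrier R"
  by (auto simp: seq_power_def)

lemma length_seq_power [simp]: "length (seq_power R as j) = length as"
  by (simp add: seq_power_def)

lemma map2_seq_power:
  "set as \<subseteq> carrier R \<Longrightarrow> map2 (\<otimes>) (seq_power R as i) (seq_power R as j) = seq_power R as (i + j)"
  by (induction as) (auto simp: seq_power_def nat_pow_mult)

text \<open>
  A product of \<open>length as * m\<close> generators contains some generator at least
  \<open>m\<close> times.
\<close>

lemma ideal_power_pigeonhole:
  assumes as: "set as \<subseteq> carrier R" "as \<noteq> []" and m: "m \<ge> 1"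
  shows "ideal_power R (Idl (set as)) (length as * m) \<subseteq> Idl (set (seq_power R as m))"
proof (rule ideal_prodlist_least[OF as(1)])
  have sc: "set (seq_power R as m) \<subseteq> carrier R" by (rule seq_power_carrier[OF as(1)])
  show iI: "ideal (Idl (set (seq_power R as m))) R" by (rule genideal_ideal[OF sc])
  interpret J: ideal "Idl (set (seq_power R as m))" R by fact
  fix ws assume ws: "length ws = length as * m" "set ws \<subseteq> set as"
  have "\<exists>a\<in>set as. m \<le> count_list ws a"
  proof (rule ccontr)
    assume "\<not> ?thesis"
    then have lt: "\<forall>a\<in>set as. count_list ws a \<le> m - 1" by auto
    have "length ws = (\<Sum>a\<in>set as. count_list ws a)"
      by (rule sum_count_set[OF ws(2), symmetric]) simp
    also have "\<dots> \<le> card (set as) * (m - 1)"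
      using sum_bounded_above[of "set as" "count_list ws" "m - 1"] lt by simp
    also have "\<dots> \<le> length as * (m - 1)" by (simp add: card_length)
    also have "\<dots> < length as * m" using as m by simp
    finally show False using ws by simp
  qed
  then obtain a where a: "a \<in> set as" "m \<le> count_list ws a" by blast
  have ac: "a \<in> carrier R" using a as by auto
  obtain r where r: "r \<in> carrier R" "foldr (\<otimes>) ws \<one> = a [^] (count_list ws a) \<otimes> r"
    using prodlist_count[of ws a] ws as ac by auto
  have "a [^] m \<in> Idl (set (seq_power R as m))"
    using a genideal_self[OF sc] by (auto simp: seq_power_def)
  moreover have "foldr (\<otimes>) ws \<one> = a [^] m \<otimes> (a [^] (count_list ws a - m) \<otimes> r)"
  proof -
    have "a [^] m \<otimes> a [^] (count_list ws a - m) = a [^] count_list ws a"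
      using nat_pow_mult[OF ac, of m "count_list ws a - m"] a by simp
    then show ?thesis using r ac m_assoc[of "a [^] m" "a [^] (count_list ws a - m)" r] by simp
  qed
  ultimately show "foldr (\<otimes>) ws \<one> \<in> Idl (set (seq_power R as m))"
    using r ac by (simp add: J.I_r_closed)
qed

section \<open>An Artin-Rees property of Koszul complexes\<close>

lemma chains_0_eq: "f \<in> chains n 0 \<Longrightarrow> f = (\<lambda>l. if l = replicate n False then f (replicate n False) else \<zero>)"
proof (rule ext)
  fix l assume f: "f \<in> chains n 0"
  have "l = replicate (length l) False" if "count_list l True = 0"
    using that by (induction l) (auto split: if_splits)
  then show "f l = (if l = replicate n False then f (replicate n False) else \<zero>)"
    using chains_supp[OF f, of l] by (cases "count_list l True = 0"; cases "length l = n") auto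
qed

text \<open>
  The boundaries in degree 0 form an ideal that contains every entry of the sequence.
\<close>

lemma degree_zero_boundary:
  assumes bs: "set bs \<subseteq> carrier R" and r: "r \<in> Idl (set bs)"
  shows "\<exists>w\<in>chains (length bs) 1. kdiff R bs w = (\<lambda>l. if l = replicate (length bs) False then r else \<zero>)"
proof -
  let ?u = "\<lambda>n r l. if l = replicate n False then r else \<zero>"
  let ?S = "\<lambda>bs. {r \<in> carrier R. \<exists>w\<in>chains (length bs) 1. kdiff R bs w = ?u (length bs) r}"
  have I: "ideal (?S bs) R"
  proof (rule idealI)
    show "ring R" by (rule ring_axioms)
    have sm: "x \<otimes> a \<in> ?S bs" if a: "a \<in> ?S bs" and x: "x \<in> carrier R" for a x
    proof -
      obtain w where w: "w \<in> chains (length bs) 1" "kdiff R bs w = ?u (length bs) a" using a by auto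
      have "kdiff R bs (\<lambda>l. x \<otimes> w l) = ?u (length bs) (x \<otimes> a)"
        using w x bs by (auto simp: kdiff_smult chains_carr)
      then show ?thesis using chains_smult[OF w(1) x] a x by blast
    qed
    show "x \<otimes> a \<in> ?S bs" if "a \<in> ?S bs" "x \<in> carrier R" for a x using sm that .
    show "a \<otimes> x \<in> ?S bs" if "a \<in> ?S bs" "x \<in> carrier R" for a x
    proof -
      have "a \<otimes> x = x \<otimes> a" using that by (simp add: m_comm)
      then show ?thesis using sm[OF that] by (simp only:)
    qed
    show "subgroup (?S bs) (add_monoid R)"
    proof (rule subgroup.intro)
      have "kdiff R bs (\<lambda>_. \<zero>) = ?u (length bs) \<zero>" using bs by (auto simp: kdiff_zero)
      then show "\<one>\<^bsub>add_monoid R\<^esub> \<in> ?S bs" using chains_zero by auto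
      show "x \<otimes>\<^bsub>add_monoid R\<^esub> y \<in> ?S bs" if xy: "x \<in> ?S bs" "y \<in> ?S bs" for x y
      proof -
        obtain w v where w: "w \<in> chains (length bs) 1" "kdiff R bs w = ?u (length bs) x"
          and v: "v \<in> chains (length bs) 1" "kdiff R bs v = ?u (length bs) y" using xy by auto
        have "kdiff R bs (\<lambda>l. w l \<oplus> v l) = ?u (length bs) (x \<oplus> y)"
          using w v bs by (auto simp: kdiff_add chains_carr)
        then show ?thesis using chains_add[OF w(1) v(1)] xy by auto
      qed
      show "inv\<^bsub>add_monoid R\<^esub> x \<in> ?S bs" if "x \<in> ?S bs" for x
      proof -
        have "inv\<^bsub>add_monoid R\<^esub> x = \<ominus> \<one> \<otimes> x" using that by (simp add: a_inv_def[symmetric] l_minus)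
        then show ?thesis using sm[OF that, of "\<ominus> \<one>"] by (simp only: one_closed a_inv_closed)
      qed
    qed auto
  qed
  have gen: "b \<in> ?S bs" if "b \<in> set bs" for b
    using that bs
  proof (induction bs)
    case (Cons c bs)
    have bc: "b \<in> carrier R" "c \<in> carrier R" "set bs \<subseteq> carrier R" using Cons.prems by auto
    have "\<exists>w\<in>chains (length (c # bs)) 1. kdiff R (c # bs) w = ?u (length (c # bs)) b"
    proof (cases "b = c")
      case True
      let ?w = "\<lambda>l. case l of [] \<Rightarrow> \<zero> | x # k \<Rightarrow> if x then ?u (length bs) \<one> k else \<zero>"
      have "count_list (replicate n False) True = 0" for n by (induction n) auto
      then have "?u (length bs) \<one> \<in> chains (length bs) 0" by (auto intro!: chainsI split: if_splits)
      then have w: "?w \<in> chains (Suc (length bs)) 1" by (simp add: chains_Suc chains_zero)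
      have "kdiff R (c # bs) ?w l = ?u (length (c # bs)) b l" for l
        using bc True by (cases l) (auto simp: kdiff_zero kdiff_unit)
      then show ?thesis using w by (intro bexI[of _ ?w]) auto
    next
      case False
      then obtain v where v: "v \<in> chains (length bs) 1" "kdiff R bs v = ?u (length bs) b"
        using Cons by auto
      let ?w = "\<lambda>l. case l of [] \<Rightarrow> \<zero> | x # k \<Rightarrow> if x then \<zero> else v k"
      have w: "?w \<in> chains (Suc (length bs)) 1" using v by (simp add: chains_Suc chains_zero)
      have "kdiff R (c # bs) ?w l = ?u (length (c # bs)) b l" for l
        using bc v by (cases l) (auto simp: kdiff_zero kdiff_unit)
      then show ?thesis using w by (intro bexI[of _ ?w]) auto
    qed
    then show ?case using bc by blast
  qed simp
  have "Idl (set bs) \<subseteq> ?S bs" by (rule genideal_minimal[OF I]) (use gen in blast)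
  then show ?thesis using r by blast
qed

text \<open>
  The words \<open>l @ replicate p False\<close> are those that do not involve the last
  \<open>p\<close> slots; restricting the coefficients there to \<open>I\<^sup>j\<close> describes
  \<open>K(cs) \<otimes> L\<^sub>j\<close>, with \<open>L\<^sub>j\<close> the complex of the
  \<open>j\<close>-th powers with \<open>I\<^sup>j\<close> in place of the ring in degree 0.
  Pro-acyclicity passes to the cone of an element, so it suffices to have it for \<open>L\<close>
  itself.
\<close>

lemma augmented_koszul_pro_acyclic:
  assumes as: "set as \<subseteq> carrier R" "as \<noteq> []" and W: "koszul_pro_zero R as"
    and cs: "set cs \<subseteq> carrier R" and j0: "j0 \<ge> 1"
  defines "I \<equiv> Idl (set as)" and "p \<equiv> length as"
  shows "\<exists>j1\<ge>j0. \<forall>f\<in>chains (length cs + p) s.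
     kdiff R (cs @ seq_power R as j1) f = (\<lambda>_. \<zero>) \<longrightarrow>
     (\<forall>l. length l = length cs \<longrightarrow> f (l @ replicate p False) \<in> ideal_power R I j1) \<longrightarrow>
     (\<exists>h\<in>chains (length cs + p) (s + 1).
        (\<forall>l. length l = length cs \<longrightarrow> h (l @ replicate p False) \<in> ideal_power R I j0) \<and>
        kscale R (replicate (length cs) \<one> @ seq_power R as (j1 - j0)) f = kdiff R (cs @ seq_power R as j0) h)"
  using cs j0
proof (induction cs arbitrary: s j0)
  case Nil
  have iI: "ideal I R" unfolding I_def by (rule genideal_ideal[OF as(1)])
  have no: "h (replicate p False) = \<zero>" if "h \<in> chains p t" "t \<ge> 1" for h t
  proof -
    have "count_list (replicate p False) True = 0" by (induction p) auto
    then show ?thesis using chains_supp[OF that(1), of "replicate p False"] that(2) by auto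
  qed
  have z: "\<zero> \<in> ideal_power R I k" for k
    using additive_subgroup.zero_closed[OF ideal.axioms(1)[OF ideal_power_ideal[OF iI]]] .
  consider "s < 0" | "s = 0" | "s \<ge> 1" by linarith
  then show ?case
  proof cases
    case 1
    have "kscale R (seq_power R as k) f = kdiff R (seq_power R as j) (\<lambda>_. \<zero>)" if "f \<in> chains p s" for f j k
    proof -
      have "f = (\<lambda>_. \<zero>)" by (rule chains_neg_deg[OF that 1])
      then show ?thesis using as by (auto simp: kscale_zero kdiff_zero seq_power_carrier)
    qed
    then show ?thesis using z Nil
      by (intro exI[of _ j0]) (auto intro!: bexI[of _ "\<lambda>_. \<zero>"] chains_zero)
  next
    case 2
    \<comment> \<open>in degree 0 an element of a high power of \<open>I\<close> lies in the ideal of the \<open>j0\<close>-th powers, hence is a boundary\<close>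
    have pj: "j0 \<le> p * j0" using as by (cases as) (auto simp: p_def)
    show ?thesis
    proof (intro exI[of _ "p * j0"] conjI ballI impI pj)
      fix f assume f: "f \<in> chains (length [] + p) s"
        and fI: "\<forall>l. length l = length [] \<longrightarrow> f (l @ replicate p False) \<in> ideal_power R I (p * j0)"
      have f': "f \<in> chains p 0" using f 2 by simp
      have "f (replicate p False) \<in> ideal_power R I (p * j0)" using fI by simp
      then have "f (replicate p False) \<in> Idl (set (seq_power R as j0))"
        using ideal_power_pigeonhole[OF as Nil(2)] unfolding I_def p_def by blast
      from degree_zero_boundary[OF seq_power_carrier[OF as(1)] this]
      obtain w where w: "w \<in> chains p 1"
        "kdiff R (seq_power R as j0) w = (\<lambda>l. if l = replicate p False then f (replicate p False) else \<zero>)"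
        by (auto simp: p_def)
      have kw: "kdiff R (seq_power R as j0) w = f" using w(2) chains_0_eq[OF f'] by simp
      have e: "f = kembed R 0 p (\<lambda>_. f (replicate p False))"
        by (subst chains_0_eq[OF f']) (rule ext, simp)
      have "kscale R ([] @ seq_power R as k) f = f" for k
        by (subst (1 2) e, rule ext, rule kscale_kembed)
          (use as seq_power_carrier chains_carr[OF f'] in \<open>auto simp: p_def\<close>)
      then show "\<exists>h\<in>chains (length [] + p) (s + 1).
        (\<forall>l. length l = length [] \<longrightarrow> h (l @ replicate p False) \<in> ideal_power R I j0) \<and>
        kscale R (replicate (length []) \<one> @ seq_power R as (p * j0 - j0)) f = kdiff R ([] @ seq_power R as j0) h"
        using w kw no[OF w(1)] z 2 by (intro bexI[of _ w]) auto
    qed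
  next
    case 3
    then obtain j1 where j1: "j1 \<ge> j0" "\<forall>f\<in>chains p s.
        kdiff R (seq_power R as j1) f = (\<lambda>_. \<zero>) \<longrightarrow>
        (\<exists>h\<in>chains p (s + 1).
           kscale R (seq_power R as (j1 - j0)) f = kdiff R (seq_power R as j0) h)"
      using W Nil unfolding koszul_pro_zero_def p_def by blast
    have "h (replicate p False) \<in> ideal_power R I j0" if "h \<in> chains p (s + 1)" for h
      using no[OF that] 3 z by simp
    note hI = this
    show ?thesis
    proof (intro exI[of _ j1] conjI ballI impI)
      show "j0 \<le> j1" by fact
      fix f assume "f \<in> chains (length [] + p) s" "kdiff R ([] @ seq_power R as j1) f = (\<lambda>_. \<zero>)"
      then obtain h where "h \<in> chains p (s + 1)" "kscale R (seq_power R as (j1 - j0)) f = kdiff R (seq_power R as j0) h"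
        using j1(2) by auto
      then show "\<exists>h\<in>chains (length [] + p) (s + 1).
        (\<forall>l. length l = length [] \<longrightarrow> h (l @ replicate p False) \<in> ideal_power R I j0) \<and>
        kscale R (replicate (length []) \<one> @ seq_power R as (j1 - j0)) f = kdiff R ([] @ seq_power R as j0) h"
        using hI by (intro bexI[of _ h]) auto
    qed
  qed
next
  case (Cons c cs)
  have iI: "ideal I R" unfolding I_def by (rule genideal_ideal[OF as(1)])
  have c: "c \<in> carrier R" and cs: "set cs \<subseteq> carrier R" using Cons.prems by auto
  let ?n = "length cs + p"
  let ?D = "\<lambda>j. kdiff R (cs @ seq_power R as j)"
  let ?S = "\<lambda>j. kscale R (replicate (length cs) \<one> @ seq_power R as j)"
  let ?E = "\<lambda>f j. \<forall>l. length l = length cs \<longrightarrow> f (l @ replicate p False) \<in> ideal_power R I j"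
  have sj: "set (cs @ seq_power R as j) \<subseteq> carrier R" for j using cs seq_power_carrier[OF as(1)] by auto
  have rj: "set (replicate (length cs) \<one> @ seq_power R as j) \<subseteq> carrier R" for j
    using seq_power_carrier[OF as(1)] by auto
  \<comment> \<open>one transition makes the second half of a cycle a boundary, a further one then does so for the corrected first half\<close>
  obtain j1 where j1: "j1 \<ge> j0" and J1: "\<And>f. \<lbrakk>f \<in> chains ?n s; ?D j1 f = (\<lambda>_. \<zero>); ?E f j1\<rbrakk> \<Longrightarrow>
     \<exists>h\<in>chains ?n (s + 1). ?E h j0 \<and> ?S (j1 - j0) f = ?D j0 h"
    using Cons.IH[OF cs Cons.prems(2), of s] by blast
  have "1 \<le> j1" using j1 Cons.prems by simp
  from Cons.IH[OF cs this, of "s - 1"]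
  obtain j2 where j2: "j2 \<ge> j1" and J2: "\<And>f. \<lbrakk>f \<in> chains ?n (s - 1); ?D j2 f = (\<lambda>_. \<zero>); ?E f j2\<rbrakk> \<Longrightarrow>
     \<exists>h\<in>chains ?n s. ?E h j1 \<and> ?S (j2 - j1) f = ?D j1 h"
    by force
  have SS: "?S (j1 - j0) (?S (j2 - j1) g) l = ?S (j2 - j0) g l" if "\<And>l. g l \<in> carrier R" for g l
  proof -
    have "map2 (\<otimes>) (replicate (length cs) \<one> @ seq_power R as (j1 - j0)) (replicate (length cs) \<one> @ seq_power R as (j2 - j1))
      = replicate (length cs) \<one> @ seq_power R as (j2 - j0)"
      using map2_seq_power[OF as(1), of "j1 - j0" "j2 - j1"] j1 j2 by (simp add: zip_append map_replicate_const zip_replicate)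
    then show ?thesis using kscale_kscale[of g, OF that rj rj] by simp
  qed
  have DS: "?D j (?S i g) l = ?S i (?D (i + j) g) l" if "\<And>l. g l \<in> carrier R" for g l i j
  proof -
    have "map2 (\<otimes>) cs (replicate (length cs) \<one>) = cs" using cs by (induction cs) auto
    then have "map2 (\<otimes>) (cs @ seq_power R as j) (replicate (length cs) \<one> @ seq_power R as i)
      = cs @ seq_power R as (i + j)"
      using map2_seq_power[OF as(1), of j i] by (simp add: zip_append add.commute)
    then show ?thesis using kdiff_kscale[of g, OF that rj sj] by simp
  qed
  have ES: "?E (?S i g) k" if "\<And>l. g l \<in> carrier R" "?E g k" for g i k
    using that kscale_append[of g _ "replicate (length cs) \<one>" "seq_power R as i" p] seq_power_carrier[OF as(1)]
    by (simp add: p_def)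
  show ?case
  proof (intro exI[of _ j2] conjI ballI impI)
    show "j0 \<le> j2" using j1 j2 by simp
    fix f assume f: "f \<in> chains (length (c # cs) + p) s"
      and Df: "kdiff R ((c # cs) @ seq_power R as j2) f = (\<lambda>_. \<zero>)"
      and Ef: "\<forall>l. length l = length (c # cs) \<longrightarrow> f (l @ replicate p False) \<in> ideal_power R I j2"
    let ?u = "\<lambda>l. f (False # l)" and ?v = "\<lambda>l. f (True # l)"
    have u: "?u \<in> chains ?n s" and v: "?v \<in> chains ?n (s - 1)" and f0: "f [] = \<zero>"
      using f by (simp_all add: chains_Suc)
    have fc: "f l \<in> carrier R" for l using f chains_carr by blast
    have Eu: "?E ?u j2" and Ev: "?E ?v j2" using Ef[rule_format, of "_ # _"] by auto
    have Du: "?D j2 ?u l \<oplus> c \<otimes> ?v l = \<zero>" for l using fun_cong[OF Df, of "False # l"] by simp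
    have Dv: "?D j2 ?v l = \<zero>" for l
    proof -
      have n: "\<ominus> ?D j2 ?v l = \<zero>" using fun_cong[OF Df, of "True # l"] by simp
      have "?D j2 ?v l = \<ominus> (\<ominus> ?D j2 ?v l)" by (rule minus_minus[symmetric]) (use fc sj kdiff_carr in auto)
      then show ?thesis by (simp only: n minus_zero)
    qed
    obtain w where w: "w \<in> chains ?n s" "?E w j1" "?S (j2 - j1) ?v = ?D j1 w"
      using J2[OF v _ Ev] Dv by auto
    \<comment> \<open>\<open>v\<close> becomes \<open>d w\<close>, so \<open>d u = - c v\<close> turns \<open>u + c w\<close> into a cycle\<close>
    let ?g = "\<lambda>l. ?S (j2 - j1) ?u l \<oplus> c \<otimes> w l"
    have Su: "?S (j2 - j1) ?u \<in> chains ?n s" using kscale_chains[OF _ rj] u by (simp add: p_def)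
    have g: "?g \<in> chains ?n s" by (intro chains_add chains_smult Su w c)
    have wc: "w l \<in> carrier R" for l using w chains_carr by blast
    have Suc': "?S i ?u l \<in> carrier R" "?S i ?v l \<in> carrier R" for i l using fc rj kscale_carr by auto
    have Dg: "?D j1 ?g l = \<zero>" for l
    proof -
      have "?D j1 ?g l = ?D j1 (?S (j2 - j1) ?u) l \<oplus> c \<otimes> ?S (j2 - j1) ?v l"
        using Suc' wc c sj w(3) by (simp add: kdiff_add kdiff_smult)
      also have "?D j1 (?S (j2 - j1) ?u) l = ?S (j2 - j1) (?D j2 ?u) l"
        using DS[of ?u j1 "j2 - j1" l] fc j2 by simp
      also have "?S (j2 - j1) (?D j2 ?u) l \<oplus> c \<otimes> ?S (j2 - j1) ?v l = ?S (j2 - j1) (\<lambda>l. ?D j2 ?u l \<oplus> c \<otimes> ?v l) l"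
        using fc c sj rj by (simp add: kscale_add kscale_smult kdiff_carr)
      also have "\<dots> = \<zero>" using rj by (simp add: Du kscale_zero)
      finally show ?thesis .
    qed
    have Eg: "?E ?g j1"
    proof (intro allI impI)
      fix l :: "bool list" assume l: "length l = length cs"
      interpret P: ideal "ideal_power R I j1" R by (rule ideal_power_ideal[OF iI])
      have "?E (?S (j2 - j1) ?u) j2" by (rule ES[OF _ Eu]) (rule fc)
      then have "?S (j2 - j1) ?u (l @ replicate p False) \<in> ideal_power R I j1"
        using l ideal_power_antimono[OF iI j2] by blast
      then show "?g (l @ replicate p False) \<in> ideal_power R I j1"
        using w(2) l c by (simp add: P.I_l_closed)
    qed
    obtain w' where w': "w' \<in> chains ?n (s + 1)" "?E w' j0" "?S (j1 - j0) ?g = ?D j0 w'"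
      using J1[OF g _ Eg] Dg by auto
    have Swn: "?S (j1 - j0) w \<in> chains ?n s" using kscale_chains[OF _ rj] w by (simp add: p_def)
    have Swc: "?S (j1 - j0) w l \<in> carrier R" for l using wc rj kscale_carr by auto
    let ?h = "\<lambda>l. case l of [] \<Rightarrow> \<zero> | x # k \<Rightarrow> if x then \<ominus> ?S (j1 - j0) w k else w' k"
    have h: "?h \<in> chains (Suc ?n) (s + 1)" using w' chains_neg[OF Swn] by (simp add: chains_Suc)
    have Eh: "\<forall>l. length l = length (c # cs) \<longrightarrow> ?h (l @ replicate p False) \<in> ideal_power R I j0"
    proof (intro allI impI)
      fix l :: "bool list" assume l: "length l = length (c # cs)"
      then obtain x k where lk: "l = x # k" "length k = length cs" by (cases l) auto
      interpret P: ideal "ideal_power R I j0" R by (rule ideal_power_ideal[OF iI])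
      have "?E (?S (j1 - j0) w) j1" by (rule ES[OF _ w(2)]) (rule wc)
      then have "?S (j1 - j0) w (k @ replicate p False) \<in> ideal_power R I j0"
        using lk ideal_power_antimono[OF iI j1] by blast
      then show "?h (l @ replicate p False) \<in> ideal_power R I j0"
        using w'(2) lk by (simp add: P.a_inv_closed)
    qed
    have w'c: "w' l \<in> carrier R" for l using w' chains_carr by blast
    have Dw'c: "?D j0 w' l \<in> carrier R" for l using w'c sj kdiff_carr by auto
    have eq: "kscale R (replicate (length (c # cs)) \<one> @ seq_power R as (j2 - j0)) f l
      = kdiff R ((c # cs) @ seq_power R as j0) ?h l" for l
    proof (cases l)
      case (Cons x k)
      show ?thesis
      proof (cases x)
        case True
        have "?S (j2 - j0) ?v k = ?S (j1 - j0) (?D j1 w) k" using SS[of ?v k] fc w(3) by simp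
        also have "\<dots> = ?D j0 (?S (j1 - j0) w) k" using DS[of w j0 "j1 - j0" k] wc j1 by simp
        finally show ?thesis using True Swc sj Suc' by (simp add: Cons kdiff_neg kdiff_carr)
      next
        case False
        have "?D j0 w' k = ?S (j1 - j0) ?g k" using w'(3) by simp
        also have "\<dots> = ?S (j2 - j0) ?u k \<oplus> c \<otimes> ?S (j1 - j0) w k"
          using SS[of ?u k] fc wc rj c Suc' by (simp add: kscale_add kscale_smult)
        finally have "?D j0 w' k \<oplus> c \<otimes> (\<ominus> ?S (j1 - j0) w k) = ?S (j2 - j0) ?u k"
          using c Swc[of k] Suc'(1)[of "j2 - j0" k] by (simp add: r_minus a_assoc r_neg)
        then show ?thesis using False by (simp add: Cons)
      qed
    qed simp
    show "\<exists>h\<in>chains (length (c # cs) + p) (s + 1).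
        (\<forall>l. length l = length (c # cs) \<longrightarrow> h (l @ replicate p False) \<in> ideal_power R I j0) \<and>
        kscale R (replicate (length (c # cs)) \<one> @ seq_power R as (j2 - j0)) f = kdiff R ((c # cs) @ seq_power R as j0) h"
      using h Eh eq by (intro bexI[of _ ?h]) auto
  qed
qed

text \<open>
  A cycle \<open>x\<close> with coefficients in a power of \<open>I\<close>, embedded into
  \<open>K\<^sub>j \<otimes> L\<^sub>n\<close>, bounds after transition to \<open>K\<^sub>j
  \<otimes> L\<^sub>m\<close>, and the transition fixes it since it lies in degree 0 of the second
  factor. The retraction onto \<open>K\<^sub>j\<close> then produces the required chain.
\<close>

lemma koszul_artin_rees:
  assumes as: "set as \<subseteq> carrier R" "as \<noteq> []" and W: "koszul_pro_zero R as" and j: "j \<ge> 1"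
  defines "I \<equiv> Idl (set as)" and "p \<equiv> length as"
  shows "\<exists>n. \<forall>x\<in>chains p s. kdiff R (seq_power R as j) x = (\<lambda>_. \<zero>) \<longrightarrow> (\<forall>l. x l \<in> ideal_power R I n) \<longrightarrow>
     (\<exists>y\<in>chains p (s + 1). (\<forall>l. y l \<in> ideal_power R I n') \<and> kdiff R (seq_power R as j) y = x)"
proof -
  have iI: "ideal I R" unfolding I_def by (rule genideal_ideal[OF as(1)])
  let ?cs = "seq_power R as j"
  have cs: "set ?cs \<subseteq> carrier R" by (rule seq_power_carrier[OF as(1)])
  \<comment> \<open>an \<open>m\<close>-th power is then the \<open>j\<close>-th power times an \<open>n'\<close>-th power, which lies in the \<open>n'\<close>-th power of \<open>I\<close>\<close>
  define m where "m = n' + j"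
  have m: "m \<ge> 1" using j by (simp add: m_def)
  define lifts where "lifts n f \<longleftrightarrow> kdiff R (?cs @ seq_power R as n) f = (\<lambda>_. \<zero>) \<longrightarrow>
     (\<forall>l. length l = p \<longrightarrow> f (l @ replicate p False) \<in> ideal_power R I n) \<longrightarrow>
     (\<exists>h\<in>chains (p + p) (s + 1).
        (\<forall>l. length l = p \<longrightarrow> h (l @ replicate p False) \<in> ideal_power R I m) \<and>
        kscale R (replicate p \<one> @ seq_power R as (n - m)) f = kdiff R (?cs @ seq_power R as m) h)" for n f
  have "\<exists>n\<ge>m. \<forall>f\<in>chains (p + p) s. lifts n f"
    unfolding lifts_def using augmented_koszul_pro_acyclic[OF as W cs m, of s] by (simp only: I_def p_def length_seq_power)
  then obtain n where n: "n \<ge> m" and N: "\<And>f. f \<in> chains (p + p) s \<Longrightarrow> lifts n f" by blast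
  show ?thesis
  proof (intro exI[of _ n] ballI impI)
    fix x assume x: "x \<in> chains p s" and Dx: "kdiff R ?cs x = (\<lambda>_. \<zero>)" and xI: "\<forall>l. x l \<in> ideal_power R I n"
    let ?f = "kembed R p p x"
    have xc: "x l \<in> carrier R" for l using x chains_carr by blast
    have z: "kembed R p p (\<lambda>_. \<zero>) l = \<zero>" for l
    proof -
      have "kembed R p q (\<lambda>_. \<zero>) l = \<zero>" for p q l
      proof (induction p arbitrary: l)
        case (Suc p) then show ?case by (cases l) auto
      qed simp
      then show ?thesis .
    qed
    have f: "?f \<in> chains (p + p) s" by (rule kembed_chains[OF x])
    have "kdiff R (?cs @ seq_power R as n) ?f l = \<zero>" for l
      using kdiff_kembed[of x ?cs s "seq_power R as n" l] x seq_power_carrier[OF as(1)] Dx z by (simp add: p_def)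
    moreover have "\<forall>l. length l = p \<longrightarrow> ?f (l @ replicate p False) \<in> ideal_power R I n"
      using xI by (simp add: kembed_append)
    ultimately obtain h where h: "h \<in> chains (p + p) (s + 1)"
      "\<forall>l. length l = p \<longrightarrow> h (l @ replicate p False) \<in> ideal_power R I m"
      "kscale R (replicate p \<one> @ seq_power R as (n - m)) ?f = kdiff R (?cs @ seq_power R as m) h"
      using N[OF f] unfolding lifts_def by blast
    have "kscale R (replicate p \<one> @ seq_power R as (n - m)) ?f = ?f"
      by (rule ext, rule kscale_kembed) (use xc seq_power_carrier[OF as(1)] in \<open>auto simp: p_def\<close>)
    then have Dh: "kdiff R (?cs @ seq_power R as m) h = ?f" using h(3) by simp
    have "\<exists>y\<in>chains (length ?cs) (s + 1). (\<forall>l. y l \<in> ideal_power R I n') \<and> kdiff R ?cs y = x"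
    proof (rule retraction[where X = h and bs = "seq_power R as m"])
      show "h \<in> chains (length ?cs + length (seq_power R as m)) (s + 1)" using h by (simp add: p_def)
      show "ideal (ideal_power R I n') R" by (rule ideal_power_ideal[OF iI])
      show "x \<in> chains (length ?cs) s" using x by (simp add: p_def)
      show "kdiff R (?cs @ seq_power R as m) h = kembed R (length ?cs) (length (seq_power R as m)) x"
        using Dh by (simp add: p_def)
      show "h (l @ replicate (length (seq_power R as m)) False) \<in> ideal_power R I n'" if "length l = length ?cs" for l
      proof -
        have "h (l @ replicate p False) \<in> ideal_power R I m" using h that by (simp add: p_def)
        then show ?thesis using ideal_power_antimono[OF iI, of n' m] by (auto simp: m_def p_def)
      qed
      show "\<forall>b\<in>set (seq_power R as m). \<exists>c\<in>ideal_power R I n'. \<exists>k<length ?cs. b = c \<otimes> ?cs ! k"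
      proof
        fix b assume "b \<in> set (seq_power R as m)"
        then obtain k where k: "k < length as" "b = (as ! k) [^] m" by (auto simp: seq_power_def in_set_conv_nth)
        have a: "as ! k \<in> carrier R" "as ! k \<in> I"
          using k as genideal_self[OF as(1)] nth_mem unfolding I_def by blast+
        have "b = (as ! k) [^] n' \<otimes> ?cs ! k" using k a by (simp add: seq_power_def m_def nat_pow_mult)
        then show "\<exists>c\<in>ideal_power R I n'. \<exists>k<length ?cs. b = c \<otimes> ?cs ! k"
          using pow_in_ideal_power[OF iI a(2)] k by auto
      qed
    qed (use cs in auto)
    then show "\<exists>y\<in>chains p (s + 1). (\<forall>l. y l \<in> ideal_power R I n') \<and> kdiff R ?cs y = x"
      by (simp add: p_def)
  qed
qed

end

section \<open>Adic completion\<close>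

lemma kdiff_ring_hom:
  assumes "cring R" "cring S" "h \<in> ring_hom R S" "set bs \<subseteq> carrier R" "\<And>l. f l \<in> carrier R"
  shows "h (kdiff R bs f l) = kdiff S (map h bs) (\<lambda>l. h (f l)) l"
  using assms(4,5)
proof (induction bs arbitrary: f l)
  interpret h: ring_hom_cring R S h
    using assms by (simp add: ring_hom_cring_def ring_hom_cring_axioms_def)
  case Nil then show ?case by simp
next
  interpret h: ring_hom_cring R S h
    using assms by (simp add: ring_hom_cring_def ring_hom_cring_axioms_def)
  case (Cons b bs)
  then show ?case by (cases l) (auto simp: h.R.kdiff_carr)
qed

lemma kscale_ring_hom:
  assumes "cring R" "cring S" "h \<in> ring_hom R S" "set bs \<subseteq> carrier R" "\<And>l. f l \<in> carrier R"
  shows "h (kscale R bs f l) = kscale S (map h bs) (\<lambda>l. h (f l)) l"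
  using assms(4,5)
proof (induction bs arbitrary: f l)
  interpret h: ring_hom_cring R S h
    using assms by (simp add: ring_hom_cring_def ring_hom_cring_axioms_def)
  case Nil then show ?case by simp
next
  interpret h: ring_hom_cring R S h
    using assms by (simp add: ring_hom_cring_def ring_hom_cring_axioms_def)
  case (Cons b bs)
  then show ?case by (cases l) (auto simp: h.R.kscale_carr)
qed

lemma seq_power_ring_hom:
  assumes "cring R" "cring S" "h \<in> ring_hom R S" "set as \<subseteq> carrier R"
  shows "map h (seq_power R as j) = seq_power S (map h as) j"
proof -
  interpret h: ring_hom_cring R S h
    using assms by (simp add: ring_hom_cring_def ring_hom_cring_axioms_def)
  have "h (a [^]\<^bsub>R\<^esub> j) = h a [^]\<^bsub>S\<^esub> j" if "a \<in> carrier R" for a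
    using that by (induction j) auto
  then show ?thesis using assms(4) by (auto simp: seq_power_def)
qed

lemma chains_ring_hom:
  assumes "cring R" "cring S" "h \<in> ring_hom R S" "f \<in> koszul_chains R n s"
  shows "(\<lambda>l. h (f l)) \<in> koszul_chains S n s"
proof -
  interpret h: ring_hom_cring R S h
    using assms by (simp add: ring_hom_cring_def ring_hom_cring_axioms_def)
  show ?thesis using assms(4) h.R.chains_carr[OF assms(4)] h.R.chains_supp[OF assms(4)]
    by (intro h.S.chainsI) (auto, (metis h.hom_zero)+)
qed

locale adic_ring = cring R for R (structure) + fixes I
  assumes I_ideal: "ideal I R"
begin

abbreviation "I_power k \<equiv> ideal_power R I (Suc k)"
abbreviation "level k \<equiv> R Quot (I_power k)"
abbreviation "Rhat \<equiv> adic_completion R I"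

lemma pow_ideal: "ideal (I_power k) R" by (rule ideal_power_ideal[OF I_ideal])

lemma pow_antimono: "k \<le> n \<Longrightarrow> I_power n \<subseteq> I_power k"
  by (rule ideal_power_antimono[OF I_ideal]) simp

lemma level_cring: "cring (level k)"
  by (rule ideal.quotient_is_cring[OF pow_ideal]) (rule is_cring)

lemma level_hom: "(+>) (I_power k) \<in> ring_hom R (level k)"
  by (rule ideal.rcos_ring_hom[OF pow_ideal])

lemma level_eq: "\<lbrakk>x \<in> carrier R; y \<in> carrier R\<rbrakk> \<Longrightarrow> I_power k +> x = I_power k +> y \<longleftrightarrow> x \<ominus> y \<in> I_power k"
  using quotient_eq_iff_same_a_r_cos[OF pow_ideal] by blast

lemma level_carrier: "X \<in> carrier (level k) \<longleftrightarrow> (\<exists>x\<in>carrier R. X = I_power k +> x)"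
  by (auto simp: FactRing_def A_RCOSETS_def RCOSETS_def a_r_coset_def)

lemma level_transition: "x \<in> carrier R \<Longrightarrow> I_power k <+>\<^bsub>R\<^esub> (I_power (Suc k) +> x) = I_power k +> x"
proof -
  assume x: "x \<in> carrier R"
  interpret P: ideal "I_power k" R by (rule pow_ideal)
  interpret P': ideal "I_power (Suc k)" R by (rule pow_ideal)
  have sub: "y \<in> I_power k" if "y \<in> I_power (Suc k)" for y using pow_antimono[of k "Suc k"] that by auto
  show ?thesis
  proof (intro equalityI subsetI)
    fix z assume "z \<in> I_power k <+>\<^bsub>R\<^esub> (I_power (Suc k) +> x)"
    then obtain a b where ab: "a \<in> I_power k" "b \<in> I_power (Suc k)" "z = a \<oplus> (b \<oplus> x)"
      by (auto simp: set_add_def set_mult_def a_r_coset_def r_coset_def)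
    then have "z = (a \<oplus> b) \<oplus> x" using x P.Icarr P'.Icarr by (simp add: a_assoc)
    moreover have "a \<oplus> b \<in> I_power k" using ab sub by simp
    ultimately show "z \<in> I_power k +> x" by (auto simp: a_r_coset_def r_coset_def)
  next
    fix z assume "z \<in> I_power k +> x"
    then obtain a where a: "a \<in> I_power k" "z = a \<oplus> x" by (auto simp: a_r_coset_def r_coset_def)
    have "x \<in> I_power (Suc k) +> x" using P'.a_rcos_self[OF x] .
    then show "z \<in> I_power k <+>\<^bsub>R\<^esub> (I_power (Suc k) +> x)" using a
      by (auto simp: set_add_def set_mult_def)
  qed
qed

text \<open>
  Compatibility of two adjacent components means that they have a common representative; in this
  form it is inherited by sums and products.
\<close>

lemma completion_carrier:
  "f \<in> carrier Rhat \<longleftrightarrow> (\<forall>k. \<exists>x\<in>carrier R. f k = I_power k +> x \<and> f (Suc k) = I_power (Suc k) +> x)"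
proof
  assume f: "f \<in> carrier Rhat"
  show "\<forall>k. \<exists>x\<in>carrier R. f k = I_power k +> x \<and> f (Suc k) = I_power (Suc k) +> x"
  proof
    fix k
    have 1: "f (Suc k) \<in> carrier (level (Suc k))" "I_power k <+>\<^bsub>R\<^esub> f (Suc k) = f k"
      using f by (auto simp: adic_completion_def Let_def)
    then obtain x where "x \<in> carrier R" "f (Suc k) = I_power (Suc k) +> x" by (auto simp: level_carrier)
    then show "\<exists>x\<in>carrier R. f k = I_power k +> x \<and> f (Suc k) = I_power (Suc k) +> x"
      using 1 level_transition by auto
  qed
next
  assume f: "\<forall>k. \<exists>x\<in>carrier R. f k = I_power k +> x \<and> f (Suc k) = I_power (Suc k) +> x"
  have "f k \<in> carrier (level k)" for k using f unfolding level_carrier by blast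
  moreover have "I_power k <+>\<^bsub>R\<^esub> f (Suc k) = f k" for k
    using f level_transition by metis
  ultimately show "f \<in> carrier Rhat" by (simp add: adic_completion_def Let_def)
qed

lemma completion_ops:
  "(f \<oplus>\<^bsub>Rhat\<^esub> g) k = f k \<oplus>\<^bsub>level k\<^esub> g k"
  "(f \<otimes>\<^bsub>Rhat\<^esub> g) k = f k \<otimes>\<^bsub>level k\<^esub> g k"
  "\<zero>\<^bsub>Rhat\<^esub> k = \<zero>\<^bsub>level k\<^esub>"
  "\<one>\<^bsub>Rhat\<^esub> k = \<one>\<^bsub>level k\<^esub>"
  by (simp_all add: adic_completion_def Let_def)

lemma completion_component: "f \<in> carrier Rhat \<Longrightarrow> f k \<in> carrier (level k)"
  unfolding completion_carrier level_carrier by blast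

lemma level_ops:
  assumes "x \<in> carrier R" "y \<in> carrier R"
  shows "(I_power k +> x) \<oplus>\<^bsub>level k\<^esub> (I_power k +> y) = I_power k +> (x \<oplus> y)"
    "(I_power k +> x) \<otimes>\<^bsub>level k\<^esub> (I_power k +> y) = I_power k +> (x \<otimes> y)"
    "\<ominus>\<^bsub>level k\<^esub> (I_power k +> x) = I_power k +> (\<ominus> x)"
    "\<zero>\<^bsub>level k\<^esub> = I_power k +> \<zero>" "\<one>\<^bsub>level k\<^esub> = I_power k +> \<one>"
proof -
  interpret h: ring_hom_cring R "level k" "(+>) (I_power k)"
    using level_cring level_hom is_cring by (simp add: ring_hom_cring_def ring_hom_cring_axioms_def)
  show "(I_power k +> x) \<oplus>\<^bsub>level k\<^esub> (I_power k +> y) = I_power k +> (x \<oplus> y)"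
    "(I_power k +> x) \<otimes>\<^bsub>level k\<^esub> (I_power k +> y) = I_power k +> (x \<otimes> y)"
    "\<ominus>\<^bsub>level k\<^esub> (I_power k +> x) = I_power k +> (\<ominus> x)"
    "\<zero>\<^bsub>level k\<^esub> = I_power k +> \<zero>" "\<one>\<^bsub>level k\<^esub> = I_power k +> \<one>" using assms by simp_all
qed

lemma completion_cring: "cring Rhat"
proof -
  interpret L: cring "level k" for k by (rule level_cring)
  note comp = completion_component
  have add: "f \<oplus>\<^bsub>Rhat\<^esub> g \<in> carrier Rhat"
    and mult: "f \<otimes>\<^bsub>Rhat\<^esub> g \<in> carrier Rhat"
    if fg: "f \<in> carrier Rhat" "g \<in> carrier Rhat" for f g
  proof -
    have "\<exists>x\<in>carrier R. (f \<oplus>\<^bsub>Rhat\<^esub> g) k = I_power k +> x \<and> (f \<oplus>\<^bsub>Rhat\<^esub> g) (Suc k) = I_power (Suc k) +> x"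
      and "\<exists>x\<in>carrier R. (f \<otimes>\<^bsub>Rhat\<^esub> g) k = I_power k +> x \<and> (f \<otimes>\<^bsub>Rhat\<^esub> g) (Suc k) = I_power (Suc k) +> x" for k
    proof -
      obtain x where x: "x \<in> carrier R" "f k = I_power k +> x" "f (Suc k) = I_power (Suc k) +> x"
        using fg(1) unfolding completion_carrier by blast
      obtain y where y: "y \<in> carrier R" "g k = I_power k +> y" "g (Suc k) = I_power (Suc k) +> y"
        using fg(2) unfolding completion_carrier by blast
      show "\<exists>x\<in>carrier R. (f \<oplus>\<^bsub>Rhat\<^esub> g) k = I_power k +> x \<and> (f \<oplus>\<^bsub>Rhat\<^esub> g) (Suc k) = I_power (Suc k) +> x"
        by (rule bexI[of _ "x \<oplus> y"]) (use x y in \<open>simp_all add: completion_ops level_ops\<close>)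
      show "\<exists>x\<in>carrier R. (f \<otimes>\<^bsub>Rhat\<^esub> g) k = I_power k +> x \<and> (f \<otimes>\<^bsub>Rhat\<^esub> g) (Suc k) = I_power (Suc k) +> x"
        by (rule bexI[of _ "x \<otimes> y"]) (use x y in \<open>simp_all add: completion_ops level_ops\<close>)
    qed
    then show "f \<oplus>\<^bsub>Rhat\<^esub> g \<in> carrier Rhat" "f \<otimes>\<^bsub>Rhat\<^esub> g \<in> carrier Rhat"
      by (simp_all add: completion_carrier)
  qed
  have zero: "\<zero>\<^bsub>Rhat\<^esub> \<in> carrier Rhat"
    unfolding completion_carrier by (auto intro!: bexI[of _ \<zero>] simp: completion_ops level_ops(4)[of \<zero> \<zero>])
  have one: "\<one>\<^bsub>Rhat\<^esub> \<in> carrier Rhat"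
    unfolding completion_carrier by (auto intro!: bexI[of _ \<one>] simp: completion_ops level_ops(5)[of \<zero> \<zero>])
  have neg: "\<exists>g\<in>carrier Rhat. g \<oplus>\<^bsub>Rhat\<^esub> f = \<zero>\<^bsub>Rhat\<^esub>" if f: "f \<in> carrier Rhat" for f
  proof (rule bexI)
    show "(\<lambda>k. \<ominus>\<^bsub>level k\<^esub> f k) \<oplus>\<^bsub>Rhat\<^esub> f = \<zero>\<^bsub>Rhat\<^esub>"
      using comp[OF f] by (intro ext) (simp add: completion_ops L.l_neg)
    show "(\<lambda>k. \<ominus>\<^bsub>level k\<^esub> f k) \<in> carrier Rhat" unfolding completion_carrier
    proof
      fix k
      obtain x where x: "x \<in> carrier R" "f k = I_power k +> x" "f (Suc k) = I_power (Suc k) +> x"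
        using f unfolding completion_carrier by blast
      show "\<exists>x\<in>carrier R. \<ominus>\<^bsub>level k\<^esub> f k = I_power k +> x \<and> \<ominus>\<^bsub>level (Suc k)\<^esub> f (Suc k) = I_power (Suc k) +> x"
        by (rule bexI[of _ "\<ominus> x"]) (use x in \<open>simp_all add: level_ops(3)\<close>)
    qed
  qed
  show ?thesis
  proof (rule cringI)
    show "abelian_group Rhat"
    proof (rule abelian_groupI)
      show "f \<oplus>\<^bsub>Rhat\<^esub> g \<oplus>\<^bsub>Rhat\<^esub> h = f \<oplus>\<^bsub>Rhat\<^esub> (g \<oplus>\<^bsub>Rhat\<^esub> h)"
        if "f \<in> carrier Rhat" "g \<in> carrier Rhat" "h \<in> carrier Rhat" for f g h
        using that[THEN comp] by (intro ext) (simp add: completion_ops L.a_assoc)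
      show "f \<oplus>\<^bsub>Rhat\<^esub> g = g \<oplus>\<^bsub>Rhat\<^esub> f"
        if "f \<in> carrier Rhat" "g \<in> carrier Rhat" for f g
        using that[THEN comp] by (intro ext) (simp add: completion_ops L.a_comm)
      show "\<zero>\<^bsub>Rhat\<^esub> \<oplus>\<^bsub>Rhat\<^esub> f = f" if "f \<in> carrier Rhat" for f
        using that[THEN comp] by (intro ext) (simp add: completion_ops)
    qed (fact add zero neg)+
    show "comm_monoid Rhat"
    proof (rule comm_monoidI)
      show "f \<otimes>\<^bsub>Rhat\<^esub> g \<otimes>\<^bsub>Rhat\<^esub> h = f \<otimes>\<^bsub>Rhat\<^esub> (g \<otimes>\<^bsub>Rhat\<^esub> h)"
        if "f \<in> carrier Rhat" "g \<in> carrier Rhat" "h \<in> carrier Rhat" for f g h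
        using that[THEN comp] by (intro ext) (simp add: completion_ops L.m_assoc)
      show "f \<otimes>\<^bsub>Rhat\<^esub> g = g \<otimes>\<^bsub>Rhat\<^esub> f"
        if "f \<in> carrier Rhat" "g \<in> carrier Rhat" for f g
        using that[THEN comp] by (intro ext) (simp add: completion_ops L.m_comm)
      show "\<one>\<^bsub>Rhat\<^esub> \<otimes>\<^bsub>Rhat\<^esub> f = f" if "f \<in> carrier Rhat" for f
        using that[THEN comp] by (intro ext) (simp add: completion_ops)
    qed (fact mult one)+
    show "(f \<oplus>\<^bsub>Rhat\<^esub> g) \<otimes>\<^bsub>Rhat\<^esub> h = f \<otimes>\<^bsub>Rhat\<^esub> h \<oplus>\<^bsub>Rhat\<^esub> g \<otimes>\<^bsub>Rhat\<^esub> h"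
      if "f \<in> carrier Rhat" "g \<in> carrier Rhat" "h \<in> carrier Rhat" for f g h
      using that[THEN comp] by (intro ext) (simp add: completion_ops L.l_distr)
  qed
qed

lemma component_hom: "(\<lambda>f. f k) \<in> ring_hom Rhat (level k)"
  by (rule ring_hom_memI) (auto simp: completion_ops completion_component)

lemma completion_map_closed: "x \<in> carrier R \<Longrightarrow> completion_map R I x \<in> carrier Rhat"
  unfolding completion_carrier completion_map_def by auto

lemma completion_map_hom: "completion_map R I \<in> ring_hom R Rhat"
proof (rule ring_hom_memI)
  show "completion_map R I x \<in> carrier Rhat" if "x \<in> carrier R" for x
    using that by (rule completion_map_closed)
next
  fix x y assume xy: "x \<in> carrier R" "y \<in> carrier R"
  show "completion_map R I (x \<otimes> y) = completion_map R I x \<otimes>\<^bsub>Rhat\<^esub> completion_map R I y"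
    using xy by (intro ext) (simp add: completion_ops level_ops completion_map_def)
  show "completion_map R I (x \<oplus> y) = completion_map R I x \<oplus>\<^bsub>Rhat\<^esub> completion_map R I y"
    using xy by (intro ext) (simp add: completion_ops level_ops completion_map_def)
next
  show "completion_map R I \<one> = \<one>\<^bsub>Rhat\<^esub>"
    by (intro ext) (simp add: completion_ops level_ops(5)[of \<zero> \<zero>] completion_map_def)
qed

lemma completion_le:
  "\<lbrakk>f \<in> carrier Rhat; x \<in> carrier R; f n = I_power n +> x; k \<le> n\<rbrakk> \<Longrightarrow> f k = I_power k +> x"
proof (induction n arbitrary: x)
  case (Suc n)
  show ?case
  proof (cases "k = Suc n")
    case False
    obtain y where y: "y \<in> carrier R" "f n = I_power n +> y" "f (Suc n) = I_power (Suc n) +> y"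
      using Suc.prems(1) unfolding completion_carrier by blast
    then have "x \<ominus> y \<in> I_power (Suc n)" using Suc.prems level_eq[of x y "Suc n"] by simp
    then have "x \<ominus> y \<in> I_power n" using pow_antimono[of n "Suc n"] by auto
    then have "f n = I_power n +> x" using y Suc.prems level_eq[of x y n] by simp
    then show ?thesis using Suc False by simp
  qed (use Suc.prems in simp)
qed simp

text \<open>
  A representative of the component \<open>k\<close> of each coefficient also represents all
  earlier components.
\<close>

lemma approximation:
  assumes z: "z \<in> koszul_chains Rhat n s"
  shows "\<exists>x\<in>chains n s. \<forall>l. \<forall>i\<le>k. I_power i +> x l = z l i"
proof -
  interpret C: cring Rhat by (rule completion_cring)
  have zc: "z l \<in> carrier Rhat" for l using C.chains_carr[OF z] .
  \<comment> \<open>zero coefficients get the representative zero, which keeps \<open>x\<close> homogeneous of the same degree\<close>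
  have "\<exists>a. a \<in> carrier R \<and> (z l = \<zero>\<^bsub>Rhat\<^esub> \<longrightarrow> a = \<zero>) \<and> z l k = I_power k +> a" for l
  proof (cases "z l = \<zero>\<^bsub>Rhat\<^esub>")
    case True then show ?thesis by (intro exI[of _ \<zero>]) (simp add: completion_ops level_ops(4)[of \<zero> \<zero>])
  next
    case False then show ?thesis using completion_component[OF zc, of l k] by (auto simp: level_carrier)
  qed
  then obtain x where x: "\<And>l. x l \<in> carrier R" "\<And>l. z l = \<zero>\<^bsub>Rhat\<^esub> \<Longrightarrow> x l = \<zero>" "\<And>l. z l k = I_power k +> x l"
    by metis
  have "x \<in> chains n s"
    by (rule chainsI) (use x C.chains_supp[OF z] in blast)+
  then show ?thesis using x completion_le[OF zc x(1) x(3)] by (intro bexI[of _ x]) auto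
qed

end

section \<open>Koszul cycles over the completion\<close>

context cring
begin

text \<open>
  Every Koszul cycle \<open>z\<close> over the completion differs by a boundary from the image of
  a cycle over the ring, for which the transition to a suitable smaller exponent yields a
  boundary.
\<close>

lemma koszul_pro_zero_completion:
  assumes as: "set as \<subseteq> carrier R" "as \<noteq> []" and W: "koszul_pro_zero R as"
  defines "I \<equiv> Idl (set as)"
  shows "koszul_pro_zero (adic_completion R I) (map (completion_map R I) as)"
proof -
  interpret adic_ring R I
    using genideal_ideal[OF as(1)] is_cring by (simp add: adic_ring_def adic_ring_axioms_def I_def)
  interpret C: cring Rhat by (rule completion_cring)
  let ?\<gamma> = "completion_map R I" and ?p = "length as"
  let ?cas = "map ?\<gamma> as"
  have cas: "set ?cas \<subseteq> carrier Rhat" using as completion_map_closed by auto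
  have sR: "set (seq_power R as j) \<subseteq> carrier R" for j by (rule seq_power_carrier[OF as(1)])
  have sC: "set (seq_power Rhat ?cas j) \<subseteq> carrier Rhat" for j by (rule C.seq_power_carrier[OF cas])
  note sp = seq_power_ring_hom[OF is_cring completion_cring completion_map_hom as(1)]
  have comp: "map (\<lambda>f. f k) (map ?\<gamma> bs) = map ((+>) (I_power k)) bs" for k bs
    by (simp add: completion_map_def)
  show ?thesis unfolding koszul_pro_zero_def
  proof (intro allI impI)
    fix s :: int and j0 :: nat assume s: "1 \<le> s" and j0: "1 \<le> j0"
    obtain j1 where j1: "j1 \<ge> j0" and J1: "\<And>f. f \<in> chains ?p s \<Longrightarrow> kdiff R (seq_power R as j1) f = (\<lambda>_. \<zero>) \<Longrightarrow>
        \<exists>h\<in>chains ?p (s + 1). kscale R (seq_power R as (j1 - j0)) f = kdiff R (seq_power R as j0) h"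
      using W s j0 unfolding koszul_pro_zero_def by blast
    have j1': "1 \<le> j1" using j0 j1 by simp
    let ?D = "kdiff R (seq_power R as j1)"
    let ?DC = "kdiff Rhat (seq_power Rhat ?cas j1)"
    have Dc: "?D f l \<in> carrier R" if "f \<in> chains ?p t" for f t l
      by (rule kdiff_carr) (use chains_carr[OF that] sR in auto)
    have comm: "?DC z l k = kdiff (level k) (map ((+>) (I_power k)) (seq_power R as j1)) (\<lambda>l. z l k) l"
      if "\<And>l. z l \<in> carrier Rhat" for z l k
      using kdiff_ring_hom[OF completion_cring level_cring[of k] component_hom sC[of j1], where f = z and l = l] that
      by (simp add: sp[symmetric] comp del: map_map)
    have comm': "I_power k +> ?D f l = kdiff (level k) (map ((+>) (I_power k)) (seq_power R as j1)) (\<lambda>l. I_power k +> f l) l"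
      if "\<And>l. f l \<in> carrier R" for f l k
      using kdiff_ring_hom[OF is_cring level_cring level_hom sR] that by blast
    have AR: "\<exists>n. \<forall>x\<in>chains ?p t. ?D x = (\<lambda>_. \<zero>) \<longrightarrow> (\<forall>l. x l \<in> I_power n) \<longrightarrow>
       (\<exists>y\<in>chains ?p (t + 1). (\<forall>l. y l \<in> I_power n') \<and> ?D y = x)" for t n'
    proof -
      obtain n where n: "\<forall>x\<in>chains ?p t. ?D x = (\<lambda>_. \<zero>) \<longrightarrow> (\<forall>l. x l \<in> ideal_power R I n) \<longrightarrow>
       (\<exists>y\<in>chains ?p (t + 1). (\<forall>l. y l \<in> I_power n') \<and> ?D y = x)"
        using koszul_artin_rees[OF as W j1', of t "Suc n'"] unfolding I_def by blast
      have "I_power n \<subseteq> ideal_power R I n" by (rule ideal_power_antimono[OF I_ideal]) simp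
      then show ?thesis using n by blast
    qed
    show "\<exists>j1\<ge>j0. \<forall>f\<in>koszul_chains Rhat (length ?cas) s.
        kdiff Rhat (seq_power Rhat ?cas j1) f = (\<lambda>_. \<zero>\<^bsub>Rhat\<^esub>) \<longrightarrow>
        (\<exists>h\<in>koszul_chains Rhat (length ?cas) (s + 1).
           kscale Rhat (seq_power Rhat ?cas (j1 - j0)) f = kdiff Rhat (seq_power Rhat ?cas j0) h)"
    proof (intro exI[of _ j1] conjI ballI impI j1)
      fix z assume "z \<in> koszul_chains Rhat (length ?cas) s" and Dz: "?DC z = (\<lambda>_. \<zero>\<^bsub>Rhat\<^esub>)"
      then have z: "z \<in> koszul_chains Rhat ?p s" by simp
      have zc: "z l \<in> carrier Rhat" for l using C.chains_carr[OF z] .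
      \<comment> \<open>approximation by cycles: the boundary of an approximation is a small cycle, hence bounds a small chain, which is subtracted\<close>
      have cyc: "\<exists>w\<in>chains ?p s. ?D w = (\<lambda>_. \<zero>) \<and> (\<forall>l. \<forall>i\<le>k. I_power i +> w l = z l i)" for k
      proof -
        obtain n where n: "\<forall>x\<in>chains ?p (s - 1). ?D x = (\<lambda>_. \<zero>) \<longrightarrow> (\<forall>l. x l \<in> I_power n) \<longrightarrow>
          (\<exists>y\<in>chains ?p (s - 1 + 1). (\<forall>l. y l \<in> I_power k) \<and> ?D y = x)" using AR[of "s - 1" k] by blast
        obtain x where x: "x \<in> chains ?p s" "\<forall>l. \<forall>i\<le>n + k. I_power i +> x l = z l i"
          using approximation[OF z] by blast
        have xc: "x l \<in> carrier R" for l using x chains_carr by blast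
        have Dx: "?D x \<in> chains ?p (s - 1)" using kdiff_chains[OF _ sR] x by simp
        have "?D (?D x) = (\<lambda>_. \<zero>)" using kdiff_kdiff[OF xc sR] by auto
        moreover have "?D x l \<in> I_power n" for l
        proof -
          have "I_power n +> ?D x l = kdiff (level n) (map ((+>) (I_power n)) (seq_power R as j1)) (\<lambda>l. I_power n +> x l) l"
            by (rule comm'[OF xc])
          also have "(\<lambda>l. I_power n +> x l) = (\<lambda>l. z l n)" using x by auto
          also have "kdiff (level n) (map ((+>) (I_power n)) (seq_power R as j1)) (\<lambda>l. z l n) l = ?DC z l n"
            using comm[of z] zc by simp
          also have "\<dots> = I_power n +> \<zero>" by (simp add: Dz completion_ops level_ops(4)[of \<zero> \<zero>])
          finally show ?thesis using level_eq[of "?D x l" \<zero> n] Dc[OF x(1)] by (simp add: minus_eq)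
        qed
        ultimately obtain y where y: "y \<in> chains ?p s" "\<forall>l. y l \<in> I_power k" "?D y = ?D x"
          using n Dx by auto
        have yc: "y l \<in> carrier R" for l using y chains_carr by blast
        let ?w = "\<lambda>l. x l \<ominus> y l"
        have w: "?w \<in> chains ?p s" by (rule chains_minus[OF x(1) y(1)])
        have "?D ?w = (\<lambda>_. \<zero>)"
          using kdiff_minus[OF xc yc sR] y(3) Dc[OF x(1)] by (auto simp: minus_eq r_neg)
        moreover have "I_power i +> ?w l = z l i" if "i \<le> k" for l i
        proof -
          interpret P: ideal "I_power i" R by (rule pow_ideal)
          have yi: "y l \<in> I_power i" using y(2) pow_antimono[OF that] by blast
          have "?w l \<ominus> x l = \<ominus> y l" using xc[of l] yc[of l] by algebra
          then have "?w l \<ominus> x l \<in> I_power i" using yi by simp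
          then have "I_power i +> ?w l = I_power i +> x l" using level_eq[of "?w l" "x l" i] xc yc by simp
          then show ?thesis using x(2) that by simp
        qed
        ultimately show ?thesis using w by blast
      qed
      have "\<forall>k. \<exists>n. \<forall>x\<in>chains ?p s. ?D x = (\<lambda>_. \<zero>) \<longrightarrow> (\<forall>l. x l \<in> I_power n) \<longrightarrow>
          (\<exists>y\<in>chains ?p (s + 1). (\<forall>l. y l \<in> I_power k) \<and> ?D y = x)" using AR[of s] by blast
      then obtain e where e: "\<And>k x. \<lbrakk>x \<in> chains ?p s; ?D x = (\<lambda>_. \<zero>); \<forall>l. x l \<in> I_power (e k)\<rbrakk> \<Longrightarrow>
          \<exists>y\<in>chains ?p (s + 1). (\<forall>l. y l \<in> I_power k) \<and> ?D y = x" by metis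
      \<comment> \<open>precise enough for the difference of the approximations \<open>k\<close> and \<open>k + 1\<close> to be the boundary of a chain with values in \<open>I_power (Suc k)\<close>\<close>
      have "\<forall>k. \<exists>w. w \<in> chains ?p s \<and> ?D w = (\<lambda>_. \<zero>) \<and> (\<forall>l. \<forall>i\<le>k + e k + e (Suc k). I_power i +> w l = z l i)"
        using cyc by blast
      then obtain w where w: "\<And>k. w k \<in> chains ?p s" "\<And>k. ?D (w k) = (\<lambda>_. \<zero>)"
        "\<And>k l i. i \<le> k + e k + e (Suc k) \<Longrightarrow> I_power i +> w k l = z l i" by metis
      have wc: "w k l \<in> carrier R" for k l using w(1) chains_carr by blast
      have "\<forall>k. \<exists>b. b \<in> chains ?p (s + 1) \<and> (\<forall>l. b l \<in> I_power (Suc k)) \<and> ?D b = (\<lambda>l. w (Suc k) l \<ominus> w k l)"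
      proof
        fix k
        let ?x = "\<lambda>l. w (Suc k) l \<ominus> w k l"
        have x: "?x \<in> chains ?p s" by (rule chains_minus[OF w(1) w(1)])
        have Dx: "?D ?x = (\<lambda>_. \<zero>)" using kdiff_minus[OF wc wc sR] w(2) by (auto simp: minus_eq)
        have "?x l \<in> I_power (e (Suc k))" for l
          using level_eq[OF wc[of "Suc k" l] wc[of k l], of "e (Suc k)"] w(3)[of "e (Suc k)" _ l] by simp
        then show "\<exists>b. b \<in> chains ?p (s + 1) \<and> (\<forall>l. b l \<in> I_power (Suc k)) \<and> ?D b = ?x"
          using e[OF x Dx, of "Suc k"] by blast
      qed
      then obtain b where b: "\<And>k. b k \<in> chains ?p (s + 1)" "\<And>k l. b k l \<in> I_power (Suc k)"
        "\<And>k. ?D (b k) = (\<lambda>l. w (Suc k) l \<ominus> w k l)" by metis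
      have bc: "b k l \<in> carrier R" for k l using b(1) chains_carr by blast
      \<comment> \<open>the partial sums of the series of the \<open>b k\<close>, whose limit is \<open>c\<close>\<close>
      define B where "B = rec_nat (\<lambda>_. \<zero>) (\<lambda>k B l. B l \<oplus> b k l)"
      have B_0: "B 0 = (\<lambda>_. \<zero>)" and B_Suc: "B (Suc k) = (\<lambda>l. B k l \<oplus> b k l)" for k
        by (simp_all add: B_def)
      have B: "B k \<in> chains ?p (s + 1)" for k
        by (induction k) (simp_all add: B_0 B_Suc chains_zero chains_add b(1))
      have Bc: "B k l \<in> carrier R" for k l using B chains_carr by blast
      have DB: "?D (B k) l = w k l \<ominus> w 0 l" for k l
      proof (induction k)
        case 0 show ?case using wc by (simp add: B_0 kdiff_zero[OF sR] minus_eq r_neg)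
      next
        case (Suc k)
        have "?D (B (Suc k)) l = (w k l \<ominus> w 0 l) \<oplus> (w (Suc k) l \<ominus> w k l)"
          by (simp add: B_Suc kdiff_add[OF Bc bc sR] Suc b(3))
        also have "\<dots> = w (Suc k) l \<ominus> w 0 l"
          using wc[of k l] wc[of 0 l] wc[of "Suc k" l] by algebra
        finally show ?case .
      qed
      define c where "c l = (\<lambda>k. I_power k +> B k l)" for l
      have cc: "c l \<in> carrier Rhat" for l
        unfolding completion_carrier
      proof
        fix k
        interpret P: ideal "I_power k" R by (rule pow_ideal)
        have "b k l \<in> I_power k" using b(2)[of k l] pow_antimono[of k "Suc k"] by auto
        moreover have "B (Suc k) l \<ominus> B k l = b k l" unfolding B_Suc using Bc[of k l] bc[of k l] by algebra
        ultimately have "I_power k +> B (Suc k) l = I_power k +> B k l" using level_eq[OF Bc Bc] by simp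
        then show "\<exists>x\<in>carrier R. c l k = I_power k +> x \<and> c l (Suc k) = I_power (Suc k) +> x"
          using Bc by (intro bexI[of _ "B (Suc k) l"]) (auto simp: c_def)
      qed
      have c: "c \<in> koszul_chains Rhat ?p (s + 1)"
      proof (rule C.chainsI[OF cc])
        fix l assume "c l \<noteq> \<zero>\<^bsub>Rhat\<^esub>"
        then obtain k where "c l k \<noteq> \<zero>\<^bsub>Rhat\<^esub> k" by blast
        then have "B k l \<noteq> \<zero>" by (auto simp: c_def completion_ops level_ops(4)[of \<zero> \<zero>])
        then show "length l = ?p \<and> int (count_list l True) = s + 1" using chains_supp[OF B[of k]] by blast
      qed
      have g0: "(\<lambda>l. ?\<gamma> (w 0 l)) \<in> koszul_chains Rhat ?p s"
        by (rule chains_ring_hom[OF is_cring completion_cring completion_map_hom w(1)])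
      have g0c: "?\<gamma> (w 0 l) \<in> carrier Rhat" for l using C.chains_carr[OF g0] .
      \<comment> \<open>in component \<open>k\<close> this reads \<open>w k = w 0 + (w k - w 0)\<close>, as the boundary of \<open>B k\<close> telescopes\<close>
      have z_eq: "z l = ?\<gamma> (w 0 l) \<oplus>\<^bsub>Rhat\<^esub> ?DC c l" for l
      proof (rule ext)
        fix k
        have "?DC c l k = kdiff (level k) (map ((+>) (I_power k)) (seq_power R as j1)) (\<lambda>l. c l k) l"
          by (rule comm[OF cc])
        also have "\<dots> = I_power k +> ?D (B k) l" using comm'[OF Bc] by (simp add: c_def)
        finally have "(?\<gamma> (w 0 l) \<oplus>\<^bsub>Rhat\<^esub> ?DC c l) k = I_power k +> (w 0 l \<oplus> (w k l \<ominus> w 0 l))"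
          using wc by (simp add: DB completion_ops completion_map_def level_ops(1))
        also have "w 0 l \<oplus> (w k l \<ominus> w 0 l) = w k l" using wc[of 0 l] wc[of k l] by algebra
        also have "I_power k +> w k l = z l k" by (rule w(3)) simp
        finally show "z l k = (?\<gamma> (w 0 l) \<oplus>\<^bsub>Rhat\<^esub> ?DC c l) k" by simp
      qed
      obtain h where h: "h \<in> chains ?p (s + 1)"
        "kscale R (seq_power R as (j1 - j0)) (w 0) = kdiff R (seq_power R as j0) h"
        using J1[OF w(1) w(2)] by blast
      let ?S = "kscale Rhat (seq_power Rhat ?cas (j1 - j0))"
      let ?D0 = "kdiff Rhat (seq_power Rhat ?cas j0)"
      have hc: "h l \<in> carrier R" for l using h chains_carr by blast
      have gh: "(\<lambda>l. ?\<gamma> (h l)) \<in> koszul_chains Rhat ?p (s + 1)"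
        by (rule chains_ring_hom[OF is_cring completion_cring completion_map_hom h(1)])
      have Sc: "?S c \<in> koszul_chains Rhat ?p (s + 1)"
        using C.kscale_chains[of c "seq_power Rhat ?cas (j1 - j0)"] c sC by simp
      have Dcc: "?DC c l \<in> carrier Rhat" for l by (rule C.kdiff_carr[OF cc sC])
      have "?S z l = ?D0 (\<lambda>l. ?\<gamma> (h l) \<oplus>\<^bsub>Rhat\<^esub> ?S c l) l" for l
      proof -
        have "?S z l = ?S (\<lambda>l. ?\<gamma> (w 0 l) \<oplus>\<^bsub>Rhat\<^esub> ?DC c l) l"
          using z_eq by (simp flip: z_eq)
        also have "\<dots> = ?S (\<lambda>l. ?\<gamma> (w 0 l)) l \<oplus>\<^bsub>Rhat\<^esub> ?S (?DC c) l"
          by (rule C.kscale_add[OF g0c Dcc sC])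
        also have "?S (\<lambda>l. ?\<gamma> (w 0 l)) l = ?\<gamma> (kscale R (seq_power R as (j1 - j0)) (w 0) l)"
          using kscale_ring_hom[OF is_cring completion_cring completion_map_hom sR wc] by (simp add: sp)
        also have "\<dots> = ?\<gamma> (kdiff R (seq_power R as j0) h l)" by (simp add: h(2))
        also have "\<dots> = ?D0 (\<lambda>l. ?\<gamma> (h l)) l"
          using kdiff_ring_hom[OF is_cring completion_cring completion_map_hom sR hc] by (simp add: sp)
        also have "?S (?DC c) l = ?D0 (?S c) l"
          using C.kdiff_kscale[where l = l, OF cc sC[of "j1 - j0"] sC[of j0]] C.map2_seq_power[OF cas, of j0 "j1 - j0"] j1 by simp
        finally show ?thesis
          using C.kdiff_add[OF C.chains_carr[OF gh] C.chains_carr[OF Sc] sC] by simp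
      qed
      then show "\<exists>h\<in>koszul_chains Rhat (length ?cas) (s + 1). ?S z = ?D0 h"
        using C.chains_add[OF gh Sc] by (intro bexI[of _ "\<lambda>l. ?\<gamma> (h l) \<oplus>\<^bsub>Rhat\<^esub> ?S c l"]) auto
    qed
  qed
qed

lemma completed_ideal_generators:
  assumes as: "set as \<subseteq> carrier R"
  defines "I \<equiv> Idl (set as)"
  shows "completed_ideal R I = Idl\<^bsub>adic_completion R I\<^esub> (set (map (completion_map R I) as))"
proof -
  interpret adic_ring R I
    using genideal_ideal[OF as] is_cring by (simp add: adic_ring_def adic_ring_axioms_def I_def)
  interpret C: cring Rhat by (rule completion_cring)
  let ?\<gamma> = "completion_map R I"
  let ?J = "Idl\<^bsub>Rhat\<^esub> (?\<gamma> ` set as)"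
  have sub: "?\<gamma> ` set as \<subseteq> carrier Rhat" using as completion_map_closed by auto
  have subI: "set as \<subseteq> I" unfolding I_def by (rule genideal_self[OF as])
  have IR: "?\<gamma> ` I \<subseteq> carrier Rhat" using ideal.Icarr[OF I_ideal] completion_map_closed by blast
  have "ideal {r \<in> carrier R. ?\<gamma> r \<in> ?J} R"
    by (rule ring_hom_ring.ideal_vimage[OF ring_hom_ringI2[OF ring_axioms C.ring_axioms completion_map_hom]
        C.genideal_ideal[OF sub]])
  then have "I \<subseteq> {r \<in> carrier R. ?\<gamma> r \<in> ?J}"
    unfolding I_def by (rule genideal_minimal) (use as C.genideal_self[OF sub] in \<open>auto simp: I_def\<close>)
  then have 1: "Idl\<^bsub>Rhat\<^esub> (?\<gamma> ` I) \<subseteq> ?J"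
    by (intro C.genideal_minimal C.genideal_ideal[OF sub]) auto
  have 2: "?J \<subseteq> Idl\<^bsub>Rhat\<^esub> (?\<gamma> ` I)"
    by (intro C.genideal_minimal C.genideal_ideal[OF IR]) (use C.genideal_self[OF IR] subI in blast)
  show ?thesis unfolding completed_ideal_def using 1 2 by auto
qed

end

section \<open>Free modules\<close>

text \<open>
  The value at \<open>t\<close> of the linear map from the free module on \<open>X\<close> to the
  ring that takes the values \<open>w\<close> on the generators.
\<close>

definition lin_ext :: "('a, 'r) ring_scheme \<Rightarrow> 'x set \<Rightarrow> ('x \<Rightarrow> 'a) \<Rightarrow> ('x \<Rightarrow> 'a) \<Rightarrow> 'a" where
  "lin_ext R X w t = (\<Oplus>\<^bsub>R\<^esub>x\<in>{x \<in> X. t x \<noteq> \<zero>\<^bsub>R\<^esub>}. t x \<otimes>\<^bsub>R\<^esub> w x)"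

lemma free_module_simps:
  "carrier (free_module R X) = {t \<in> X \<rightarrow>\<^sub>E carrier R. finite {x \<in> X. t x \<noteq> \<zero>\<^bsub>R\<^esub>}}"
  "t \<oplus>\<^bsub>free_module R X\<^esub> s = (\<lambda>x\<in>X. t x \<oplus>\<^bsub>R\<^esub> s x)"
  "\<zero>\<^bsub>free_module R X\<^esub> = (\<lambda>x\<in>X. \<zero>\<^bsub>R\<^esub>)"
  "r \<odot>\<^bsub>free_module R X\<^esub> t = (\<lambda>x\<in>X. r \<otimes>\<^bsub>R\<^esub> t x)"
  by (simp_all add: free_module_def direct_sum_module_def regular_module_def)

lemma free_module_at:
  assumes "x \<in> X"
  shows "(t \<oplus>\<^bsub>free_module R X\<^esub> s) x = t x \<oplus>\<^bsub>R\<^esub> s x"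
    "\<zero>\<^bsub>free_module R X\<^esub> x = \<zero>\<^bsub>R\<^esub>" "(r \<odot>\<^bsub>free_module R X\<^esub> t) x = r \<otimes>\<^bsub>R\<^esub> t x"
  using assms by (simp_all add: free_module_simps)

context cring
begin

lemma free_carr: "t \<in> carrier (free_module R X) \<Longrightarrow> x \<in> X \<Longrightarrow> t x \<in> carrier R"
  by (auto simp: free_module_simps)

lemma free_fin: "t \<in> carrier (free_module R X) \<Longrightarrow> finite {x \<in> X. t x \<noteq> \<zero>}"
  by (auto simp: free_module_simps)

lemma free_memI:
  "\<lbrakk>\<And>x. x \<in> X \<Longrightarrow> t x \<in> carrier R; finite S; \<And>x. x \<in> X \<Longrightarrow> x \<notin> S \<Longrightarrow> t x = \<zero>\<rbrakk> \<Longrightarrow>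
   (\<lambda>x\<in>X. t x) \<in> carrier (free_module R X)"
  by (auto simp: free_module_simps intro: finite_subset[of _ S])

lemma free_add_closed:
  assumes "s \<in> carrier (free_module R X)" "t \<in> carrier (free_module R X)"
  shows "s \<oplus>\<^bsub>free_module R X\<^esub> t \<in> carrier (free_module R X)"
  unfolding free_module_simps(2)
  by (rule free_memI[where S = "{x \<in> X. s x \<noteq> \<zero>} \<union> {x \<in> X. t x \<noteq> \<zero>}"])
    (use assms[THEN free_fin] assms[THEN free_carr] in auto)

lemma free_smult_closed:
  assumes "t \<in> carrier (free_module R X)" "r \<in> carrier R"
  shows "r \<odot>\<^bsub>free_module R X\<^esub> t \<in> carrier (free_module R X)"
  unfolding free_module_simps(4)
  by (rule free_memI[where S = "{x \<in> X. t x \<noteq> \<zero>}"])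
    (use assms free_fin[OF assms(1)] free_carr[OF assms(1)] in auto)

lemma free_gen_closed: "free_gen R X x \<in> carrier (free_module R X)"
  unfolding free_gen_def by (rule free_memI[where S = "{x}"]) auto

lemma free_eqI:
  "\<lbrakk>s \<in> carrier (free_module R X); t \<in> carrier (free_module R X); \<And>x. x \<in> X \<Longrightarrow> s x = t x\<rbrakk> \<Longrightarrow> s = t"
  by (auto simp: free_module_simps intro: PiE_ext)

lemma free_module_abelian: "abelian_group (free_module R X)"
proof (rule abelian_groupI)
  let ?F = "free_module R X"
  fix t s u assume ts: "t \<in> carrier ?F" "s \<in> carrier ?F" "u \<in> carrier ?F"
  note c = ts[THEN free_carr]
  show "t \<oplus>\<^bsub>?F\<^esub> s \<oplus>\<^bsub>?F\<^esub> u = t \<oplus>\<^bsub>?F\<^esub> (s \<oplus>\<^bsub>?F\<^esub> u)"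
    by (rule free_eqI[where X = X]) (use ts c in \<open>auto intro: free_add_closed simp: free_module_at a_assoc\<close>)
next
  let ?F = "free_module R X"
  fix t s assume ts: "t \<in> carrier ?F" "s \<in> carrier ?F"
  note c = ts[THEN free_carr]
  show "t \<oplus>\<^bsub>?F\<^esub> s \<in> carrier ?F" by (rule free_add_closed[OF ts])
  show "t \<oplus>\<^bsub>?F\<^esub> s = s \<oplus>\<^bsub>?F\<^esub> t"
    by (rule free_eqI[where X = X]) (use ts c in \<open>auto intro: free_add_closed simp: free_module_at a_comm\<close>)
next
  let ?F = "free_module R X"
  show z: "\<zero>\<^bsub>?F\<^esub> \<in> carrier ?F"
    unfolding free_module_simps(3) by (rule free_memI[where S = "{}"]) auto
  fix t assume t: "t \<in> carrier ?F"
  note c = free_carr[OF t]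
  show "\<zero>\<^bsub>?F\<^esub> \<oplus>\<^bsub>?F\<^esub> t = t"
    by (rule free_eqI[where X = X]) (use t c z in \<open>auto intro: free_add_closed simp: free_module_at\<close>)
  have m: "(\<ominus> \<one>) \<odot>\<^bsub>?F\<^esub> t \<in> carrier ?F" by (rule free_smult_closed[OF t]) simp
  show "\<exists>s\<in>carrier ?F. s \<oplus>\<^bsub>?F\<^esub> t = \<zero>\<^bsub>?F\<^esub>"
  proof (rule bexI[OF _ m], rule free_eqI[where X = X])
    show "(\<ominus> \<one>) \<odot>\<^bsub>?F\<^esub> t \<oplus>\<^bsub>?F\<^esub> t \<in> carrier ?F" by (rule free_add_closed[OF m t])
    show "\<zero>\<^bsub>?F\<^esub> \<in> carrier ?F" by (rule z)
    show "((\<ominus> \<one>) \<odot>\<^bsub>?F\<^esub> t \<oplus>\<^bsub>?F\<^esub> t) x = \<zero>\<^bsub>?F\<^esub> x" if "x \<in> X" for x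
      using that c by (simp add: free_module_at l_minus l_neg)
  qed
qed

lemma free_module_module: "module R (free_module R X)"
proof (rule moduleI)
  let ?F = "free_module R X"
  show "cring R" by (rule is_cring)
  show "abelian_group ?F" by (rule free_module_abelian)
next
  let ?F = "free_module R X"
  fix t assume t: "t \<in> carrier ?F"
  note c = free_carr[OF t]
  show "\<one> \<odot>\<^bsub>?F\<^esub> t = t"
    by (rule free_eqI[OF free_smult_closed[OF t one_closed] t]) (use c in \<open>simp add: free_module_at\<close>)
  fix a assume a: "a \<in> carrier R"
  show "a \<odot>\<^bsub>?F\<^esub> t \<in> carrier ?F" by (rule free_smult_closed[OF t a])
  show "(a \<oplus> b) \<odot>\<^bsub>?F\<^esub> t = a \<odot>\<^bsub>?F\<^esub> t \<oplus>\<^bsub>?F\<^esub> b \<odot>\<^bsub>?F\<^esub> t" if b: "b \<in> carrier R" for b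
    by (rule free_eqI[where X = X]) (use a b t c in \<open>auto intro: free_smult_closed free_add_closed simp: free_module_at l_distr\<close>)
  show "(a \<otimes> b) \<odot>\<^bsub>?F\<^esub> t = a \<odot>\<^bsub>?F\<^esub> (b \<odot>\<^bsub>?F\<^esub> t)" if b: "b \<in> carrier R" for b
    by (rule free_eqI[where X = X]) (use a b t c in \<open>auto intro: free_smult_closed simp: free_module_at m_assoc\<close>)
  show "a \<odot>\<^bsub>?F\<^esub> (t \<oplus>\<^bsub>?F\<^esub> s) = a \<odot>\<^bsub>?F\<^esub> t \<oplus>\<^bsub>?F\<^esub> a \<odot>\<^bsub>?F\<^esub> s" if s: "s \<in> carrier ?F" for s
    by (rule free_eqI[where X = X]) (use a s t c free_carr[OF s] in \<open>auto intro: free_smult_closed free_add_closed simp: free_module_at r_distr\<close>)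
qed

lemma lin_ext_superset:
  assumes t: "t \<in> carrier (free_module R X)" and w: "\<And>x. x \<in> X \<Longrightarrow> w x \<in> carrier R"
    and S: "finite S" "S \<subseteq> X" "\<And>x. x \<in> X \<Longrightarrow> x \<notin> S \<Longrightarrow> t x = \<zero>"
  shows "lin_ext R X w t = (\<Oplus>x\<in>S. t x \<otimes> w x)"
  unfolding lin_ext_def
  by (rule add.finprod_mono_neutral_cong_left)
    (use S w free_carr[OF t] in auto)

lemma lin_ext_carr:
  assumes t: "t \<in> carrier (free_module R X)" and w: "\<And>x. x \<in> X \<Longrightarrow> w x \<in> carrier R"
  shows "lin_ext R X w t \<in> carrier R"
  unfolding lin_ext_def by (rule finsum_closed) (use w free_carr[OF t] in auto)

lemma lin_ext_add:
  assumes s: "s \<in> carrier (free_module R X)" and t: "t \<in> carrier (free_module R X)"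
    and w: "\<And>x. x \<in> X \<Longrightarrow> w x \<in> carrier R"
  shows "lin_ext R X w (s \<oplus>\<^bsub>free_module R X\<^esub> t) = lin_ext R X w s \<oplus> lin_ext R X w t"
proof -
  let ?S = "{x \<in> X. s x \<noteq> \<zero>} \<union> {x \<in> X. t x \<noteq> \<zero>}"
  have S: "finite ?S" "?S \<subseteq> X" using free_fin[OF s] free_fin[OF t] by auto
  have c: "s x \<in> carrier R" "t x \<in> carrier R" if "x \<in> X" for x using free_carr[OF s that] free_carr[OF t that] by auto
  have "lin_ext R X w (s \<oplus>\<^bsub>free_module R X\<^esub> t) = (\<Oplus>x\<in>?S. (s \<oplus>\<^bsub>free_module R X\<^esub> t) x \<otimes> w x)"
    by (rule lin_ext_superset[OF free_add_closed[OF s t] w S]) (auto simp: free_module_simps(2))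
  also have "\<dots> = (\<Oplus>x\<in>?S. s x \<otimes> w x \<oplus> t x \<otimes> w x)"
    by (rule finsum_cong') (use c w in \<open>auto simp: free_module_simps(2) l_distr\<close>)
  also have "\<dots> = (\<Oplus>x\<in>?S. s x \<otimes> w x) \<oplus> (\<Oplus>x\<in>?S. t x \<otimes> w x)"
    by (rule finsum_addf) (use c w in auto)
  also have "(\<Oplus>x\<in>?S. s x \<otimes> w x) = lin_ext R X w s"
    by (rule lin_ext_superset[OF s w S, symmetric]) auto
  also have "(\<Oplus>x\<in>?S. t x \<otimes> w x) = lin_ext R X w t"
    by (rule lin_ext_superset[OF t w S, symmetric]) auto
  finally show ?thesis .
qed

lemma lin_ext_smult:
  assumes t: "t \<in> carrier (free_module R X)" and r: "r \<in> carrier R"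
    and w: "\<And>x. x \<in> X \<Longrightarrow> w x \<in> carrier R"
  shows "lin_ext R X w (r \<odot>\<^bsub>free_module R X\<^esub> t) = r \<otimes> lin_ext R X w t"
proof -
  let ?S = "{x \<in> X. t x \<noteq> \<zero>}"
  have S: "finite ?S" "?S \<subseteq> X" using free_fin[OF t] by auto
  have c: "t x \<in> carrier R" if "x \<in> X" for x using free_carr[OF t that] .
  have "lin_ext R X w (r \<odot>\<^bsub>free_module R X\<^esub> t) = (\<Oplus>x\<in>?S. (r \<odot>\<^bsub>free_module R X\<^esub> t) x \<otimes> w x)"
    by (rule lin_ext_superset[OF free_smult_closed[OF t r] w S]) (auto simp: free_module_simps(4) r)
  also have "\<dots> = (\<Oplus>x\<in>?S. r \<otimes> (t x \<otimes> w x))"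
    by (rule finsum_cong') (use c w r in \<open>auto simp: free_module_simps(4) m_assoc\<close>)
  also have "\<dots> = r \<otimes> lin_ext R X w t"
    unfolding lin_ext_def by (rule finsum_rdistr[symmetric]) (use c w r S in auto)
  finally show ?thesis .
qed

lemma lin_ext_zero: "lin_ext R X w \<zero>\<^bsub>free_module R X\<^esub> = \<zero>"
  unfolding lin_ext_def by (rule add.finprod_one_eqI) (auto simp: free_module_simps)

lemma lin_ext_neg:
  assumes t: "t \<in> carrier (free_module R X)" and w: "\<And>x. x \<in> X \<Longrightarrow> w x \<in> carrier R"
  shows "lin_ext R X w (\<ominus>\<^bsub>free_module R X\<^esub> t) = \<ominus> lin_ext R X w t"
proof -
  interpret F: abelian_group "free_module R X" by (rule free_module_abelian)
  have "lin_ext R X w (\<ominus>\<^bsub>free_module R X\<^esub> t) \<oplus> lin_ext R X w t = \<zero>"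
    using lin_ext_add[OF F.a_inv_closed[OF t] t, of w] w lin_ext_zero[of X w] by (simp add: F.l_neg[OF t])
  then show ?thesis
    by (rule minus_equality[symmetric, OF _ lin_ext_carr[OF t w] lin_ext_carr[OF F.a_inv_closed[OF t] w]])
qed

lemma lin_ext_gen:
  assumes x: "x \<in> X" and w: "\<And>x. x \<in> X \<Longrightarrow> w x \<in> carrier R"
  shows "lin_ext R X w (free_gen R X x) = w x"
proof -
  have "lin_ext R X w (free_gen R X x) = (\<Oplus>y\<in>{x}. free_gen R X x y \<otimes> w y)"
    by (rule lin_ext_superset[OF free_gen_closed w]) (use x in \<open>auto simp: free_gen_def\<close>)
  also have "\<dots> = free_gen R X x x \<otimes> w x"
    using x w[OF x] by (simp add: free_gen_def)
  finally show ?thesis using x w[OF x] by (simp add: free_gen_def)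
qed

text \<open>
  If each generator is congruent to a multiple of one element \<open>g\<close>, then so is every
  element, and the multiple depends linearly on it. Induction on the support.
\<close>

lemma lin_ext_mod_submodule:
  assumes N: "submodule N R (free_module R X)" and w: "\<And>x. x \<in> X \<Longrightarrow> w x \<in> carrier R"
    and g: "g \<in> carrier (free_module R X)"
    and red: "\<And>x. x \<in> X \<Longrightarrow> free_gen R X x \<ominus>\<^bsub>free_module R X\<^esub> w x \<odot>\<^bsub>free_module R X\<^esub> g \<in> N"
    and t: "t \<in> carrier (free_module R X)"
  shows "t \<ominus>\<^bsub>free_module R X\<^esub> lin_ext R X w t \<odot>\<^bsub>free_module R X\<^esub> g \<in> N"
proof -
  let ?F = "free_module R X"
  interpret F: module R ?F by (rule free_module_module)
  interpret N: submodule N R ?F by (rule N)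
  have Nadd: "a \<oplus>\<^bsub>?F\<^esub> b \<in> N" if "a \<in> N" "b \<in> N" for a b using N.m_closed that by simp
  have "finite S \<Longrightarrow> \<forall>t. t \<in> carrier ?F \<longrightarrow> {x \<in> X. t x \<noteq> \<zero>} \<subseteq> S \<longrightarrow> t \<ominus>\<^bsub>?F\<^esub> lin_ext R X w t \<odot>\<^bsub>?F\<^esub> g \<in> N" for S
  proof (induction S rule: finite_induct)
    case empty
    show ?case
    proof (intro allI impI)
      fix t assume t: "t \<in> carrier ?F" "{x \<in> X. t x \<noteq> \<zero>} \<subseteq> {}"
      have "t = \<zero>\<^bsub>?F\<^esub>" by (rule free_eqI[OF t(1) F.M.zero_closed]) (use t in \<open>auto simp: free_module_simps\<close>)
      then show "t \<ominus>\<^bsub>?F\<^esub> lin_ext R X w t \<odot>\<^bsub>?F\<^esub> g \<in> N"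
        using N.m_inv_closed[OF N.one_closed] g by (simp add: lin_ext_zero F.M.minus_eq a_inv_def[symmetric])
    qed
  next
    case (insert y S)
    show ?case
    proof (intro allI impI)
      fix t assume t: "t \<in> carrier ?F" "{x \<in> X. t x \<noteq> \<zero>} \<subseteq> insert y S"
      show "t \<ominus>\<^bsub>?F\<^esub> lin_ext R X w t \<odot>\<^bsub>?F\<^esub> g \<in> N"
      proof (cases "y \<in> X")
        case False
        then have "{x \<in> X. t x \<noteq> \<zero>} \<subseteq> S" using t by auto
        then show ?thesis using insert.IH t by blast
      next
        case y: True
        define u where "u = (\<lambda>x\<in>X. if x = y then \<zero> else t x)"
        have tc: "t x \<in> carrier R" if "x \<in> X" for x using free_carr[OF t(1) that] .
        have u: "u \<in> carrier ?F" unfolding u_def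
          by (rule free_memI[where S = "{x \<in> X. t x \<noteq> \<zero>}"]) (use tc free_fin[OF t(1)] in auto)
        have eg: "free_gen R X y \<in> carrier ?F" by (rule free_gen_closed)
        have ty: "t y \<in> carrier R" "w y \<in> carrier R" using tc w y by auto
        have teq: "t = u \<oplus>\<^bsub>?F\<^esub> t y \<odot>\<^bsub>?F\<^esub> free_gen R X y"
          by (rule free_eqI[OF t(1) free_add_closed[OF u free_smult_closed[OF eg ty(1)]]])
            (use tc ty in \<open>auto simp: free_module_simps u_def free_gen_def\<close>)
        have L: "lin_ext R X w t = lin_ext R X w u \<oplus> t y \<otimes> w y"
          by (subst teq) (simp add: lin_ext_add[OF u free_smult_closed[OF eg ty(1)] w]
              lin_ext_smult[OF eg ty(1) w] lin_ext_gen[OF y w])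
        have Lu: "lin_ext R X w u \<in> carrier R" by (rule lin_ext_carr[OF u w])
        have "u \<ominus>\<^bsub>?F\<^esub> lin_ext R X w u \<odot>\<^bsub>?F\<^esub> g \<in> N"
        proof -
          have "{x \<in> X. u x \<noteq> \<zero>} \<subseteq> S" using t(2) by (auto simp: u_def)
          then show ?thesis using insert.IH u by blast
        qed
        moreover have "t y \<odot>\<^bsub>?F\<^esub> (free_gen R X y \<ominus>\<^bsub>?F\<^esub> w y \<odot>\<^bsub>?F\<^esub> g) \<in> N"
          by (rule N.smult_closed[OF ty(1) red[OF y]])
        ultimately have "(u \<ominus>\<^bsub>?F\<^esub> lin_ext R X w u \<odot>\<^bsub>?F\<^esub> g) \<oplus>\<^bsub>?F\<^esub> t y \<odot>\<^bsub>?F\<^esub> (free_gen R X y \<ominus>\<^bsub>?F\<^esub> w y \<odot>\<^bsub>?F\<^esub> g) \<in> N"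
          by (rule Nadd)
        also have "(u \<ominus>\<^bsub>?F\<^esub> lin_ext R X w u \<odot>\<^bsub>?F\<^esub> g) \<oplus>\<^bsub>?F\<^esub> t y \<odot>\<^bsub>?F\<^esub> (free_gen R X y \<ominus>\<^bsub>?F\<^esub> w y \<odot>\<^bsub>?F\<^esub> g)
          = (u \<oplus>\<^bsub>?F\<^esub> t y \<odot>\<^bsub>?F\<^esub> free_gen R X y) \<ominus>\<^bsub>?F\<^esub> (lin_ext R X w u \<oplus> t y \<otimes> w y) \<odot>\<^bsub>?F\<^esub> g"
          using u eg g Lu ty
          by (simp add: F.M.minus_eq F.smult_l_distr F.smult_r_distr F.smult_assoc1 F.smult_r_minus F.M.minus_add F.M.a_ac)
        finally show ?thesis using teq L by simp
      qed
    qed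
  qed
  then show ?thesis using free_fin[OF t] t by blast
qed

section \<open>Tensor products of copies of the ring\<close>

lemma finprod_upd:
  fixes p :: nat
  assumes "i < p" "u \<in> carrier R" "\<And>j. j < p \<Longrightarrow> x j \<in> carrier R"
  shows "finprod R (x(i := u)) {..<p} = u \<otimes> finprod R x ({..<p} - {i})"
proof -
  have e: "{..<p} = insert i ({..<p} - {i})" using assms by auto
  have "finprod R (x(i := u)) (insert i ({..<p} - {i})) = u \<otimes> finprod R (x(i := u)) ({..<p} - {i})"
    by (subst finprod_insert) (use assms in auto)
  then have "finprod R (x(i := u)) {..<p} = u \<otimes> finprod R (x(i := u)) ({..<p} - {i})"
    by (simp only: e[symmetric])
  also have "finprod R (x(i := u)) ({..<p} - {i}) = finprod R x ({..<p} - {i})"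
    by (rule finprod_cong') (use assms in auto)
  finally show ?thesis .
qed

end

text \<open>
  Both the free module of rank one and the zero module have this form.
\<close>

definition ideal_module :: "('a, 'r) ring_scheme \<Rightarrow> 'a set \<Rightarrow> ('a, 'a) module" where
  "ideal_module R J = (regular_module R)\<lparr>carrier := J\<rparr>"

lemma ideal_module_simps [simp]:
  "carrier (ideal_module R J) = J" "add (ideal_module R J) = add R" "smult (ideal_module R J) = mult R"
  "zero (ideal_module R J) = zero R"
  by (simp_all add: ideal_module_def regular_module_def)

text \<open>
  When every factor is the ring or zero, multiplication of the factors identifies the tensor
  product with the ring or with zero. The element of the tensor product that corresponds to
  \<open>r\<close> is, as a coset in the free module on tuples, the fibre over \<open>r\<close>,
  which is \<open>tensor_fibre\<close>.
\<close>

definition tensor_values :: "('a, 'r) ring_scheme \<Rightarrow> nat \<Rightarrow> (nat \<Rightarrow> 'a set) \<Rightarrow> 'a set" where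
  "tensor_values R p D = (if \<forall>i<p. D i = carrier R then carrier R else {\<zero>\<^bsub>R\<^esub>})"

definition tensor_fibre :: "('a, 'r) ring_scheme \<Rightarrow> nat \<Rightarrow> (nat \<Rightarrow> 'a set) \<Rightarrow> 'a \<Rightarrow> ((nat \<Rightarrow> 'a) \<Rightarrow> 'a) set" where
  "tensor_fibre R p D r =
     {t \<in> carrier (free_module R (PiE {..<p} D)).
        lin_ext R (PiE {..<p} D) (\<lambda>x. finprod R x {..<p}) t = r}"

locale tensor_of_ideals = cring R for R (structure) + fixes p :: nat and D :: "nat \<Rightarrow> 'a set"
  assumes D: "\<And>i. i < p \<Longrightarrow> D i = carrier R \<or> D i = {\<zero>}"
begin

abbreviation "X \<equiv> PiE {..<p} D"
abbreviation "F \<equiv> free_module R X"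
abbreviation "w \<equiv> \<lambda>x. finprod R x {..<p}"
abbreviation "ev \<equiv> lin_ext R X w"
abbreviation "N \<equiv> tensor_fibre R p D \<zero>"

lemma D_closed:
  assumes i: "i < p" and u: "u \<in> D i"
  shows D_sub: "u \<in> carrier R" and D_add: "v \<in> D i \<Longrightarrow> u \<oplus> v \<in> D i"
    and D_smult: "r \<in> carrier R \<Longrightarrow> r \<otimes> u \<in> D i"
  using D[OF i] u by (elim disjE; simp)+

lemma X_carr: "x \<in> X \<Longrightarrow> i < p \<Longrightarrow> x i \<in> carrier R" using D_sub by (auto simp: PiE_def Pi_def)

lemma w_carr: "x \<in> X \<Longrightarrow> w x \<in> carrier R" by (rule finprod_closed) (use X_carr in auto)

lemma X_upd: "x \<in> X \<Longrightarrow> i < p \<Longrightarrow> u \<in> D i \<Longrightarrow> x(i := u) \<in> X" by (auto simp: PiE_def extensional_def)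

sublocale F: module R F by (rule free_module_module)

lemma kernel_submodule: "submodule N R F"
proof (rule F.submoduleI)
  show "N \<subseteq> carrier F" by (auto simp: tensor_fibre_def)
  show "\<zero>\<^bsub>F\<^esub> \<in> N" by (simp add: tensor_fibre_def lin_ext_zero)
  show "\<ominus>\<^bsub>F\<^esub> a \<in> N" if "a \<in> N" for a
    using that w_carr by (auto simp: tensor_fibre_def lin_ext_neg)
  show "a \<oplus>\<^bsub>F\<^esub> b \<in> N" if "a \<in> N" "b \<in> N" for a b
    using that w_carr by (auto simp: tensor_fibre_def lin_ext_add)
  show "a \<odot>\<^bsub>F\<^esub> x \<in> N" if "a \<in> carrier R" "x \<in> N" for a x
    using that w_carr by (auto simp: tensor_fibre_def lin_ext_smult)
qed

abbreviation "e \<equiv> free_gen R X"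

lemma e_closed: "e x \<in> carrier F" by (rule free_gen_closed)

lemma ev_e: "x \<in> X \<Longrightarrow> ev (e x) = w x" by (rule lin_ext_gen) (use w_carr in auto)

lemma ev_minus: "s \<in> carrier F \<Longrightarrow> t \<in> carrier F \<Longrightarrow> ev (s \<ominus>\<^bsub>F\<^esub> t) = ev s \<ominus> ev t"
  using w_carr by (simp add: F.M.minus_eq minus_eq lin_ext_add lin_ext_neg)

lemma rel_add:
  assumes "x \<in> X" "i < p" "u \<in> D i" "v \<in> D i"
  shows "e (x(i := u \<oplus> v)) \<ominus>\<^bsub>F\<^esub> (e (x(i := u)) \<oplus>\<^bsub>F\<^esub> e (x(i := v))) \<in> N"
proof -
  have c: "u \<in> carrier R" "v \<in> carrier R" "\<And>j. j < p \<Longrightarrow> x j \<in> carrier R"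
    using assms D_sub X_carr by auto
  have f: "finprod R x ({..<p} - {i}) \<in> carrier R" by (rule finprod_closed) (use c in auto)
  have "ev (e (x(i := u \<oplus> v)) \<ominus>\<^bsub>F\<^esub> (e (x(i := u)) \<oplus>\<^bsub>F\<^esub> e (x(i := v)))) =
    w (x(i := u \<oplus> v)) \<ominus> (w (x(i := u)) \<oplus> w (x(i := v)))"
    using assms w_carr by (simp add: ev_minus e_closed lin_ext_add ev_e X_upd D_add)
  also have "\<dots> = \<zero>" using c f assms(2) by (simp add: finprod_upd l_distr minus_eq r_neg)
  finally show ?thesis by (simp add: tensor_fibre_def e_closed)
qed

lemma rel_smult:
  assumes "x \<in> X" "i < p" "r \<in> carrier R" "u \<in> D i"
  shows "e (x(i := r \<otimes> u)) \<ominus>\<^bsub>F\<^esub> (r \<odot>\<^bsub>F\<^esub> e (x(i := u))) \<in> N"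
proof -
  have c: "u \<in> carrier R" "\<And>j. j < p \<Longrightarrow> x j \<in> carrier R"
    using assms D_sub X_carr by auto
  have f: "finprod R x ({..<p} - {i}) \<in> carrier R" by (rule finprod_closed) (use c in auto)
  have "ev (e (x(i := r \<otimes> u)) \<ominus>\<^bsub>F\<^esub> (r \<odot>\<^bsub>F\<^esub> e (x(i := u)))) = w (x(i := r \<otimes> u)) \<ominus> r \<otimes> w (x(i := u))"
    using assms w_carr by (simp add: ev_minus e_closed lin_ext_smult ev_e X_upd D_smult)
  also have "\<dots> = \<zero>" using c f assms(2,3) by (simp add: finprod_upd m_assoc minus_eq r_neg)
  finally show ?thesis using assms by (simp add: tensor_fibre_def e_closed)
qed

definition "unit_tuple = (\<lambda>i\<in>{..<p}. if D i = {\<zero>} then \<zero> else \<one>)"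

lemma unit_tuple: "unit_tuple \<in> X"
proof -
  have "(if D i = {\<zero>} then \<zero> else \<one>) \<in> D i" if "i < p" for i
    using D[OF that] by (cases "D i = {\<zero>}") auto
  then show ?thesis by (simp add: unit_tuple_def)
qed

text \<open>
  Moving the scalars out of one factor after the other reduces a tuple \<open>x\<close> to
  \<open>w x\<close> times the tuple of units. In a factor that is zero the unit and the entry are
  both \<open>\<zero>\<close>, and \<open>\<zero> = \<zero> \<otimes> \<zero>\<close>.
\<close>

lemma free_gen_mod_relations:
  assumes K: "submodule K R F"
    and rel: "\<And>x i r u. \<lbrakk>x \<in> X; i < p; r \<in> carrier R; u \<in> D i\<rbrakk> \<Longrightarrow> e (x(i := r \<otimes> u)) \<ominus>\<^bsub>F\<^esub> (r \<odot>\<^bsub>F\<^esub> e (x(i := u))) \<in> K"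
    and x: "x \<in> X"
  shows "e x \<ominus>\<^bsub>F\<^esub> w x \<odot>\<^bsub>F\<^esub> e unit_tuple \<in> K"
proof -
  interpret K: submodule K R F by (rule K)
  have Kadd: "a \<oplus>\<^bsub>F\<^esub> b \<in> K" if "a \<in> K" "b \<in> K" for a b using K.m_closed that by simp
  \<comment> \<open>the first \<open>k\<close> factors are already reduced\<close>
  define y where "y k = (\<lambda>i. if i < k then unit_tuple i else x i)" for k
  have yX: "y k \<in> X" if "k \<le> p" for k
    using that x unit_tuple by (auto simp: y_def PiE_def Pi_def extensional_def)
  have "k \<le> p \<longrightarrow> e x \<ominus>\<^bsub>F\<^esub> finprod R x {..<k} \<odot>\<^bsub>F\<^esub> e (y k) \<in> K" for k
  proof (induction k)
    case 0
    have "y 0 = x" by (rule ext) (simp add: y_def)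
    then show ?case using K.one_closed e_closed by (simp add: F.M.minus_eq F.M.r_neg)
  next
    case (Suc k)
    show ?case
    proof
      assume k: "Suc k \<le> p"
      let ?P = "finprod R x {..<k}"
      have P: "?P \<in> carrier R" by (rule finprod_closed) (use X_carr[OF x] k in auto)
      have xk: "x k \<in> carrier R" "x k \<in> D k" using X_carr[OF x, of k] PiE_mem[OF x, of k] k by simp_all
      have uk: "unit_tuple k \<in> D k" using PiE_mem[OF unit_tuple, of k] k by simp
      have kp: "k < p" and kp': "k \<le> p" using k by auto
      have 1: "x k \<otimes> unit_tuple k = x k"
      proof (cases "D k = {\<zero>}")
        case True then show ?thesis using xk kp by (simp add: unit_tuple_def)
      next
        case False then show ?thesis using xk kp by (simp add: unit_tuple_def)
      qed
      have 2: "(y k)(k := x k) = y k" "(y k)(k := unit_tuple k) = y (Suc k)" by (auto simp: y_def)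
      have "e (y k) \<ominus>\<^bsub>F\<^esub> (x k \<odot>\<^bsub>F\<^esub> e (y (Suc k))) \<in> K"
        using rel[OF yX[OF kp'] kp xk(1) uk] by (simp only: 1 2)
      then have "?P \<odot>\<^bsub>F\<^esub> (e (y k) \<ominus>\<^bsub>F\<^esub> (x k \<odot>\<^bsub>F\<^esub> e (y (Suc k)))) \<in> K" by (rule K.smult_closed[OF P])
      then have "(e x \<ominus>\<^bsub>F\<^esub> ?P \<odot>\<^bsub>F\<^esub> e (y k)) \<oplus>\<^bsub>F\<^esub> ?P \<odot>\<^bsub>F\<^esub> (e (y k) \<ominus>\<^bsub>F\<^esub> (x k \<odot>\<^bsub>F\<^esub> e (y (Suc k)))) \<in> K"
        using Suc k Kadd by simp
      also have "(e x \<ominus>\<^bsub>F\<^esub> ?P \<odot>\<^bsub>F\<^esub> e (y k)) \<oplus>\<^bsub>F\<^esub> ?P \<odot>\<^bsub>F\<^esub> (e (y k) \<ominus>\<^bsub>F\<^esub> (x k \<odot>\<^bsub>F\<^esub> e (y (Suc k))))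
        = e x \<ominus>\<^bsub>F\<^esub> (?P \<otimes> x k) \<odot>\<^bsub>F\<^esub> e (y (Suc k))"
        using P xk e_closed
        by (simp add: F.M.minus_eq F.smult_r_distr F.smult_assoc1 F.smult_r_minus F.M.a_assoc F.M.r_neg1)
      also have "?P \<otimes> x k = finprod R x {..<Suc k}"
        unfolding lessThan_Suc by (subst finprod_insert) (use P xk X_carr[OF x] k in \<open>auto simp: m_comm\<close>)
      finally show "e x \<ominus>\<^bsub>F\<^esub> finprod R x {..<Suc k} \<odot>\<^bsub>F\<^esub> e (y (Suc k)) \<in> K" .
    qed
  qed
  moreover have "y p = unit_tuple"
    using x by (auto simp: y_def unit_tuple_def PiE_def extensional_def)
  ultimately show ?thesis by (metis order_refl)
qed

lemma tuples_eq: "tensor_tuples p (\<lambda>i. ideal_module R (D i)) = X"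
  by (simp add: tensor_tuples_def)

lemma tensor_free_eq: "tensor_free R p (\<lambda>i. ideal_module R (D i)) = F"
  by (simp add: tensor_free_def tuples_eq)

text \<open>
  The relations lie in the kernel of multiplication because it is multilinear. Conversely, modulo
  any submodule that contains the generating relations, an element is its product times one fixed
  tuple.
\<close>

lemma relations_eq: "tensor_relations R p (\<lambda>i. ideal_module R (D i)) = N"
proof -
  let ?S1 = "{e (x(i := u \<oplus> v)) \<ominus>\<^bsub>F\<^esub> (e (x(i := u)) \<oplus>\<^bsub>F\<^esub> e (x(i := v))) | x i u v.
            x \<in> X \<and> i < p \<and> u \<in> D i \<and> v \<in> D i}"
  let ?S2 = "{e (x(i := r \<otimes> u)) \<ominus>\<^bsub>F\<^esub> (r \<odot>\<^bsub>F\<^esub> e (x(i := u))) | x i r u.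
            x \<in> X \<and> i < p \<and> r \<in> carrier R \<and> u \<in> D i}"
  have "tensor_relations R p (\<lambda>i. ideal_module R (D i)) = submodule_span R F (?S1 \<union> ?S2)"
    unfolding tensor_relations_def Let_def tensor_free_eq tuples_eq by simp
  also have "\<dots> = N"
  proof
    have "?S1 \<union> ?S2 \<subseteq> N" using rel_add rel_smult by blast
    then show "submodule_span R F (?S1 \<union> ?S2) \<subseteq> N"
      unfolding submodule_span_def using kernel_submodule by blast
    show "N \<subseteq> submodule_span R F (?S1 \<union> ?S2)"
      unfolding submodule_span_def
    proof (rule Inter_greatest)
      fix K assume "K \<in> {N. submodule N R F \<and> ?S1 \<union> ?S2 \<subseteq> N}"
      then have K: "submodule K R F" and S: "?S2 \<subseteq> K" by auto
      have "e x \<ominus>\<^bsub>F\<^esub> w x \<odot>\<^bsub>F\<^esub> e unit_tuple \<in> K" if "x \<in> X" for x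
        by (rule free_gen_mod_relations[OF K _ that]) (use S in blast)
      from lin_ext_mod_submodule[OF K w_carr e_closed this]
      have *: "t \<ominus>\<^bsub>F\<^esub> ev t \<odot>\<^bsub>F\<^esub> e unit_tuple \<in> K" if "t \<in> carrier F" for t using that by blast
      show "N \<subseteq> K"
      proof
        fix t assume "t \<in> N"
        then have t: "t \<in> carrier F" "ev t = \<zero>" by (auto simp: tensor_fibre_def)
        have "t \<ominus>\<^bsub>F\<^esub> \<zero> \<odot>\<^bsub>F\<^esub> e unit_tuple = t"
          using t(1) e_closed[of unit_tuple] F.M.minus_equality[of "\<zero>\<^bsub>F\<^esub>" "\<zero>\<^bsub>F\<^esub>"] by (simp add: F.smult_l_null F.M.minus_eq)
        then show "t \<in> K" using *[OF t(1)] t(2) by simp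
      qed
    qed
  qed
  finally show ?thesis .
qed

lemma values_sub: "tensor_values R p D \<subseteq> carrier R" by (auto simp: tensor_values_def)

text \<open>
  The tuple of ones shows that every scalar is attained if all factors are the ring. If some
  factor is zero, then every product vanishes.
\<close>

lemma values_eq: "r \<in> tensor_values R p D \<longleftrightarrow> (\<exists>t\<in>carrier F. ev t = r)"
proof (cases "\<forall>i<p. D i = carrier R")
  case True
  have "ev (r \<odot>\<^bsub>F\<^esub> e (\<lambda>i\<in>{..<p}. \<one>)) = r" if r: "r \<in> carrier R" for r
  proof -
    have o: "(\<lambda>i\<in>{..<p}. \<one>) \<in> X" using True by auto
    have "w (\<lambda>i\<in>{..<p}. \<one>) = \<one>" by (rule finprod_one_eqI) auto
    then show ?thesis using r w_carr by (simp add: lin_ext_smult e_closed ev_e[OF o])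
  qed
  then have "r \<in> carrier R \<Longrightarrow> \<exists>t\<in>carrier F. ev t = r" using e_closed F.smult_closed by blast
  then show ?thesis using True lin_ext_carr[of _ X w] w_carr by (auto simp: tensor_values_def)
next
  case False
  then obtain i where i: "i < p" "D i = {\<zero>}" using D by blast
  have "w x = \<zero>" if x: "x \<in> X" for x
  proof -
    have "x i \<in> D i" using PiE_mem[OF x, of i] i by simp
    then have "x = x(i := \<zero>)" using i by auto
    then have "w x = w (x(i := \<zero>))" by simp
    also have "\<dots> = \<zero> \<otimes> finprod R x ({..<p} - {i})"
      by (rule finprod_upd) (use i X_carr[OF x] in auto)
    also have "\<dots> = \<zero>" by (rule l_null, rule finprod_closed) (use X_carr[OF x] in auto)
    finally show ?thesis .
  qed
  then have "ev t = \<zero>" if "t \<in> carrier F" for t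
    unfolding lin_ext_def by (intro add.finprod_one_eqI) (use free_carr[OF that] in auto)
  then show ?thesis using False F.M.zero_closed by (auto simp: tensor_values_def)
qed

lemma coset_fibre:
  assumes t: "t \<in> carrier F"
  shows "N +>\<^bsub>F\<^esub> t = tensor_fibre R p D (ev t)"
proof (intro equalityI subsetI)
  fix s assume "s \<in> N +>\<^bsub>F\<^esub> t"
  then obtain n where n: "n \<in> N" "s = n \<oplus>\<^bsub>F\<^esub> t" by (auto simp: a_r_coset_def r_coset_def)
  then show "s \<in> tensor_fibre R p D (ev t)"
    using t w_carr lin_ext_carr[OF t, of w] by (auto simp: tensor_fibre_def lin_ext_add)
next
  fix s assume "s \<in> tensor_fibre R p D (ev t)"
  then have s: "s \<in> carrier F" "ev s = ev t" by (auto simp: tensor_fibre_def)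
  have "ev (s \<ominus>\<^bsub>F\<^esub> t) = \<zero>" using s t lin_ext_carr[OF t, of w] w_carr by (simp add: ev_minus minus_eq r_neg)
  then have "s \<ominus>\<^bsub>F\<^esub> t \<in> N" using s t by (simp add: tensor_fibre_def)
  moreover have "s = (s \<ominus>\<^bsub>F\<^esub> t) \<oplus>\<^bsub>F\<^esub> t" using s t by (simp add: F.M.minus_eq F.M.a_assoc F.M.l_neg)
  ultimately show "s \<in> N +>\<^bsub>F\<^esub> t" unfolding a_r_coset_def r_coset_def by auto
qed

abbreviation "T \<equiv> tensor_product R p (\<lambda>i. ideal_module R (D i))"

lemma T_carrier: "carrier T = tensor_fibre R p D ` tensor_values R p D"
proof -
  have "carrier T = {N +>\<^bsub>F\<^esub> t | t. t \<in> carrier F}"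
    by (auto simp: tensor_product_def tensor_free_eq relations_eq quotient_module_def A_RCOSETS_def RCOSETS_def a_r_coset_def)
  also have "\<dots> = {tensor_fibre R p D (ev t) | t. t \<in> carrier F}"
    using coset_fibre by (intro Collect_cong) (metis)
  also have "\<dots> = tensor_fibre R p D ` tensor_values R p D" using values_eq by auto
  finally show ?thesis .
qed

lemma T_zero: "\<zero>\<^bsub>T\<^esub> = N"
  by (simp add: tensor_product_def tensor_free_eq relations_eq quotient_module_def)

lemma T_add:
  assumes r: "r \<in> tensor_values R p D" and s: "s \<in> tensor_values R p D"
  shows "tensor_fibre R p D r \<oplus>\<^bsub>T\<^esub> tensor_fibre R p D s = tensor_fibre R p D (r \<oplus> s)"
proof -
  have "tensor_fibre R p D r \<oplus>\<^bsub>T\<^esub> tensor_fibre R p D s = tensor_fibre R p D r <+>\<^bsub>F\<^esub> tensor_fibre R p D s"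
    by (simp add: tensor_product_def tensor_free_eq relations_eq quotient_module_def)
  also have "\<dots> = tensor_fibre R p D (r \<oplus> s)"
  proof (intro equalityI subsetI)
    fix z assume "z \<in> tensor_fibre R p D r <+>\<^bsub>F\<^esub> tensor_fibre R p D s"
    then show "z \<in> tensor_fibre R p D (r \<oplus> s)"
      using w_carr by (auto simp: set_add_def set_mult_def tensor_fibre_def lin_ext_add)
  next
    fix z assume z: "z \<in> tensor_fibre R p D (r \<oplus> s)"
    obtain t where t: "t \<in> carrier F" "ev t = r" using r values_eq by blast
    have zc: "z \<in> carrier F" "ev z = r \<oplus> s" using z by (auto simp: tensor_fibre_def)
    have rs: "r \<in> carrier R" "s \<in> carrier R" using r s values_sub by auto
    have "ev (z \<ominus>\<^bsub>F\<^esub> t) = (r \<oplus> s) \<ominus> r" using t zc by (simp add: ev_minus)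
    also have "\<dots> = s" using rs by algebra
    finally have "z \<ominus>\<^bsub>F\<^esub> t \<in> tensor_fibre R p D s" using t zc by (simp add: tensor_fibre_def)
    moreover have "z = t \<oplus>\<^bsub>F\<^esub> (z \<ominus>\<^bsub>F\<^esub> t)"
      using t zc F.M.r_neg2[of t z] by (simp add: F.M.minus_eq F.M.a_comm F.M.a_lcomm F.M.r_neg)
    moreover have "t \<in> tensor_fibre R p D r" using t by (simp add: tensor_fibre_def)
    ultimately show "z \<in> tensor_fibre R p D r <+>\<^bsub>F\<^esub> tensor_fibre R p D s"
      unfolding set_add_def set_mult_def by auto
  qed
  finally show ?thesis .
qed

lemma fibre_inj:
  "\<lbrakk>r \<in> tensor_values R p D; tensor_fibre R p D r = tensor_fibre R p D s\<rbrakk> \<Longrightarrow> r = s"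
  using values_eq by (auto simp: tensor_fibre_def)

end

section \<open>Tensor products of scalar multiplications\<close>

lemma set_add_memI: "x \<in> A \<Longrightarrow> y \<in> B \<Longrightarrow> x \<oplus>\<^bsub>G\<^esub> y \<in> A <+>\<^bsub>G\<^esub> B"
  by (auto simp: set_add_def set_mult_def)

lemma (in comm_monoid) finprod_lessThan_Suc_shift:
  assumes "f \<in> {..<Suc n} \<rightarrow> carrier G"
  shows "finprod G f {..<Suc n} = f 0 \<otimes> finprod G (\<lambda>i. f (Suc i)) {..<n}"
proof -
  have "finprod G f {..<Suc n} = f 0 \<otimes> finprod G f (Suc ` {..<n})"
    unfolding lessThan_Suc_eq_insert_0 by (subst finprod_insert) (use assms in auto)
  also have "finprod G f (Suc ` {..<n}) = finprod G (\<lambda>i. f (Suc i)) {..<n}"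
    by (rule finprod_reindex) (use assms in auto)
  finally show ?thesis .
qed

context cring
begin

lemma finsum_neg:
  assumes "finite A" "f \<in> A \<rightarrow> carrier R"
  shows "(\<Oplus>i\<in>A. \<ominus> f i) = \<ominus> (\<Oplus>i\<in>A. f i)"
  using assms
proof (induction A rule: finite_induct)
  case (insert a A)
  then show ?case by (subst (1 2) finsum_insert) (auto simp: minus_add)
qed simp

text \<open>
  The recursive boundary agrees with the usual alternating sum: the sign of slot \<open>i\<close>
  is the parity of the number of \<open>True\<close> entries before it.
\<close>

lemma kdiff_explicit:
  "\<lbrakk>\<And>l. f l \<in> carrier R; set bs \<subseteq> carrier R; length l = length bs\<rbrakk> \<Longrightarrow>
   kdiff R bs f l = (\<Oplus>i\<in>{..<length bs}. if l ! i then \<zero>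
      else if even (count_list (take i l) True) then bs ! i \<otimes> f (l[i := True]) else \<ominus> (bs ! i \<otimes> f (l[i := True])))"
proof (induction bs arbitrary: f l)
  case Nil then show ?case by simp
next
  case (Cons b bs)
  then obtain x k where l: "l = x # k" "length k = length bs" by (cases l) auto
  have c: "b \<in> carrier R" "set bs \<subseteq> carrier R" "\<And>i. i < length bs \<Longrightarrow> bs ! i \<in> carrier R"
    using Cons.prems by auto
  let ?t = "\<lambda>f k i. if k ! i then \<zero>
      else if even (count_list (take i k) True) then bs ! i \<otimes> f (k[i := True]) else \<ominus> (bs ! i \<otimes> f (k[i := True]))"
  let ?T = "\<lambda>i. if l ! i then \<zero>
      else if even (count_list (take i l) True) then (b # bs) ! i \<otimes> f (l[i := True]) else \<ominus> ((b # bs) ! i \<otimes> f (l[i := True]))"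
  have IH: "kdiff R bs (\<lambda>l. f (y # l)) k = (\<Oplus>i\<in>{..<length bs}. ?t (\<lambda>l. f (y # l)) k i)" for y
    by (rule Cons.IH) (use Cons.prems c l in auto)
  have nb: "(b # bs) ! i \<in> carrier R" if "i < Suc (length bs)" for i
    using c that by (cases i) auto
  have T: "?T \<in> {..<Suc (length bs)} \<rightarrow> carrier R"
    using nb Cons.prems(1) by auto
  have t: "?t (\<lambda>l. f (y # l)) k \<in> {..<length bs} \<rightarrow> carrier R" for y
    using c Cons.prems(1) by auto
  have "(\<Oplus>i\<in>{..<length (b # bs)}. ?T i) = ?T 0 \<oplus> (\<Oplus>i\<in>{..<length bs}. ?T (Suc i))"
    using add.finprod_lessThan_Suc_shift[OF T] by simp
  also have "\<dots> = kdiff R (b # bs) f l"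
  proof (cases x)
    case True
    have "(\<Oplus>i\<in>{..<length bs}. ?T (Suc i)) = (\<Oplus>i\<in>{..<length bs}. \<ominus> ?t (\<lambda>l. f (True # l)) k i)"
      by (rule finsum_cong') (use t[of True] c Cons.prems(1) in \<open>auto simp: l True\<close>)
    also have "\<dots> = \<ominus> (\<Oplus>i\<in>{..<length bs}. ?t (\<lambda>l. f (True # l)) k i)"
      by (rule finsum_neg) (use t in auto)
    finally show ?thesis using True finsum_closed[OF t[of True]] by (simp add: l IH)
  next
    case False
    have "(\<Oplus>i\<in>{..<length bs}. ?T (Suc i)) = (\<Oplus>i\<in>{..<length bs}. ?t (\<lambda>l. f (False # l)) k i)"
      by (rule finsum_cong') (use t[of False] in \<open>auto simp: l False\<close>)
    then show ?thesis using False finsum_closed[OF t[of False]] c Cons.prems(1)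
      by (simp add: l IH a_comm)
  qed
  finally show ?case by simp
qed

lemma kscale_explicit:
  "\<lbrakk>\<And>l. f l \<in> carrier R; set bs \<subseteq> carrier R; length l = length bs\<rbrakk> \<Longrightarrow>
   kscale R bs f l = finprod R (\<lambda>i. if l ! i then bs ! i else \<one>) {..<length bs} \<otimes> f l"
proof (induction bs arbitrary: f l)
  case Nil then show ?case by simp
next
  case (Cons b bs)
  then obtain x k where l: "l = x # k" "length k = length bs" by (cases l) auto
  have c: "b \<in> carrier R" "set bs \<subseteq> carrier R" "\<And>i. i < length bs \<Longrightarrow> bs ! i \<in> carrier R"
    using Cons.prems by auto
  have nb: "(b # bs) ! i \<in> carrier R" if "i < Suc (length bs)" for i
    using c that by (cases i) auto
  let ?P = "finprod R (\<lambda>i. if k ! i then bs ! i else \<one>) {..<length bs}"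
  have P: "?P \<in> carrier R" by (rule finprod_closed) (use c in auto)
  have "finprod R (\<lambda>i. if l ! i then (b # bs) ! i else \<one>) {..<length (b # bs)} = (if x then b else \<one>) \<otimes> ?P"
    using finprod_lessThan_Suc_shift[of "\<lambda>i. if l ! i then (b # bs) ! i else \<one>" "length bs"] nb by (simp add: l cong: if_cong)
  moreover have "kscale R bs (\<lambda>l. f (y # l)) k = ?P \<otimes> f (y # k)" for y
    by (rule Cons.IH) (use Cons.prems c l in auto)
  ultimately show ?case using c P Cons.prems(1) by (simp add: l m_assoc)
qed

text \<open>
  A tensor product of scalar multiplications is multiplication by the product of the scalars. This
  is checked on the free modules, by grouping the sum over tuples according to their images.
\<close>

lemma tensor_map_fibre:
  assumes "tensor_of_ideals R p D" "tensor_of_ideals R p D'"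
    and c: "\<And>i. i < p \<Longrightarrow> c i \<in> carrier R"
    and f: "\<And>i u. \<lbrakk>i < p; u \<in> D i\<rbrakk> \<Longrightarrow> f i u = c i \<otimes> u \<and> c i \<otimes> u \<in> D' i"
    and r: "r \<in> tensor_values R p D"
  shows "tensor_map R p (\<lambda>i. ideal_module R (D i)) (\<lambda>i. ideal_module R (D' i)) f (tensor_fibre R p D r)
      = tensor_fibre R p D' (finprod R c {..<p} \<otimes> r)" (is ?thesis1)
    and "finprod R c {..<p} \<otimes> r \<in> tensor_values R p D'" (is ?thesis2)
proof -
  interpret S: tensor_of_ideals R p D by fact
  interpret S': tensor_of_ideals R p D' by fact
  let ?X = "PiE {..<p} D" and ?X' = "PiE {..<p} D'"
  let ?F = "free_module R ?X" and ?F' = "free_module R ?X'"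
  let ?w = "\<lambda>x. finprod R x {..<p}"
  let ?C = "finprod R c {..<p}"
  define \<phi> where "\<phi> x = (\<lambda>i\<in>{..<p}. f i (x i))" for x
  have C: "?C \<in> carrier R" by (rule finprod_closed) (use c in auto)
  have phi: "\<phi> x \<in> ?X'" if x: "x \<in> ?X" for x
  proof -
    have "f i (x i) \<in> D' i" if "i < p" for i using f[OF that, of "x i"] PiE_mem[OF x, of i] that by simp
    then show ?thesis by (simp add: \<phi>_def)
  qed
  have wphi: "?w (\<phi> x) = ?C \<otimes> ?w x" if x: "x \<in> ?X" for x
  proof -
    have xm: "x i \<in> D i" if "i < p" for i using PiE_mem[OF x, of i] that by simp
    have "?w (\<phi> x) = finprod R (\<lambda>i. c i \<otimes> x i) {..<p}"
      by (rule finprod_cong') (use c f xm S.X_carr[OF x] in \<open>auto simp: \<phi>_def\<close>)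
    also have "\<dots> = ?C \<otimes> ?w x" by (rule finprod_multf) (use c S.X_carr[OF x] in auto)
    finally show ?thesis .
  qed
  let ?m = "free_map R ?X ?X' \<phi>"
  have m: "?m t \<in> carrier ?F'" "lin_ext R ?X' ?w (?m t) = ?C \<otimes> lin_ext R ?X ?w t" if t: "t \<in> carrier ?F" for t
  proof -
    define S where "S = {x \<in> ?X. t x \<noteq> \<zero>}"
    have S: "finite S" "S \<subseteq> ?X" using free_fin[OF t] by (auto simp: S_def)
    have tc: "t x \<in> carrier R" if "x \<in> S" for x using free_carr[OF t] that S by auto
    have mt: "?m t = (\<lambda>y\<in>?X'. \<Oplus>x\<in>{x \<in> S. \<phi> x = y}. t x)"
      by (simp add: free_map_def S_def conj_assoc)
    have out: "(\<Oplus>x\<in>{x \<in> S. \<phi> x = y}. t x) = \<zero>" if "y \<notin> \<phi> ` S" for y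
    proof -
      have "{x \<in> S. \<phi> x = y} = {}" using that by auto
      then show ?thesis by (simp only: finsum_empty)
    qed
    have inc: "(\<Oplus>x\<in>{x \<in> S. \<phi> x = y}. t x) \<in> carrier R" for y
      by (rule finsum_closed) (use tc in auto)
    show mc: "?m t \<in> carrier ?F'" unfolding mt
      by (rule free_memI[where S = "\<phi> ` S"]) (use S out inc in auto)
    have pS: "\<phi> ` S \<subseteq> ?X'" using phi S by auto
    have "lin_ext R ?X' ?w (?m t) = (\<Oplus>y\<in>\<phi> ` S. ?m t y \<otimes> ?w y)"
      by (rule lin_ext_superset[OF mc]) (use S'.w_carr S pS out in \<open>auto simp: mt\<close>)
    also have "\<dots> = (\<Oplus>y\<in>\<phi> ` S. \<Oplus>x\<in>{x \<in> S. \<phi> x = y}. t x \<otimes> ?w (\<phi> x))"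
    proof (rule finsum_cong')
      show "(\<lambda>y. \<Oplus>x\<in>{x \<in> S. \<phi> x = y}. t x \<otimes> ?w (\<phi> x)) \<in> \<phi> ` S \<rightarrow> carrier R"
        by (intro funcsetI finsum_closed) (use tc S'.w_carr phi S in auto)
      fix y assume y: "y \<in> \<phi> ` S"
      then have yX: "y \<in> ?X'" using pS by auto
      have "(\<Oplus>x\<in>{x \<in> S. \<phi> x = y}. t x) \<otimes> ?w y = (\<Oplus>x\<in>{x \<in> S. \<phi> x = y}. t x \<otimes> ?w y)"
        by (rule finsum_ldistr) (use S tc S'.w_carr[OF yX] in auto)
      also have "\<dots> = (\<Oplus>x\<in>{x \<in> S. \<phi> x = y}. t x \<otimes> ?w (\<phi> x))"
        by (rule finsum_cong') (use tc S'.w_carr[OF yX] in auto)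
      finally show "?m t y \<otimes> ?w y = (\<Oplus>x\<in>{x \<in> S. \<phi> x = y}. t x \<otimes> ?w (\<phi> x))"
        using yX by (simp add: mt)
    qed simp
    also have "\<dots> = (\<Oplus>x\<in>(\<Union>y\<in>\<phi> ` S. {x \<in> S. \<phi> x = y}). t x \<otimes> ?w (\<phi> x))"
      by (rule add.finprod_UN_disjoint[symmetric])
        (use S tc S'.w_carr phi in \<open>auto simp: pairwise_def disjnt_def\<close>)
    also have "(\<Union>y\<in>\<phi> ` S. {x \<in> S. \<phi> x = y}) = S" by auto
    also have "(\<Oplus>x\<in>S. t x \<otimes> ?w (\<phi> x)) = (\<Oplus>x\<in>S. ?C \<otimes> (t x \<otimes> ?w x))"
    proof (rule finsum_cong')
      show "(\<lambda>x. ?C \<otimes> (t x \<otimes> ?w x)) \<in> S \<rightarrow> carrier R" using tc C S.w_carr S by auto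
      fix x assume "x \<in> S"
      then have "x \<in> ?X" "t x \<in> carrier R" using S tc by auto
      then show "t x \<otimes> ?w (\<phi> x) = ?C \<otimes> (t x \<otimes> ?w x)"
        using C S.w_carr by (simp add: wphi m_lcomm)
    qed simp
    also have "\<dots> = ?C \<otimes> lin_ext R ?X ?w t"
      unfolding lin_ext_def S_def[symmetric]
      by (rule finsum_rdistr[symmetric]) (use tc C S.w_carr S in auto)
    finally show "lin_ext R ?X' ?w (?m t) = ?C \<otimes> lin_ext R ?X ?w t" .
  qed
  obtain t0 where t0: "t0 \<in> carrier ?F" "lin_ext R ?X ?w t0 = r" using r S.values_eq by blast
  show ?thesis2 unfolding S'.values_eq using m[OF t0(1)] t0(2) by blast
  have "tensor_map R p (\<lambda>i. ideal_module R (D i)) (\<lambda>i. ideal_module R (D' i)) f (tensor_fibre R p D r)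
     = tensor_fibre R p D' \<zero> <+>\<^bsub>?F'\<^esub> (?m ` tensor_fibre R p D r)"
    by (simp add: tensor_map_def quotient_map_def S'.tensor_free_eq S'.relations_eq S.tuples_eq S'.tuples_eq \<phi>_def[abs_def])
  also have "\<dots> = tensor_fibre R p D' (?C \<otimes> r)"
  proof (intro equalityI subsetI)
    fix z assume "z \<in> tensor_fibre R p D' \<zero> <+>\<^bsub>?F'\<^esub> (?m ` tensor_fibre R p D r)"
    then obtain n t where nt: "n \<in> tensor_fibre R p D' \<zero>" "t \<in> tensor_fibre R p D r" "z = n \<oplus>\<^bsub>?F'\<^esub> ?m t"
      by (auto simp: set_add_def set_mult_def)
    have t: "t \<in> carrier ?F" "lin_ext R ?X ?w t = r" using nt by (auto simp: tensor_fibre_def)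
    have n: "n \<in> carrier ?F'" "lin_ext R ?X' ?w n = \<zero>" using nt by (auto simp: tensor_fibre_def)
    have rc: "r \<in> carrier R" using r S.values_sub by auto
    show "z \<in> tensor_fibre R p D' (?C \<otimes> r)"
      using n m[OF t(1)] t(2) C rc S'.w_carr by (simp add: tensor_fibre_def nt(3) lin_ext_add)
  next
    fix z assume "z \<in> tensor_fibre R p D' (?C \<otimes> r)"
    then have z: "z \<in> carrier ?F'" "lin_ext R ?X' ?w z = ?C \<otimes> r" by (auto simp: tensor_fibre_def)
    have rc: "r \<in> carrier R" using r S.values_sub by auto
    note m0 = m[OF t0(1)]
    have "lin_ext R ?X' ?w (z \<ominus>\<^bsub>?F'\<^esub> ?m t0) = \<zero>"
      using S'.ev_minus[OF z(1) m0(1)] m0(2) z(2) t0(2) C rc by (simp add: minus_eq r_neg)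
    then have 1: "z \<ominus>\<^bsub>?F'\<^esub> ?m t0 \<in> tensor_fibre R p D' \<zero>" using z m0 by (simp add: tensor_fibre_def)
    have 2: "z = (z \<ominus>\<^bsub>?F'\<^esub> ?m t0) \<oplus>\<^bsub>?F'\<^esub> ?m t0"
      using z(1) m0(1) by (simp add: S'.F.M.minus_eq S'.F.M.a_assoc S'.F.M.l_neg)
    have 3: "?m t0 \<in> ?m ` tensor_fibre R p D r" using t0 by (auto simp: tensor_fibre_def)
    show "z \<in> tensor_fibre R p D' \<zero> <+>\<^bsub>?F'\<^esub> (?m ` tensor_fibre R p D r)"
      by (subst 2) (rule set_add_memI[OF 1 3])
  qed
  finally show ?thesis1 .
qed

text \<open>
  Addition, negation and finite sums can be computed in a subgroup \<open>E\<close> of the ring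
  for any module whose carrier is an additive image of \<open>E\<close>.
\<close>

lemma image_abelian_group:
  fixes M :: "('c, 'm) ring_scheme"
  assumes E: "E \<subseteq> carrier R" "\<zero> \<in> E" "\<And>r s. r \<in> E \<Longrightarrow> s \<in> E \<Longrightarrow> r \<oplus> s \<in> E" "\<And>r. r \<in> E \<Longrightarrow> \<ominus> r \<in> E"
    and M: "carrier M = \<phi> ` E" "\<zero>\<^bsub>M\<^esub> = \<phi> \<zero>"
    and add: "\<And>r s. r \<in> E \<Longrightarrow> s \<in> E \<Longrightarrow> \<phi> r \<oplus>\<^bsub>M\<^esub> \<phi> s = \<phi> (r \<oplus> s)"
  shows "abelian_group M"
    and "r \<in> E \<Longrightarrow> \<ominus>\<^bsub>M\<^esub> \<phi> r = \<phi> (\<ominus> r)"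
    and "finite A \<Longrightarrow> g \<in> A \<rightarrow> E \<Longrightarrow> finsum M (\<lambda>i. \<phi> (g i)) A = \<phi> (finsum R g A)"
proof -
  have Ec: "r \<in> carrier R" if "r \<in> E" for r using E that by auto
  show ag: "abelian_group M"
  proof (rule abelian_groupI)
    fix x y z assume "x \<in> carrier M" "y \<in> carrier M" "z \<in> carrier M"
    then obtain r s t where "r \<in> E" "s \<in> E" "t \<in> E" "x = \<phi> r" "y = \<phi> s" "z = \<phi> t" unfolding M by blast
    then show "x \<oplus>\<^bsub>M\<^esub> y \<oplus>\<^bsub>M\<^esub> z = x \<oplus>\<^bsub>M\<^esub> (y \<oplus>\<^bsub>M\<^esub> z)" using E Ec by (simp add: add a_assoc)
  next
    fix x y assume "x \<in> carrier M" "y \<in> carrier M"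
    then obtain r s where rs: "r \<in> E" "s \<in> E" "x = \<phi> r" "y = \<phi> s" unfolding M by blast
    then show "x \<oplus>\<^bsub>M\<^esub> y \<in> carrier M" unfolding M using E by (simp add: add)
    show "x \<oplus>\<^bsub>M\<^esub> y = y \<oplus>\<^bsub>M\<^esub> x" using rs E Ec by (simp add: add a_comm)
  next
    show "\<zero>\<^bsub>M\<^esub> \<in> carrier M" using E unfolding M by simp
  next
    fix x assume "x \<in> carrier M"
    then obtain r where r: "r \<in> E" "x = \<phi> r" unfolding M by blast
    show "\<zero>\<^bsub>M\<^esub> \<oplus>\<^bsub>M\<^esub> x = x" using r E Ec by (simp add: M add)
    have "\<phi> (\<ominus> r) \<oplus>\<^bsub>M\<^esub> x = \<zero>\<^bsub>M\<^esub>" using r E Ec by (simp add: M add l_neg)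
    then show "\<exists>y\<in>carrier M. y \<oplus>\<^bsub>M\<^esub> x = \<zero>\<^bsub>M\<^esub>" unfolding M(1) using r E by blast
  qed
  interpret M: abelian_group M by (rule ag)
  show "\<ominus>\<^bsub>M\<^esub> \<phi> r = \<phi> (\<ominus> r)" if r: "r \<in> E"
  proof (rule M.minus_equality)
    show "\<phi> (\<ominus> r) \<oplus>\<^bsub>M\<^esub> \<phi> r = \<zero>\<^bsub>M\<^esub>" using r E Ec by (simp add: M add l_neg)
    show "\<phi> r \<in> carrier M" "\<phi> (\<ominus> r) \<in> carrier M" unfolding M using r E by auto
  qed
  show "finsum M (\<lambda>i. \<phi> (g i)) A = \<phi> (finsum R g A)" if "finite A" "g \<in> A \<rightarrow> E"
    using that
  proof (induction A rule: finite_induct)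
    case empty show ?case by (simp add: M)
  next
    case (insert a A)
    have gA: "g \<in> A \<rightarrow> E" "g a \<in> E" using insert.prems by auto
    have sE: "finsum R g A \<in> E" using insert.hyps(1) gA(1)
    proof (induction A rule: finite_induct)
      case (insert b B)
      then have "g b \<in> E" "g \<in> B \<rightarrow> carrier R" using Ec by auto
      then show ?case using insert E Ec by simp
    qed (use E in simp)
    have "finsum M (\<lambda>i. \<phi> (g i)) (insert a A) = \<phi> (g a) \<oplus>\<^bsub>M\<^esub> finsum M (\<lambda>i. \<phi> (g i)) A"
      by (rule M.finsum_insert) (use insert.hyps insert.prems M in auto)
    also have "\<dots> = \<phi> (g a \<oplus> finsum R g A)" using insert.IH gA sE by (simp add: add)
    also have "g a \<oplus> finsum R g A = finsum R g (insert a A)"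
      by (rule finsum_insert[symmetric]) (use insert.hyps gA Ec in auto)
    finally show ?case .
  qed
qed

end

section \<open>The Koszul complex as a tensor product\<close>

definition koszul_dom :: "('a, 'r) ring_scheme \<Rightarrow> int \<Rightarrow> 'a set" where
  "koszul_dom R n = (if n = -1 \<or> n = 0 then carrier R else {\<zero>\<^bsub>R\<^esub>})"

text \<open>
  Multidegrees with entries \<open>-1\<close> and \<open>0\<close> correspond to words, with
  \<open>True\<close> for \<open>-1\<close>. In all other multidegrees the component of the Koszul
  complex is zero.
\<close>

definition degree_word :: "nat \<Rightarrow> (nat \<Rightarrow> int) \<Rightarrow> bool list" where
  "degree_word p \<nu> = map (\<lambda>i. \<nu> i = -1) [0..<p]"

definition word_degree :: "bool list \<Rightarrow> nat \<Rightarrow> int" where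
  "word_degree l = (\<lambda>i\<in>{..<length l}. if l ! i then -1 else 0)"

definition coefficient :: "('a, 'r) ring_scheme \<Rightarrow> nat \<Rightarrow> (bool list \<Rightarrow> 'a) \<Rightarrow> (nat \<Rightarrow> int) \<Rightarrow> 'a" where
  "coefficient R p f \<nu> = (if \<forall>i<p. \<nu> i = -1 \<or> \<nu> i = 0 then f (degree_word p \<nu>) else \<zero>\<^bsub>R\<^esub>)"

abbreviation "koszul_fibre R p \<nu> \<equiv> tensor_fibre R p (\<lambda>i. koszul_dom R (\<nu> i))"
abbreviation "koszul_values R p \<nu> \<equiv> tensor_values R p (\<lambda>i. koszul_dom R (\<nu> i))"
abbreviation "koszul_component R p \<nu> \<equiv> tensor_product R p (\<lambda>i. ideal_module R (koszul_dom R (\<nu> i)))"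

text \<open>
  The isomorphism from chains in coordinates of degree \<open>- n\<close> onto the degree
  \<open>n\<close> part of the tensor product complex.
\<close>

definition realize :: "('a, 'r) ring_scheme \<Rightarrow> nat \<Rightarrow> int \<Rightarrow> (bool list \<Rightarrow> 'a) \<Rightarrow>
    (nat \<Rightarrow> int) \<Rightarrow> ((nat \<Rightarrow> 'a) \<Rightarrow> 'a) set" where
  "realize R p n f = (\<lambda>\<nu>\<in>multidegrees p n. koszul_fibre R p \<nu> (coefficient R p f \<nu>))"

lemma cobj_koszul1: "cobj (koszul1 R a) n = ideal_module R (koszul_dom R n)"
  by (simp add: koszul1_def ideal_module_def koszul_dom_def zero_module_def regular_module_def)

lemma tensor_component_koszul:
  "tensor_component R p (\<lambda>i. koszul1 R (a i)) = koszul_component R p"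
  by (rule ext) (simp add: tensor_component_def cobj_koszul1)

lemma cobj_koszul:
  "cobj (koszul R as) n = direct_sum_module R (multidegrees (length as) n) (koszul_component R (length as))"
  by (simp add: koszul_def tensor_complex_def tensor_component_koszul)

lemma length_degree_word [simp]: "length (degree_word p \<nu>) = p" by (simp add: degree_word_def)

lemma nth_degree_word [simp]: "i < p \<Longrightarrow> degree_word p \<nu> ! i \<longleftrightarrow> \<nu> i = -1" by (simp add: degree_word_def)

lemma take_degree_word: "i \<le> p \<Longrightarrow> take i (degree_word p \<nu>) = degree_word i \<nu>"
  by (simp add: degree_word_def take_map)

lemma sum_degree_word:
  "(\<And>j. j < k \<Longrightarrow> \<nu> j = -1 \<or> \<nu> j = 0) \<Longrightarrow> (\<Sum>j<k. \<nu> j) = - int (count_list (degree_word k \<nu>) True)"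
proof (induction k)
  case (Suc k)
  have "degree_word (Suc k) \<nu> = degree_word k \<nu> @ [\<nu> k = -1]" by (simp add: degree_word_def)
  then show ?case using Suc Suc.prems[of k] by auto
qed (simp add: degree_word_def)

lemma degree_word_word_degree: "length l = p \<Longrightarrow> degree_word p (word_degree l) = l"
  by (rule nth_equalityI) (auto simp: word_degree_def)

lemma word_degree_degree_word:
  "\<lbrakk>\<nu> \<in> extensional {..<p}; \<And>i. i < p \<Longrightarrow> \<nu> i = -1 \<or> \<nu> i = 0\<rbrakk> \<Longrightarrow> word_degree (degree_word p \<nu>) = \<nu>"
  by (rule extensionalityI[where A = "{..<p}"]) (force simp: word_degree_def)+

lemma word_degree_multidegrees:
  "\<lbrakk>length l = p; int (count_list l True) = - n\<rbrakk> \<Longrightarrow> word_degree l \<in> multidegrees p n"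
proof -
  assume l: "length l = p" "int (count_list l True) = - n"
  have "(\<Sum>i<p. word_degree l i) = - int (count_list (degree_word p (word_degree l)) True)"
    by (rule sum_degree_word) (auto simp: word_degree_def l)
  then have "(\<Sum>i<p. word_degree l i) = n" using l by (simp add: degree_word_word_degree)
  moreover have "word_degree l \<in> {..<p} \<rightarrow>\<^sub>E UNIV" using l by (simp add: word_degree_def)
  ultimately show ?thesis by (simp add: multidegrees_def)
qed

lemma coefficient_binary:
  "\<forall>i<p. \<nu> i = -1 \<or> \<nu> i = 0 \<Longrightarrow> coefficient R p f \<nu> = f (degree_word p \<nu>)"
  unfolding coefficient_def by (rule if_P)

lemma coefficient_other:
  "\<not> (\<forall>i<p. \<nu> i = -1 \<or> \<nu> i = 0) \<Longrightarrow> coefficient R p f \<nu> = \<zero>\<^bsub>R\<^esub>"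
  unfolding coefficient_def by (rule if_not_P)

lemma coefficient_word_degree: "length l = p \<Longrightarrow> coefficient R p f (word_degree l) = f l"
proof -
  assume l: "length l = p"
  have "\<forall>i<p. word_degree l i = -1 \<or> word_degree l i = 0" using l by (simp add: word_degree_def)
  then have "coefficient R p f (word_degree l) = f (degree_word p (word_degree l))"
    by (rule coefficient_binary)
  then show ?thesis by (simp only: degree_word_word_degree[OF l])
qed

context cring
begin

lemma koszul_tensor_of_ideals: "tensor_of_ideals R p (\<lambda>i. koszul_dom R (\<nu> i))"
  using is_cring by (auto simp: tensor_of_ideals_def tensor_of_ideals_axioms_def koszul_dom_def)

lemma coefficient_values: "(\<And>l. f l \<in> carrier R) \<Longrightarrow> coefficient R p f \<nu> \<in> koszul_values R p \<nu>"
  by (auto simp: coefficient_def tensor_values_def koszul_dom_def)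

lemma koszul_component_carrier: "carrier (koszul_component R p \<nu>) = koszul_fibre R p \<nu> ` koszul_values R p \<nu>"
  by (rule tensor_of_ideals.T_carrier[OF koszul_tensor_of_ideals])

lemma koszul_component_zero: "\<zero>\<^bsub>koszul_component R p \<nu>\<^esub> = koszul_fibre R p \<nu> \<zero>"
  by (rule tensor_of_ideals.T_zero[OF koszul_tensor_of_ideals])

lemma koszul_component_add:
  "\<lbrakk>r \<in> koszul_values R p \<nu>; s \<in> koszul_values R p \<nu>\<rbrakk> \<Longrightarrow>
   koszul_fibre R p \<nu> r \<oplus>\<^bsub>koszul_component R p \<nu>\<^esub> koszul_fibre R p \<nu> s = koszul_fibre R p \<nu> (r \<oplus> s)"
  by (rule tensor_of_ideals.T_add[OF koszul_tensor_of_ideals])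

lemma values_subgroup:
  "tensor_values R p D \<subseteq> carrier R" "\<zero> \<in> tensor_values R p D"
  "\<And>r s. r \<in> tensor_values R p D \<Longrightarrow> s \<in> tensor_values R p D \<Longrightarrow> r \<oplus> s \<in> tensor_values R p D"
  "\<And>r. r \<in> tensor_values R p D \<Longrightarrow> \<ominus> r \<in> tensor_values R p D"
  by (cases "\<forall>i<p. D i = carrier R"; simp add: tensor_values_def)+

lemma koszul_component_group:
  shows "abelian_group (koszul_component R p \<nu>)"
    and "r \<in> koszul_values R p \<nu> \<Longrightarrow> \<ominus>\<^bsub>koszul_component R p \<nu>\<^esub> koszul_fibre R p \<nu> r = koszul_fibre R p \<nu> (\<ominus> r)"
    and "\<lbrakk>finite A; g \<in> A \<rightarrow> koszul_values R p \<nu>\<rbrakk> \<Longrightarrow>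
      finsum (koszul_component R p \<nu>) (\<lambda>i. koszul_fibre R p \<nu> (g i)) A = koszul_fibre R p \<nu> (finsum R g A)"
proof -
  note image = image_abelian_group[where E = "koszul_values R p \<nu>"
    and \<phi> = "koszul_fibre R p \<nu>" and M = "koszul_component R p \<nu>"]
  note facts = values_subgroup koszul_component_carrier koszul_component_zero koszul_component_add
  show "abelian_group (koszul_component R p \<nu>)" by (rule image(1)) (fact facts | assumption)+
  show "\<ominus>\<^bsub>koszul_component R p \<nu>\<^esub> koszul_fibre R p \<nu> r = koszul_fibre R p \<nu> (\<ominus> r)"
    if "r \<in> koszul_values R p \<nu>" by (rule image(2)) (fact facts that | assumption)+
  show "finsum (koszul_component R p \<nu>) (\<lambda>i. koszul_fibre R p \<nu> (g i)) A = koszul_fibre R p \<nu> (finsum R g A)"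
    if "finite A" "g \<in> A \<rightarrow> koszul_values R p \<nu>" by (rule image(3)) (fact facts that | assumption)+
qed

lemma koszul_fibre_inj:
  "\<lbrakk>koszul_fibre R p \<nu> r = koszul_fibre R p \<nu> s; r \<in> koszul_values R p \<nu>\<rbrakk> \<Longrightarrow> r = s"
  by (rule tensor_of_ideals.fibre_inj[OF koszul_tensor_of_ideals])

lemma tensor_component_map_koszul:
  assumes c: "\<And>i. i < p \<Longrightarrow> c i \<in> carrier R"
    and h: "\<And>i u. \<lbrakk>i < p; u \<in> koszul_dom R (\<nu> i)\<rbrakk> \<Longrightarrow> h i u = c i \<otimes> u \<and> c i \<otimes> u \<in> koszul_dom R (\<mu> i)"
    and r: "r \<in> koszul_values R p \<nu>"
  shows "tensor_component_map R p (\<lambda>i. koszul1 R (a i)) (\<lambda>i. koszul1 R (b i)) \<nu> \<mu> h (koszul_fibre R p \<nu> r)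
      = koszul_fibre R p \<mu> (finprod R c {..<p} \<otimes> r)"
    and "finprod R c {..<p} \<otimes> r \<in> koszul_values R p \<mu>"
  unfolding tensor_component_map_def cobj_koszul1
  using tensor_map_fibre[OF koszul_tensor_of_ideals koszul_tensor_of_ideals c h r] by simp_all

lemma realize_closed:
  assumes f: "f \<in> chains (length as) (- n)"
  shows "realize R (length as) n f \<in> carrier (cobj (koszul R as) n)"
proof -
  let ?p = "length as"
  have fc: "f l \<in> carrier R" for l using f chains_carr by blast
  let ?B = "{..<?p} \<rightarrow>\<^sub>E {-1, 0 :: int}"
  have "realize R ?p n f \<nu> \<in> carrier (koszul_component R ?p \<nu>)" if "\<nu> \<in> multidegrees ?p n" for \<nu>
    using that coefficient_values[of f] fc by (simp add: realize_def koszul_component_carrier)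
  moreover have "{\<nu> \<in> multidegrees ?p n. realize R ?p n f \<nu> \<noteq> \<zero>\<^bsub>koszul_component R ?p \<nu>\<^esub>} \<subseteq> ?B"
  proof
    fix \<nu> assume "\<nu> \<in> {\<nu> \<in> multidegrees ?p n. realize R ?p n f \<nu> \<noteq> \<zero>\<^bsub>koszul_component R ?p \<nu>\<^esub>}"
    then have nu: "\<nu> \<in> multidegrees ?p n" and ne: "realize R ?p n f \<nu> \<noteq> koszul_fibre R ?p \<nu> \<zero>"
      unfolding koszul_component_zero by blast+
    have "realize R ?p n f \<nu> = koszul_fibre R ?p \<nu> (coefficient R ?p f \<nu>)" using nu by (simp add: realize_def)
    then have "coefficient R ?p f \<nu> \<noteq> \<zero>" using ne by metis
    then have "\<forall>i<?p. \<nu> i = -1 \<or> \<nu> i = 0" by (rule contrapos_np) (rule coefficient_other)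
    moreover have "\<nu> \<in> extensional {..<?p}" using nu by (simp add: multidegrees_def PiE_def)
    ultimately show "\<nu> \<in> ?B" by (simp add: PiE_iff)
  qed
  then have "finite {\<nu> \<in> multidegrees ?p n. realize R ?p n f \<nu> \<noteq> \<zero>\<^bsub>koszul_component R ?p \<nu>\<^esub>}"
    by (rule finite_subset) (simp add: finite_PiE)
  ultimately show ?thesis
    by (simp add: cobj_koszul direct_sum_module_def PiE_iff) (simp add: realize_def)
qed

lemma realize_surj:
  assumes t: "t \<in> carrier (cobj (koszul R as) n)"
  shows "\<exists>f\<in>chains (length as) (- n). t = realize R (length as) n f"
proof -
  let ?p = "length as"
  have t': "t \<in> (\<Pi>\<^sub>E \<nu>\<in>multidegrees ?p n. carrier (koszul_component R ?p \<nu>))"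
    using t by (auto simp: cobj_koszul direct_sum_module_def)
  have "\<exists>r\<in>koszul_values R ?p \<nu>. t \<nu> = koszul_fibre R ?p \<nu> r" if "\<nu> \<in> multidegrees ?p n" for \<nu>
    using PiE_mem[OF t' that] by (auto simp: koszul_component_carrier)
  then obtain r where r: "\<And>\<nu>. \<nu> \<in> multidegrees ?p n \<Longrightarrow> r \<nu> \<in> koszul_values R ?p \<nu>"
    "\<And>\<nu>. \<nu> \<in> multidegrees ?p n \<Longrightarrow> t \<nu> = koszul_fibre R ?p \<nu> (r \<nu>)" by metis
  define f where "f l = (if length l = ?p \<and> int (count_list l True) = - n then r (word_degree l) else \<zero>)" for l
  have f: "f \<in> chains ?p (- n)"
  proof (rule chainsI)
    show "f l \<in> carrier R" for l
      using r(1)[OF word_degree_multidegrees, of l] values_subgroup(1) by (auto simp: f_def)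
  qed (auto simp: f_def split: if_splits)
  have "t = realize R ?p n f"
  proof (rule PiE_ext[OF t'])
    show "realize R ?p n f \<in> (\<Pi>\<^sub>E \<nu>\<in>multidegrees ?p n. carrier (koszul_component R ?p \<nu>))"
      using realize_closed[OF f] by (auto simp: cobj_koszul direct_sum_module_def)
    fix \<nu> assume nu: "\<nu> \<in> multidegrees ?p n"
    have "coefficient R ?p f \<nu> = r \<nu>"
    proof (cases "\<forall>i<?p. \<nu> i = -1 \<or> \<nu> i = 0")
      case True
      have "int (count_list (degree_word ?p \<nu>) True) = - n"
        using sum_degree_word[of ?p \<nu>] True nu by (simp add: multidegrees_def)
      moreover have "word_degree (degree_word ?p \<nu>) = \<nu>"
        by (rule word_degree_degree_word) (use nu True in \<open>auto simp: multidegrees_def PiE_def\<close>)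
      ultimately show ?thesis unfolding coefficient_binary[OF True] by (simp add: f_def)
    next
      case False
      then obtain i where i: "i < ?p" "\<not> (\<nu> i = -1 \<or> \<nu> i = 0)" by blast
      have "koszul_values R ?p \<nu> \<subseteq> {\<zero>}"
      proof (cases "carrier R = {\<zero>}")
        case False
        then show ?thesis using i by (auto simp: tensor_values_def koszul_dom_def)
      qed (use values_subgroup(1) in auto)
      then show ?thesis unfolding coefficient_other[OF False] using r(1)[OF nu] by auto
    qed
    then show "t \<nu> = realize R ?p n f \<nu>" using r(2)[OF nu] nu by (simp add: realize_def)
  qed
  then show ?thesis using f by blast
qed

lemma cobj_eq_image: "carrier (cobj (koszul R as) n) = realize R (length as) n ` chains (length as) (- n)"
  using realize_closed realize_surj by blast

lemma realize_inj:
  assumes f: "f \<in> chains p (- n)" and g: "g \<in> chains p (- n)" and e: "realize R p n f = realize R p n g"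
  shows "f = g"
proof
  fix l
  show "f l = g l"
  proof (cases "length l = p \<and> int (count_list l True) = - n")
    case True
    then have m: "word_degree l \<in> multidegrees p n" by (simp add: word_degree_multidegrees)
    have "koszul_fibre R p (word_degree l) (coefficient R p f (word_degree l)) =
      koszul_fibre R p (word_degree l) (coefficient R p g (word_degree l))"
      using fun_cong[OF e, of "word_degree l"] m by (simp add: realize_def)
    then have "coefficient R p f (word_degree l) = coefficient R p g (word_degree l)"
      by (rule koszul_fibre_inj) (rule coefficient_values, rule chains_carr[OF f])
    then show ?thesis using True by (simp add: coefficient_word_degree)
  next
    case False then show ?thesis using chains_supp[OF f, of l] chains_supp[OF g, of l] by auto
  qed
qed

lemma realize_zero: "\<zero>\<^bsub>cobj (koszul R as) n\<^esub> = realize R (length as) n (\<lambda>_. \<zero>)"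
  by (auto simp: cobj_koszul direct_sum_module_def realize_def koszul_component_zero coefficient_def intro!: restrict_ext)

lemma realize_add:
  assumes f: "f \<in> chains (length as) (- n)" and g: "g \<in> chains (length as) (- n)"
  shows "realize R (length as) n f \<oplus>\<^bsub>cobj (koszul R as) n\<^esub> realize R (length as) n g
    = realize R (length as) n (\<lambda>l. f l \<oplus> g l)"
proof -
  have "coefficient R (length as) (\<lambda>l. f l \<oplus> g l) \<nu> = coefficient R (length as) f \<nu> \<oplus> coefficient R (length as) g \<nu>" for \<nu>
  proof (cases "\<forall>i<length as. \<nu> i = -1 \<or> \<nu> i = 0")
    case True show ?thesis by (simp only: coefficient_binary[OF True])
  next
    case False show ?thesis by (simp only: coefficient_other[OF False] l_zero zero_closed)
  qed
  then show ?thesis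
    using coefficient_values[of f "length as"] coefficient_values[of g "length as"] chains_carr[OF f] chains_carr[OF g]
    by (auto simp: cobj_koszul direct_sum_module_def realize_def koszul_component_add intro!: restrict_ext)
qed

text \<open>
  In multidegree \<open>\<mu>\<close> the summand with index \<open>i\<close> comes from the
  multidegree with \<open>\<mu> i\<close> lowered by 1. It is nonzero only for \<open>\<mu> i =
  0\<close>, and then it is the summand of the explicit formula for \<open>kdiff\<close> in which
  slot \<open>i\<close> is set to \<open>True\<close>.
\<close>

lemma realize_cdiff:
  assumes bs: "set bs \<subseteq> carrier R" and f: "f \<in> chains (length bs) (- n)"
  shows "cdiff (koszul R bs) n (realize R (length bs) n f) = realize R (length bs) (n + 1) (kdiff R bs f)"
proof -
  let ?p = "length bs" and ?C = "\<lambda>i. koszul1 R (bs ! i)"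
  have fc: "f l \<in> carrier R" for l using f chains_carr by blast
  have bc: "bs ! i \<in> carrier R" if "i < ?p" for i using bs that by auto
  define body where "body \<mu> i = (let \<nu> = \<mu>(i := \<mu> i - 1);
              y = tensor_component_map R ?p ?C ?C \<nu> \<mu> (\<lambda>j. if j = i then cdiff (?C i) (\<nu> i) else id) (realize R ?p n f \<nu>)
          in if even (\<Sum>j<i. \<nu> j) then y else \<ominus>\<^bsub>koszul_component R ?p \<mu>\<^esub> y)" for \<mu> i
  have "finsum (koszul_component R ?p \<mu>) (body \<mu>) {..<?p} = koszul_fibre R ?p \<mu> (coefficient R ?p (kdiff R bs f) \<mu>)"
    if mu: "\<mu> \<in> multidegrees ?p (n + 1)" for \<mu>
  proof -
    define \<nu> where "\<nu> i = \<mu>(i := \<mu> i - 1)" for i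
    define c where "c i = (if \<mu> i = 0 then bs ! i else \<zero>)" for i
    define g where "g i = (if even (\<Sum>j<i. \<mu> j) then c i \<otimes> coefficient R ?p f (\<nu> i) else \<ominus> (c i \<otimes> coefficient R ?p f (\<nu> i)))" for i
    have cc: "c i \<in> carrier R" if "i < ?p" for i using bc that by (simp add: c_def)
    have cf: "coefficient R ?p f \<kappa> \<in> koszul_values R ?p \<kappa>" for \<kappa> by (rule coefficient_values) (rule fc)
    have cfc: "coefficient R ?p f \<kappa> \<in> carrier R" for \<kappa> using cf values_subgroup(1) by blast
    have g: "body \<mu> i = koszul_fibre R ?p \<mu> (g i) \<and> g i \<in> koszul_values R ?p \<mu>" if i: "i < ?p" for i
    proof -
      let ?y = "tensor_component_map R ?p ?C ?C (\<nu> i) \<mu> (\<lambda>j. if j = i then cdiff (?C i) (\<nu> i i) else id) (realize R ?p n f (\<nu> i))"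
      let ?cc = "\<lambda>j. if j = i then c i else \<one>"
      have sm: "(\<Sum>j<?p. \<nu> i j) = (\<Sum>j<?p. \<mu> j) - 1"
      proof -
        have "(\<Sum>j<?p. \<nu> i j) = (\<Sum>j<?p. \<mu> j - (if j = i then 1 else 0))" by (rule sum.cong) (auto simp: \<nu>_def)
        also have "\<dots> = (\<Sum>j<?p. \<mu> j) - 1" using i by (simp add: sum_subtractf)
        finally show ?thesis .
      qed
      have nu: "\<nu> i \<in> multidegrees ?p n"
        using mu i sm by (auto simp: multidegrees_def \<nu>_def PiE_def extensional_def)
      have P: "finprod R ?cc {..<?p} = c i"
        using finprod_singleton_swap[of i "{..<?p}" "\<lambda>_. c i"] i cc by auto
      have h: "(if j = i then cdiff (?C i) (\<nu> i i) else id) u = ?cc j \<otimes> u \<and> ?cc j \<otimes> u \<in> koszul_dom R (\<mu> j)"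
        if j: "j < ?p" and u: "u \<in> koszul_dom R (\<nu> i j)" for j u
      proof (cases "j = i")
        case True
        have uc: "u \<in> carrier R" using u by (auto simp: koszul_dom_def split: if_splits)
        show ?thesis
        proof (cases "\<mu> i = 0")
          case m: True
          then show ?thesis using True uc bc[OF i] by (simp add: \<nu>_def koszul1_def c_def koszul_dom_def)
        next
          case m: False
          then have "\<nu> i i \<noteq> -1" by (simp add: \<nu>_def)
          then show ?thesis using True uc m by (simp add: koszul1_def c_def koszul_dom_def)
        qed
      next
        case False
        then have "\<nu> i j = \<mu> j" by (simp add: \<nu>_def)
        moreover have "u \<in> carrier R" using u by (auto simp: koszul_dom_def split: if_splits)
        ultimately show ?thesis using False u by simp
      qed
      have "?y = tensor_component_map R ?p ?C ?C (\<nu> i) \<mu> (\<lambda>j. if j = i then cdiff (?C i) (\<nu> i i) else id)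
          (koszul_fibre R ?p (\<nu> i) (coefficient R ?p f (\<nu> i)))" using nu by (simp add: realize_def)
      also have "\<dots> = koszul_fibre R ?p \<mu> (finprod R ?cc {..<?p} \<otimes> coefficient R ?p f (\<nu> i))"
        by (rule tensor_component_map_koszul(1)[OF _ h cf]) (use cc i in auto)
      finally have y: "?y = koszul_fibre R ?p \<mu> (c i \<otimes> coefficient R ?p f (\<nu> i))" by (simp only: P)
      have "finprod R ?cc {..<?p} \<otimes> coefficient R ?p f (\<nu> i) \<in> koszul_values R ?p \<mu>"
        by (rule tensor_component_map_koszul(2)[OF _ h cf]) (use cc i in auto)
      then have v: "c i \<otimes> coefficient R ?p f (\<nu> i) \<in> koszul_values R ?p \<mu>" by (simp only: P)
      have "(\<Sum>j<i. \<nu> i j) = (\<Sum>j<i. \<mu> j)" by (rule sum.cong) (auto simp: \<nu>_def)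
      then have "body \<mu> i = (if even (\<Sum>j<i. \<mu> j) then ?y else \<ominus>\<^bsub>koszul_component R ?p \<mu>\<^esub> ?y)"
        unfolding body_def Let_def \<nu>_def by simp
      then show ?thesis using koszul_component_group(2)[OF v] v values_subgroup(4)
        unfolding y g_def by auto
    qed
    interpret T: abelian_group "koszul_component R ?p \<mu>" by (rule koszul_component_group(1))
    have "finsum (koszul_component R ?p \<mu>) (body \<mu>) {..<?p} =
      finsum (koszul_component R ?p \<mu>) (\<lambda>i. koszul_fibre R ?p \<mu> (g i)) {..<?p}"
      by (rule T.finsum_cong') (use g koszul_component_carrier in auto)
    also have "\<dots> = koszul_fibre R ?p \<mu> (finsum R g {..<?p})"
      by (rule koszul_component_group(3)) (use g in auto)
    also have "finsum R g {..<?p} = coefficient R ?p (kdiff R bs f) \<mu>"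
    proof (cases "\<forall>i<?p. \<mu> i = -1 \<or> \<mu> i = 0")
      case True
      let ?l = "degree_word ?p \<mu>"
      let ?s = "\<lambda>i. if ?l ! i then \<zero> else if even (count_list (take i ?l) True) then bs ! i \<otimes> f (?l[i := True]) else \<ominus> (bs ! i \<otimes> f (?l[i := True]))"
      have "finsum R g {..<?p} = (\<Oplus>i\<in>{..<?p}. ?s i)"
      proof (rule finsum_cong')
        show "?s \<in> {..<?p} \<rightarrow> carrier R" using bc fc by auto
        fix i assume "i \<in> {..<?p}"
        then have i: "i < ?p" by simp
        show "g i = ?s i"
        proof (cases "\<mu> i = -1")
          case m: True
          then show ?thesis using i cfc[of "\<nu> i"] by (simp add: g_def c_def)
        next
          case m: False
          then have m0: "\<mu> i = 0" using True i by auto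
          \<comment> \<open>the two sign conventions agree as all these degrees are \<open>-1\<close> or \<open>0\<close>\<close>
          have ev: "even (\<Sum>j<i. \<mu> j) \<longleftrightarrow> even (count_list (take i ?l) True)"
            using sum_degree_word[of i \<mu>] True i by (simp add: take_degree_word)
          have "\<forall>j<?p. \<nu> i j = -1 \<or> \<nu> i j = 0" using True m0 by (auto simp: \<nu>_def)
          note coefficient_binary[OF this]
          moreover have "degree_word ?p (\<nu> i) = ?l[i := True]"
            by (rule nth_equalityI) (use m0 in \<open>auto simp: \<nu>_def nth_list_update\<close>)
          ultimately have "coefficient R ?p f (\<nu> i) = f (?l[i := True])" by metis
          then show ?thesis using i m m0 ev by (simp add: g_def c_def)
        qed
      qed simp
      also have "\<dots> = kdiff R bs f ?l" by (rule kdiff_explicit[symmetric]) (use fc bs in auto)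
      finally show ?thesis unfolding coefficient_binary[OF True] .
    next
      case False
      then obtain j where j: "j < ?p" "\<not> (\<mu> j = -1 \<or> \<mu> j = 0)" by blast
      have "g i = \<zero>" if i: "i < ?p" for i
      proof (cases "\<mu> i = 0")
        case True
        then have "\<nu> i j = \<mu> j" using j by (auto simp: \<nu>_def)
        then have "\<not> (\<forall>j<?p. \<nu> i j = -1 \<or> \<nu> i j = 0)" using j by metis
        then have "coefficient R ?p f (\<nu> i) = \<zero>" by (rule coefficient_other)
        then show ?thesis using cc[OF i] by (simp add: g_def)
      next
        case m: False
        then show ?thesis using cfc by (simp add: g_def c_def)
      qed
      then have "finsum R g {..<?p} = \<zero>" by (intro add.finprod_one_eqI) auto
      then show ?thesis unfolding coefficient_other[OF False] .
    qed
    finally show ?thesis .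
  qed
  note comp = this
  have "cdiff (koszul R bs) n (realize R ?p n f) =
    (\<lambda>\<mu>\<in>multidegrees ?p (n + 1). finsum (koszul_component R ?p \<mu>) (body \<mu>) {..<?p})"
    unfolding koszul_def tensor_complex_def tensor_component_koszul body_def[abs_def]
    by (simp only: cochain_complex.select_convs)
  also have "\<dots> = realize R ?p (n + 1) (kdiff R bs f)"
    unfolding realize_def[of R ?p "n + 1"] by (rule restrict_ext) (rule comp)
  finally show ?thesis .
qed

lemma realize_transition:
  assumes as: "set as \<subseteq> carrier R" and f: "f \<in> chains (length as) (- n)"
  shows "koszul_transition R as j1 j0 n (realize R (length as) n f) =
    realize R (length as) n (kscale R (seq_power R as (j1 - j0)) f)"
proof -
  let ?p = "length as"
  have fc: "f l \<in> carrier R" for l using f chains_carr by blast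
  have ac: "as ! i \<in> carrier R" if "i < ?p" for i using as that by auto
  have "tensor_component_map R ?p (\<lambda>i. koszul1 R (seq_power R as j1 ! i)) (\<lambda>i. koszul1 R (seq_power R as j0 ! i)) \<nu> \<nu>
      (\<lambda>i. koszul1_transition R (as ! i) j1 j0 (\<nu> i)) (realize R ?p n f \<nu>) =
    koszul_fibre R ?p \<nu> (coefficient R ?p (kscale R (seq_power R as (j1 - j0)) f) \<nu>)"
    if nu: "\<nu> \<in> multidegrees ?p n" for \<nu>
  proof -
    define c where "c i = (if \<nu> i = 0 then \<one> else if \<nu> i = -1 then as ! i [^] (j1 - j0) else \<zero>)" for i
    have cc: "c i \<in> carrier R" if "i < ?p" for i using ac that by (simp add: c_def)
    have cf: "coefficient R ?p f \<nu> \<in> koszul_values R ?p \<nu>" by (rule coefficient_values) (rule fc)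
    have h: "koszul1_transition R (as ! i) j1 j0 (\<nu> i) u = c i \<otimes> u \<and> c i \<otimes> u \<in> koszul_dom R (\<nu> i)"
      if i: "i < ?p" and u: "u \<in> koszul_dom R (\<nu> i)" for i u
    proof -
      have uc: "u \<in> carrier R" using u by (auto simp: koszul_dom_def split: if_splits)
      show ?thesis using uc ac[OF i] u by (auto simp: koszul1_transition_def c_def koszul_dom_def)
    qed
    have "tensor_component_map R ?p (\<lambda>i. koszul1 R (seq_power R as j1 ! i)) (\<lambda>i. koszul1 R (seq_power R as j0 ! i)) \<nu> \<nu>
      (\<lambda>i. koszul1_transition R (as ! i) j1 j0 (\<nu> i)) (koszul_fibre R ?p \<nu> (coefficient R ?p f \<nu>))
      = koszul_fibre R ?p \<nu> (finprod R c {..<?p} \<otimes> coefficient R ?p f \<nu>)"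
      by (rule tensor_component_map_koszul(1)[OF cc h cf])
    also have "finprod R c {..<?p} \<otimes> coefficient R ?p f \<nu> = coefficient R ?p (kscale R (seq_power R as (j1 - j0)) f) \<nu>"
    proof (cases "\<forall>i<?p. \<nu> i = -1 \<or> \<nu> i = 0")
      case True
      let ?bs = "seq_power R as (j1 - j0)" and ?l = "degree_word ?p \<nu>"
      have "kscale R ?bs f ?l = finprod R (\<lambda>i. if ?l ! i then ?bs ! i else \<one>) {..<length ?bs} \<otimes> f ?l"
        by (rule kscale_explicit) (use fc seq_power_carrier[OF as] in auto)
      also have "finprod R (\<lambda>i. if ?l ! i then ?bs ! i else \<one>) {..<length ?bs} = finprod R c {..<?p}"
        by (rule finprod_cong') (use True cc in \<open>auto simp: c_def seq_power_def\<close>)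
      finally show ?thesis unfolding coefficient_binary[OF True] by (rule sym)
    next
      case False
      have "finprod R c {..<?p} \<in> carrier R" by (rule finprod_closed) (use cc in auto)
      then show ?thesis unfolding coefficient_other[OF False] by (rule r_null)
    qed
    finally show ?thesis using nu by (simp add: realize_def)
  qed
  then show ?thesis
    unfolding realize_def[of R ?p n "kscale R (seq_power R as (j1 - j0)) f"]
    unfolding koszul_transition_def tensor_complex_map_def by (intro restrict_ext)
qed

section \<open>Weak proregularity in coordinates\<close>

lemma koszul_cocycles:
  assumes "set bs \<subseteq> carrier R"
  shows "cocycles (koszul R bs) n = realize R (length bs) n ` {f \<in> chains (length bs) (- n). kdiff R bs f = (\<lambda>_. \<zero>)}"
proof -
  have "cdiff (koszul R bs) n (realize R (length bs) n f) = \<zero>\<^bsub>cobj (koszul R bs) (n + 1)\<^esub> \<longleftrightarrow> kdiff R bs f = (\<lambda>_. \<zero>)"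
    if f: "f \<in> chains (length bs) (- n)" for f
  proof -
    have "kdiff R bs f \<in> chains (length bs) (- (n + 1))" using kdiff_chains[OF f assms] by simp
    note inj = realize_inj[OF this chains_zero]
    show ?thesis unfolding realize_cdiff[OF assms f] realize_zero by (rule iffI, erule inj, erule arg_cong)
  qed
  then show ?thesis unfolding cocycles_def a_kernel_def' cobj_eq_image by blast
qed

lemma koszul_coboundaries:
  assumes "set bs \<subseteq> carrier R"
  shows "coboundaries (koszul R bs) n = realize R (length bs) n ` kdiff R bs ` chains (length bs) (- n + 1)"
proof -
  have "cdiff (koszul R bs) (n - 1) (realize R (length bs) (n - 1) f) = realize R (length bs) n (kdiff R bs f)"
    if "f \<in> chains (length bs) (- n + 1)" for f
    using realize_cdiff[OF assms, of f "n - 1"] that by simp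
  moreover have "- (n - 1) = - n + 1" by simp
  ultimately show ?thesis
    unfolding coboundaries_def cobj_eq_image by (simp add: image_image cong: image_cong)
qed

lemma realize_add_coboundary:
  assumes bs: "set bs \<subseteq> carrier R" and g: "g \<in> chains (length bs) (- n + 1)" and h: "h \<in> chains (length bs) (- n + 1)"
  shows "realize R (length bs) n (kdiff R bs g) \<oplus>\<^bsub>cobj (koszul R bs) n\<^esub> realize R (length bs) n (kdiff R bs h)
    = realize R (length bs) n (kdiff R bs (\<lambda>l. g l \<oplus> h l))"
proof -
  have c: "kdiff R bs g \<in> chains (length bs) (- n)" "kdiff R bs h \<in> chains (length bs) (- n)"
    using kdiff_chains[OF g bs] kdiff_chains[OF h bs] by simp_all
  have "kdiff R bs (\<lambda>l. g l \<oplus> h l) = (\<lambda>l. kdiff R bs g l \<oplus> kdiff R bs h l)"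
    by (rule ext, rule kdiff_add[OF chains_carr[OF g] chains_carr[OF h] bs])
  then show ?thesis using realize_add[OF c] by simp
qed

text \<open>
  A class is zero exactly when its coset is the group of coboundaries. The transition maps the
  coset of a cycle \<open>f\<close> into the coset of the scaled \<open>f\<close>, as it commutes
  with the boundaries.
\<close>

lemma cohomology_pro_zero_iff:
  assumes as: "set as \<subseteq> carrier R"
  shows "pro_zero (\<lambda>j. cohomology (koszul R (seq_power R as j)) i)
        (\<lambda>j1 j0. cohomology_map (koszul R (seq_power R as j0)) (koszul_transition R as j1 j0) i) \<longleftrightarrow>
    (\<forall>j0\<ge>1. \<exists>j1\<ge>j0. \<forall>f\<in>chains (length as) (- i).
        kdiff R (seq_power R as j1) f = (\<lambda>_. \<zero>) \<longrightarrow>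
        (\<exists>h\<in>chains (length as) (- i + 1).
           kscale R (seq_power R as (j1 - j0)) f = kdiff R (seq_power R as j0) h))"
proof -
  let ?p = "length as"
  let ?K = "\<lambda>j. koszul R (seq_power R as j)"
  let ?D = "\<lambda>j. kdiff R (seq_power R as j)"
  let ?\<Phi> = "realize R ?p i"
  define B where "B j = ?\<Phi> ` ?D j ` chains ?p (- i + 1)" for j
  have sj: "set (seq_power R as j) \<subseteq> carrier R" for j by (rule seq_power_carrier[OF as])
  have M: "cobj (?K j) n = cobj (?K 0) n" for j n by (simp add: cobj_koszul)
  let ?M = "cobj (?K 0) i"
  have cob: "coboundaries (?K j) i = B j" for j
    using koszul_coboundaries[OF sj, of j i] by (simp add: B_def)
  have coc: "cocycles (?K j) i = ?\<Phi> ` {f \<in> chains ?p (- i). ?D j f = (\<lambda>_. \<zero>)}" for j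
    using koszul_cocycles[OF sj, of j i] by simp
  have add: "?\<Phi> f \<oplus>\<^bsub>?M\<^esub> ?\<Phi> g = ?\<Phi> (\<lambda>l. f l \<oplus> g l)" if "f \<in> chains ?p (- i)" "g \<in> chains ?p (- i)" for f g
    using realize_add[of f "seq_power R as 0" i g] that by simp
  have Dch: "?D j h \<in> chains ?p (- i)" if "h \<in> chains ?p (- i + 1)" for j h
    using kdiff_chains[of h "seq_power R as j" "- i + 1"] that sj by simp
  have Dz: "?D j (\<lambda>_. \<zero>) = (\<lambda>_. \<zero>)" for j using kdiff_zero[OF sj] by blast
  have Sch: "kscale R (seq_power R as k) f \<in> chains ?p t" if "f \<in> chains ?p t" for k f t
    using kscale_chains[of f "seq_power R as k" t] that sj by simp
  have trans: "koszul_transition R as j1 j0 i (?\<Phi> f) = ?\<Phi> (kscale R (seq_power R as (j1 - j0)) f)"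
    if "f \<in> chains ?p (- i)" for f j1 j0
    by (rule realize_transition[OF as that])
  have carr: "carrier (cohomology (?K j) i) = {{b \<oplus>\<^bsub>?M\<^esub> z | b. b \<in> B j} | z. z \<in> cocycles (?K j) i}" for j
    unfolding cohomology_def quotient_module_def cob
    by (auto simp: A_RCOSETS_def RCOSETS_def r_coset_def M[of j])
  have zero: "\<zero>\<^bsub>cohomology (?K j) i\<^esub> = B j" for j
    by (simp add: cohomology_def quotient_module_def cob)
  have cmap: "cohomology_map (?K j0) (koszul_transition R as j1 j0) i X
     = {b \<oplus>\<^bsub>?M\<^esub> y | b y. b \<in> B j0 \<and> y \<in> koszul_transition R as j1 j0 i ` X}" for j1 j0 X
    by (auto simp: cohomology_map_def quotient_map_def cob set_add_def set_mult_def M[of j0])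
  have "(\<forall>X\<in>carrier (cohomology (?K j1) i). cohomology_map (?K j0) (koszul_transition R as j1 j0) i X = \<zero>\<^bsub>cohomology (?K j0) i\<^esub>)
    \<longleftrightarrow> (\<forall>f\<in>chains ?p (- i). ?D j1 f = (\<lambda>_. \<zero>) \<longrightarrow> (\<exists>h\<in>chains ?p (- i + 1). kscale R (seq_power R as (j1 - j0)) f = ?D j0 h))"
    (is "?L \<longleftrightarrow> ?Rhs") if j: "j0 \<le> j1" for j0 j1
  proof
    assume L: ?L
    show ?Rhs
    proof (intro ballI impI)
      fix f assume f: "f \<in> chains ?p (- i)" and Df: "?D j1 f = (\<lambda>_. \<zero>)"
      let ?X = "{b \<oplus>\<^bsub>?M\<^esub> ?\<Phi> f | b. b \<in> B j1}"
      have X: "?X \<in> carrier (cohomology (?K j1) i)" unfolding carr coc using f Df by blast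
      have eq: "{b \<oplus>\<^bsub>?M\<^esub> y | b y. b \<in> B j0 \<and> y \<in> koszul_transition R as j1 j0 i ` ?X} = B j0"
        using L[rule_format, OF X] unfolding cmap zero .
      have zB: "?\<Phi> (\<lambda>_. \<zero>) \<in> B j" for j
        unfolding B_def using imageI[OF imageI[OF chains_zero], of ?\<Phi> "?D j" ?p "- i + 1"] by (simp add: Dz)
      have "?\<Phi> (\<lambda>_. \<zero>) \<oplus>\<^bsub>?M\<^esub> ?\<Phi> f = ?\<Phi> f"
        using add[OF chains_zero f] chains_carr[OF f] by simp
      then have "?\<Phi> f \<in> ?X" using zB[of j1] by force
      then have y: "?\<Phi> (kscale R (seq_power R as (j1 - j0)) f) \<in> koszul_transition R as j1 j0 i ` ?X"
        using trans[OF f, symmetric] by blast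
      have zsum: "?\<Phi> (\<lambda>_. \<zero>) \<oplus>\<^bsub>?M\<^esub> ?\<Phi> (kscale R (seq_power R as (j1 - j0)) f) = ?\<Phi> (kscale R (seq_power R as (j1 - j0)) f)"
        using add[OF chains_zero Sch[OF f]] chains_carr[OF Sch[OF f]] by simp
      have "?\<Phi> (kscale R (seq_power R as (j1 - j0)) f) \<in> B j0"
      proof -
        have "?\<Phi> (\<lambda>_. \<zero>) \<oplus>\<^bsub>?M\<^esub> ?\<Phi> (kscale R (seq_power R as (j1 - j0)) f)
          \<in> {b \<oplus>\<^bsub>?M\<^esub> y | b y. b \<in> B j0 \<and> y \<in> koszul_transition R as j1 j0 i ` ?X}"
          using zB[of j0] y by blast
        then show ?thesis unfolding eq zsum .
      qed
      then obtain h where h: "h \<in> chains ?p (- i + 1)" "?\<Phi> (kscale R (seq_power R as (j1 - j0)) f) = ?\<Phi> (?D j0 h)"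
        unfolding B_def by blast
      then show "\<exists>h\<in>chains ?p (- i + 1). kscale R (seq_power R as (j1 - j0)) f = ?D j0 h"
        using realize_inj[OF Sch[OF f] Dch[OF h(1)] h(2)] by blast
    qed
  next
    assume Rh: ?Rhs
    show ?L
    proof
      fix X assume "X \<in> carrier (cohomology (?K j1) i)"
      then obtain f where f: "f \<in> chains ?p (- i)" "?D j1 f = (\<lambda>_. \<zero>)" and X: "X = {b \<oplus>\<^bsub>?M\<^esub> ?\<Phi> f | b. b \<in> B j1}"
        unfolding carr coc by blast
      obtain h0 where h0: "h0 \<in> chains ?p (- i + 1)" "kscale R (seq_power R as (j1 - j0)) f = ?D j0 h0"
        using Rh f by blast
      let ?S = "kscale R (seq_power R as (j1 - j0))"
      have XT: "koszul_transition R as j1 j0 i ` X \<subseteq> B j0"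
      proof
        fix y assume "y \<in> koszul_transition R as j1 j0 i ` X"
        then obtain h where h: "h \<in> chains ?p (- i + 1)" "y = koszul_transition R as j1 j0 i (?\<Phi> (?D j1 h) \<oplus>\<^bsub>?M\<^esub> ?\<Phi> f)"
          unfolding X B_def by blast
        have hc: "h l \<in> carrier R" for l using h chains_carr by blast
        have y: "y = ?\<Phi> (?S (\<lambda>l. ?D j1 h l \<oplus> f l))"
          unfolding h(2) add[OF Dch[OF h(1)] f(1)] by (rule trans[OF chains_add[OF Dch[OF h(1)] f(1)]])
        have "?S (?D j1 h) l = ?D j0 (?S h) l" for l
          using kdiff_kscale[where l = l, OF hc sj[of "j1 - j0"] sj[of j0]] map2_seq_power[OF as, of j0 "j1 - j0"] j by simp
        then have "?S (\<lambda>l. ?D j1 h l \<oplus> f l) = ?D j0 (\<lambda>l. ?S h l \<oplus> h0 l)"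
          using chains_carr[OF Dch[OF h(1)]] chains_carr[OF f(1)] chains_carr[OF Sch[OF h(1)]] chains_carr[OF h0(1)] sj
          by (intro ext) (simp add: kscale_add kdiff_add h0(2))
        then show "y \<in> B j0" unfolding y B_def using chains_add[OF Sch[OF h(1)] h0(1)] by simp
      qed
      have addB: "?\<Phi> (?D j0 g) \<oplus>\<^bsub>?M\<^esub> ?\<Phi> (?D j0 h) = ?\<Phi> (?D j0 (\<lambda>l. g l \<oplus> h l))"
        if "g \<in> chains ?p (- i + 1)" "h \<in> chains ?p (- i + 1)" for g h
        using realize_add_coboundary[OF sj, of g j0 i h] that by (simp add: M[of j0])
      have "{b \<oplus>\<^bsub>?M\<^esub> y | b y. b \<in> B j0 \<and> y \<in> koszul_transition R as j1 j0 i ` X} = B j0"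
      proof (intro equalityI subsetI)
        fix z assume "z \<in> {b \<oplus>\<^bsub>?M\<^esub> y | b y. b \<in> B j0 \<and> y \<in> koszul_transition R as j1 j0 i ` X}"
        then obtain b y where bz: "b \<in> B j0" "y \<in> koszul_transition R as j1 j0 i ` X" "z = b \<oplus>\<^bsub>?M\<^esub> y"
          by blast
        obtain g where g: "g \<in> chains ?p (- i + 1)" "b = ?\<Phi> (?D j0 g)" using bz(1) unfolding B_def by blast
        obtain h where h: "h \<in> chains ?p (- i + 1)" "y = ?\<Phi> (?D j0 h)"
          using subsetD[OF XT bz(2)] unfolding B_def by blast
        have gh: "g \<in> chains ?p (- i + 1)" "h \<in> chains ?p (- i + 1)" "z = ?\<Phi> (?D j0 g) \<oplus>\<^bsub>?M\<^esub> ?\<Phi> (?D j0 h)"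
          using g h bz(3) by simp_all
        then have "z = ?\<Phi> (?D j0 (\<lambda>l. g l \<oplus> h l))" using addB by simp
        then show "z \<in> B j0" unfolding B_def using chains_add[OF gh(1,2)] by simp
      next
        fix z assume "z \<in> B j0"
        then obtain g where g: "g \<in> chains ?p (- i + 1)" "z = ?\<Phi> (?D j0 g)" unfolding B_def by blast
        have "?\<Phi> (?D j1 (\<lambda>_. \<zero>)) \<oplus>\<^bsub>?M\<^esub> ?\<Phi> f \<in> X" unfolding X B_def using chains_zero by blast
        then obtain y where y: "y \<in> koszul_transition R as j1 j0 i ` X" by blast
        then obtain h where h: "h \<in> chains ?p (- i + 1)" "y = ?\<Phi> (?D j0 h)" using subsetD[OF XT y] unfolding B_def by blast
        let ?d = "\<lambda>l. g l \<ominus> h l"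
        have d: "?d \<in> chains ?p (- i + 1)" by (rule chains_minus[OF g(1) h(1)])
        have "(\<lambda>l. ?d l \<oplus> h l) = g"
        proof
          fix l
          have "g l \<in> carrier R" "h l \<in> carrier R" using g h chains_carr by blast+
          then show "?d l \<oplus> h l = g l" by (simp add: minus_eq a_assoc l_neg)
        qed
        then have "?\<Phi> (?D j0 ?d) \<oplus>\<^bsub>?M\<^esub> y = z" using addB[OF d h(1)] g h by simp
        moreover have "?\<Phi> (?D j0 ?d) \<in> B j0" unfolding B_def using d by blast
        ultimately show "z \<in> {b \<oplus>\<^bsub>?M\<^esub> y | b y. b \<in> B j0 \<and> y \<in> koszul_transition R as j1 j0 i ` X}" using y by blast
      qed
      then show "cohomology_map (?K j0) (koszul_transition R as j1 j0) i X = \<zero>\<^bsub>cohomology (?K j0) i\<^esub>"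
        unfolding cmap zero .
    qed
  qed
  note step = this
  show ?thesis unfolding pro_zero_def by (intro all_cong1 imp_cong refl ex_cong1 conj_cong step)
qed

theorem weakly_proregular_seq_iff:
  "weakly_proregular_seq R as \<longleftrightarrow> as \<noteq> [] \<and> set as \<subseteq> carrier R \<and> koszul_pro_zero R as"
proof (cases "set as \<subseteq> carrier R")
  case True
  have reindex: "(\<forall>i\<le>-1. P (- i)) \<longleftrightarrow> (\<forall>s\<ge>1. P s)" for P :: "int \<Rightarrow> bool"
  proof
    assume *: "\<forall>i\<le>-1. P (- i)"
    show "\<forall>s\<ge>1. P s" using *[rule_format, of "- s" for s] by simp
  qed simp
  define Q where "Q s \<longleftrightarrow> (\<forall>j0\<ge>1. \<exists>j1\<ge>j0. \<forall>f\<in>chains (length as) s.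
        kdiff R (seq_power R as j1) f = (\<lambda>_. \<zero>) \<longrightarrow>
        (\<exists>h\<in>chains (length as) (s + 1).
           kscale R (seq_power R as (j1 - j0)) f = kdiff R (seq_power R as j0) h))" for s
  have "weakly_proregular_seq R as \<longleftrightarrow> as \<noteq> [] \<and> set as \<subseteq> carrier R \<and> (\<forall>i\<le>-1. Q (- i))"
    unfolding weakly_proregular_seq_def cohomology_pro_zero_iff[OF True] Q_def ..
  moreover have "koszul_pro_zero R as \<longleftrightarrow> (\<forall>s\<ge>1. Q s)" unfolding koszul_pro_zero_def Q_def ..
  ultimately show ?thesis by (simp only: reindex)
qed (simp add: weakly_proregular_seq_def)

end

section \<open>Completion of a weakly proregular ideal\<close>

theorem theorem0p8:
  fixes A :: "('a, 'r) ring_scheme" and I :: "'a set"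
  assumes "cring A"
    and "weakly_proregular_ideal A I"
  shows "weakly_proregular_ideal (adic_completion A I) (completed_ideal A I)"
proof -
  interpret A: cring A by fact
  obtain as where as: "weakly_proregular_seq A as" and I: "I = Idl\<^bsub>A\<^esub> (set as)"
    using assms(2) unfolding weakly_proregular_ideal_def by blast
  have seq: "as \<noteq> []" "set as \<subseteq> carrier A" "koszul_pro_zero A as"
    using as unfolding A.weakly_proregular_seq_iff by blast+
  interpret adic_ring A I
    using A.genideal_ideal[OF seq(2)] assms(1) by (simp add: adic_ring_def adic_ring_axioms_def I)
  interpret C: cring "adic_completion A I" by (rule completion_cring)
  let ?cas = "map (completion_map A I) as"
  have "set ?cas \<subseteq> carrier (adic_completion A I)" using seq(2) completion_map_closed by auto
  then have "weakly_proregular_seq (adic_completion A I) ?cas"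
    unfolding C.weakly_proregular_seq_iff
    using seq(1) A.koszul_pro_zero_completion[OF seq(2,1,3)] by (simp add: I)
  moreover have "completed_ideal A I = Idl\<^bsub>adic_completion A I\<^esub> (set ?cas)"
    unfolding I by (rule A.completed_ideal_generators[OF seq(2)])
  ultimately show ?thesis unfolding weakly_proregular_ideal_def by blast
qed

end
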